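(* Let $G$ and $H$ be locally compact, locally Hausdorff, étale groupoids with locally compact Hausdorff unit spaces, let $Z$ be a groupoid correspondence from $G$ to $H$, and let $p\in[1,\infty]$. The $\mathcal C(H)$-actions $$(\phi\cdot b)(z)=\sum_{r(\eta)=s_Z(z)}\phi(z\eta)b(\eta^{-1}),\qquad(b\cdot\psi)(\bar z)=\sum_{r(\eta)=s_Z(z)}b(\eta)\psi(\overline{z\eta})$$ ($b\in\mathcal C(H)$, $\phi\in\mathcal C(Z)$, $\psi\in\mathcal C(Z^{op})$) extend to make $(\mathsf X_Z,\mathsf Y_Z)$ a nondegenerate Banach $F^p_{\mathrm{red}}(H)$-pair. On the dense subspaces, its pairing is given by $$\langle\psi,\phi\rangle_H(\eta)=\sum_{s_Z(w)=r(\eta)}\psi(\overline w)\,\phi(w\eta)\qquad(\eta\in H);$$ equivalently, writing $B=F^p_{\mathrm{red}}(H)$, $\langle S_\psi,T_\phi\rangle_B=S_\psi T_\phi=\lambda_H^p(\langle\psi,\phi\rangle_H)$.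
   Context: For a locally compact, locally Hausdorff space $X$, $\mathcal C(X)=\mathrm{span}\{f\in C_c(U):U\subseteq X\text{ open Hausdorff}\}$ (extension by zero). $\mathcal C(H)$ is an algebra under $(f*g)(\gamma)=\sum_{r(\eta)=r(\gamma)}f(\eta)g(\eta^{-1}\gamma)$. With $H_v=s^{-1}(v)$, put $E_H^p=\bigoplus^p_{v\in H^{(0)}}\ell^p(H_v)$ ($\ell^\infty$-sum if $p=\infty$) and let $\lambda_H^p$ be the representation of $\mathcal C(H)$ on $E_H^p$, $(\lambda_H^p(f)\xi)(h)=\sum_{r(\eta)=r(h)}f(\eta)\xi(\eta^{-1}h)$. $F^p_{\mathrm{red}}(H)$ is the completion of $\mathcal C(H)$ in $\|f\|=\|\lambda_H^p(f)\|$ and is identified with the closure of $\lambda_H^p(\mathcal C(H))$. A groupoid correspondence from $G$ to $H$ is a topological space $Z$ with commuting continuous left $G$-action (anchor $r_Z:Z\to G^{(0)}$, continuous, not necessarily open) and continuous right $H$-action (anchor $s_Z:Z\to H^{(0)}$) such that $s_Z$ is a local homeomorphism and the right $H$-action is free ($zh=z$ implies $h=s_Z(z)$) and proper ($(z,h)\mapsto(zh,z)$ is a proper map into $Z\times Z$: closed, with compact inverse images of compact sets). $Z^{op}=\{\bar z:z\in Z\}$ is a homeomorphic copy of $Z$. With $Z_v=s_Z^{-1}(v)$ (discrete), put $E_Z^p=\bigoplus^p_{v\in H^{(0)}}\ell^p(Z_v)$. For $\phi\in\mathcal C(Z)$ and $\psi\in\mathcal C(Z^{op})$ define bounded operators $T_\phi:E_H^p\to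 E_Z^p$, $(T_\phi\xi)(z)=\sum_{h\in H_{s_Z(z)}}\phi(zh^{-1})\xi(h)$, and $S_\psi:E_Z^p\to E_H^p$, $(S_\psi\zeta)(h)=\sum_{z\in Z_{s(h)}}\psi(\overline{zh^{-1}})\zeta(z)$. The maps $\phi\mapsto T_\phi$, $\psi\mapsto S_\psi$ are injective. $\mathsf Y_Z$ and $\mathsf X_Z$ are the completions of $\mathcal C(Z)$ and $\mathcal C(Z^{op})$ in the norms $\|\phi\|=\|T_\phi\|$, $\|\psi\|=\|S_\psi\|$, identified with the operator-norm closures of $\{T_\phi\}$, $\{S_\psi\}$. A Banach $B$-pair $(\mathsf X,\mathsf Y)$ is a left Banach $B$-module $\mathsf X$ and a right Banach $B$-module $\mathsf Y$ (contractive actions) with a bilinear map $\langle\cdot,\cdot\rangle_B:\mathsf X\times\mathsf Y\to B$ satisfying $\langle bx,y\rangle=b\langle x,y\rangle$, $\langle x,yb\rangle=\langle x,y\rangle b$, $\|\langle x,y\rangle\|\le\|x\|\|y\|$. It is nondegenerate if $\mathrm{span}(B\mathsf X)$ is dense in $\mathsf X$ and $\mathrm{span}(\mathsf YB)$ is dense in $\mathsf Y$. *)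

theory Defs
  imports "HOL-Analysis.Analysis" "HOL-Library.Function_Algebras"
begin

section \<open>The function space C(X) of a locally Hausdorff space\<close>

definition local_homeomorphism :: "'a topology \<Rightarrow> 'b topology \<Rightarrow> ('a \<Rightarrow> 'b) \<Rightarrow> bool" where
  "local_homeomorphism X Y f \<longleftrightarrow>
     continuous_map X Y f \<and>
     (\<forall>x \<in> topspace X. \<exists>U. openin X U \<and> x \<in> U \<and> openin Y (f ` U) \<and>
        homeomorphic_map (subtopology X U) (subtopology Y (f ` U)) f)"

definition locally_Hausdorff :: "'a topology \<Rightarrow> bool" where
  "locally_Hausdorff X \<longleftrightarrow>
     (\<forall>x \<in> topspace X. \<exists>U. openin X U \<and> x \<in> U \<and> Hausdorff_space (subtopology X U))"

text \<open>Functions in \<open>C\<^sub>c(U)\<close>, extended by zero. The extension need not be continuous on X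
  when X is not Hausdorff; the support is the closure relative to U.\<close>

definition Cc_on :: "'a topology \<Rightarrow> 'a set \<Rightarrow> ('a \<Rightarrow> complex) set" where
  "Cc_on X U =
     {f. continuous_map (subtopology X U) euclidean f \<and>
         compactin (subtopology X U) (subtopology X U closure_of {x \<in> U. f x \<noteq> 0}) \<and>
         (\<forall>x. x \<notin> U \<longrightarrow> f x = 0)}"

definition fscale :: "complex \<Rightarrow> ('a \<Rightarrow> complex) \<Rightarrow> 'a \<Rightarrow> complex" where
  "fscale c f = (\<lambda>x. c * f x)"

definition Cfun :: "'a topology \<Rightarrow> ('a \<Rightarrow> complex) set" where
  "Cfun X = module.span fscale
     (\<Union>{Cc_on X U | U. openin X U \<and> Hausdorff_space (subtopology X U)})"


section \<open>Etale groupoids and groupoid correspondences\<close>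

text \<open>The arrows are the points of the topology. Units are identity arrows, so the unit space
  is a subspace of the arrow space. The product \<open>gmul G g h\<close> is meaningful
  only when \<open>gsrc G g = grng G h\<close>.\<close>

record 'g groupoid =
  gtop :: "'g topology"
  gmul :: "'g \<Rightarrow> 'g \<Rightarrow> 'g"
  ginv :: "'g \<Rightarrow> 'g"
  gsrc :: "'g \<Rightarrow> 'g"
  grng :: "'g \<Rightarrow> 'g"

definition arrows :: "'g groupoid \<Rightarrow> 'g set" where
  "arrows G = topspace (gtop G)"

definition units :: "'g groupoid \<Rightarrow> 'g set" where
  "units G = {u \<in> arrows G. gsrc G u = u \<and> grng G u = u}"

definition unit_top :: "'g groupoid \<Rightarrow> 'g topology" where
  "unit_top G = subtopology (gtop G) (units G)"

locale algebraic_groupoid =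
  fixes G :: "'g groupoid"
  assumes src_unit: "g \<in> arrows G \<Longrightarrow> gsrc G g \<in> units G"
    and rng_unit: "g \<in> arrows G \<Longrightarrow> grng G g \<in> units G"
    and mul_closed: "\<lbrakk>g \<in> arrows G; h \<in> arrows G; gsrc G g = grng G h\<rbrakk> \<Longrightarrow> gmul G g h \<in> arrows G"
    and src_mul: "\<lbrakk>g \<in> arrows G; h \<in> arrows G; gsrc G g = grng G h\<rbrakk> \<Longrightarrow> gsrc G (gmul G g h) = gsrc G h"
    and rng_mul: "\<lbrakk>g \<in> arrows G; h \<in> arrows G; gsrc G g = grng G h\<rbrakk> \<Longrightarrow> grng G (gmul G g h) = grng G g"
    and mul_assoc: "\<lbrakk>g \<in> arrows G; h \<in> arrows G; k \<in> arrows G; gsrc G g = grng G h; gsrc G h = grng G k\<rbrakk>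
          \<Longrightarrow> gmul G (gmul G g h) k = gmul G g (gmul G h k)"
    and mul_src: "g \<in> arrows G \<Longrightarrow> gmul G g (gsrc G g) = g"
    and rng_mul_self: "g \<in> arrows G \<Longrightarrow> gmul G (grng G g) g = g"
    and inv_closed: "g \<in> arrows G \<Longrightarrow> ginv G g \<in> arrows G"
    and src_inv: "g \<in> arrows G \<Longrightarrow> gsrc G (ginv G g) = grng G g"
    and rng_inv: "g \<in> arrows G \<Longrightarrow> grng G (ginv G g) = gsrc G g"
    and mul_inv: "g \<in> arrows G \<Longrightarrow> gmul G g (ginv G g) = grng G g"
    and inv_mul: "g \<in> arrows G \<Longrightarrow> gmul G (ginv G g) g = gsrc G g"

locale topological_groupoid = algebraic_groupoid +
  assumes mul_continuous:
      "continuous_map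
         (subtopology (prod_topology (gtop G) (gtop G)) {(g, h). gsrc G g = grng G h})
         (gtop G) (\<lambda>(g, h). gmul G g h)"
    and inv_continuous: "continuous_map (gtop G) (gtop G) (ginv G)"

locale lc_etale_groupoid = topological_groupoid +
  assumes src_local_homeo: "local_homeomorphism (gtop G) (unit_top G) (gsrc G)"
    and rng_local_homeo: "local_homeomorphism (gtop G) (unit_top G) (grng G)"
    and locally_compact: "locally_compact_space (gtop G)"
    and locally_Hausdorff: "locally_Hausdorff (gtop G)"
    and unit_locally_compact: "locally_compact_space (unit_top G)"
    and unit_Hausdorff: "Hausdorff_space (unit_top G)"

record ('g, 'h, 'z) correspondence =
  ctop :: "'z topology"
  crng :: "'z \<Rightarrow> 'g"
  csrc :: "'z \<Rightarrow> 'h"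
  lact :: "'g \<Rightarrow> 'z \<Rightarrow> 'z"
  ract :: "'z \<Rightarrow> 'h \<Rightarrow> 'z"

definition cpts :: "('g, 'h, 'z) correspondence \<Rightarrow> 'z set" where
  "cpts Z = topspace (ctop Z)"

definition ract_dom :: "'h groupoid \<Rightarrow> ('g, 'h, 'z) correspondence \<Rightarrow> ('z \<times> 'h) topology" where
  "ract_dom H Z = subtopology (prod_topology (ctop Z) (gtop H)) {(z, h). csrc Z z = grng H h}"

definition lact_dom :: "'g groupoid \<Rightarrow> ('g, 'h, 'z) correspondence \<Rightarrow> ('g \<times> 'z) topology" where
  "lact_dom G Z = subtopology (prod_topology (gtop G) (ctop Z)) {(g, z). gsrc G g = crng Z z}"

text \<open>Closedness with compact fibres, as in \<open>proper_map\<close>, gives compact preimages of all compact sets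
  (\<open>proper_map_alt\<close>). Z itself is assumed neither Hausdorff nor locally compact; both hold locally
  because \<open>csrc Z\<close> is a local homeomorphism.\<close>

locale groupoid_correspondence =
  fixes G :: "'g groupoid" and H :: "'h groupoid" and Z :: "('g, 'h, 'z) correspondence"
  assumes crng_continuous: "continuous_map (ctop Z) (unit_top G) (crng Z)"
    and lact_continuous: "continuous_map (lact_dom G Z) (ctop Z) (\<lambda>(g, z). lact Z g z)"
    and crng_lact: "\<lbrakk>g \<in> arrows G; z \<in> cpts Z; gsrc G g = crng Z z\<rbrakk> \<Longrightarrow> crng Z (lact Z g z) = grng G g"
    and lact_unit: "z \<in> cpts Z \<Longrightarrow> lact Z (crng Z z) z = z"
    and lact_mul: "\<lbrakk>g \<in> arrows G; g' \<in> arrows G; z \<in> cpts Z; gsrc G g = grng G g'; gsrc G g' = crng Z z\<rbrakk>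
          \<Longrightarrow> lact Z (gmul G g g') z = lact Z g (lact Z g' z)"
    and csrc_local_homeo: "local_homeomorphism (ctop Z) (unit_top H) (csrc Z)"
    and ract_continuous: "continuous_map (ract_dom H Z) (ctop Z) (\<lambda>(z, h). ract Z z h)"
    and csrc_ract: "\<lbrakk>z \<in> cpts Z; h \<in> arrows H; csrc Z z = grng H h\<rbrakk> \<Longrightarrow> csrc Z (ract Z z h) = gsrc H h"
    and ract_unit: "z \<in> cpts Z \<Longrightarrow> ract Z z (csrc Z z) = z"
    and ract_mul: "\<lbrakk>z \<in> cpts Z; h \<in> arrows H; h' \<in> arrows H; csrc Z z = grng H h; gsrc H h = grng H h'\<rbrakk>
          \<Longrightarrow> ract Z z (gmul H h h') = ract Z (ract Z z h) h'"
    and csrc_lact: "\<lbrakk>g \<in> arrows G; z \<in> cpts Z; gsrc G g = crng Z z\<rbrakk> \<Longrightarrow> csrc Z (lact Z g z) = csrc Z z"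
    and crng_ract: "\<lbrakk>z \<in> cpts Z; h \<in> arrows H; csrc Z z = grng H h\<rbrakk> \<Longrightarrow> crng Z (ract Z z h) = crng Z z"
    and actions_commute: "\<lbrakk>g \<in> arrows G; z \<in> cpts Z; h \<in> arrows H; gsrc G g = crng Z z; csrc Z z = grng H h\<rbrakk>
          \<Longrightarrow> ract Z (lact Z g z) h = lact Z g (ract Z z h)"
    and ract_free: "\<lbrakk>z \<in> cpts Z; h \<in> arrows H; csrc Z z = grng H h; ract Z z h = z\<rbrakk> \<Longrightarrow> h = csrc Z z"
    and ract_proper: "proper_map (ract_dom H Z) (prod_topology (ctop Z) (ctop Z)) (\<lambda>(z, h). (ract Z z h, z))"

datatype 'z opp = bar (unbar: 'z)

definition opp_top :: "'z topology \<Rightarrow> 'z opp topology" where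
  "opp_top X = pullback_topology (bar ` topspace X) unbar X"


section \<open>Banach spaces, algebras and pairs\<close>

text \<open>A normed space is a linear subspace \<open>carr V\<close> of a complex vector space (the whole type with
  scalar multiplication \<open>scal V\<close>), together with a norm defined on that subspace.\<close>

record 'v nspace =
  carr :: "'v set"
  scal :: "complex \<Rightarrow> 'v \<Rightarrow> 'v"
  vnorm :: "'v \<Rightarrow> real"

definition banach_space :: "('v::ab_group_add) nspace \<Rightarrow> bool" where
  "banach_space V \<longleftrightarrow>
     vector_space (scal V) \<and> module.subspace (scal V) (carr V) \<and>
     (\<forall>x \<in> carr V. 0 \<le> vnorm V x \<and> (vnorm V x = 0 \<longleftrightarrow> x = 0)) \<and>
     (\<forall>x \<in> carr V. \<forall>c. vnorm V (scal V c x) = cmod c * vnorm V x) \<and>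
     (\<forall>x \<in> carr V. \<forall>y \<in> carr V. vnorm V (x + y) \<le> vnorm V x + vnorm V y) \<and>
     (\<forall>\<sigma>::nat \<Rightarrow> 'v. (\<forall>n. \<sigma> n \<in> carr V) \<and>
          (\<forall>\<epsilon>>0. \<exists>N. \<forall>m\<ge>N. \<forall>n\<ge>N. vnorm V (\<sigma> m - \<sigma> n) < \<epsilon>) \<longrightarrow>
        (\<exists>x \<in> carr V. (\<lambda>n. vnorm V (\<sigma> n - x)) \<longlonglongrightarrow> 0))"

definition contractive_bilinear ::
  "('a::ab_group_add) nspace \<Rightarrow> ('b::ab_group_add) nspace \<Rightarrow> ('c::ab_group_add) nspace
    \<Rightarrow> ('a \<Rightarrow> 'b \<Rightarrow> 'c) \<Rightarrow> bool" where
  "contractive_bilinear A B C m \<longleftrightarrow>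
     (\<forall>a \<in> carr A. \<forall>b \<in> carr B. m a b \<in> carr C \<and> vnorm C (m a b) \<le> vnorm A a * vnorm B b) \<and>
     (\<forall>a \<in> carr A. \<forall>a' \<in> carr A. \<forall>b \<in> carr B. m (a + a') b = m a b + m a' b) \<and>
     (\<forall>a \<in> carr A. \<forall>b \<in> carr B. \<forall>b' \<in> carr B. m a (b + b') = m a b + m a b') \<and>
     (\<forall>a \<in> carr A. \<forall>b \<in> carr B. \<forall>c. m (scal A c a) b = scal C c (m a b) \<and>
                                     m a (scal B c b) = scal C c (m a b))"

definition banach_algebra :: "('b::ab_group_add) nspace \<Rightarrow> ('b \<Rightarrow> 'b \<Rightarrow> 'b) \<Rightarrow> bool" where
  "banach_algebra B mul \<longleftrightarrow>
     banach_space B \<and> contractive_bilinear B B B mul \<and>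
     (\<forall>a \<in> carr B. \<forall>b \<in> carr B. \<forall>c \<in> carr B. mul (mul a b) c = mul a (mul b c))"

definition left_banach_module ::
  "('b::ab_group_add) nspace \<Rightarrow> ('b \<Rightarrow> 'b \<Rightarrow> 'b) \<Rightarrow> ('x::ab_group_add) nspace \<Rightarrow> ('b \<Rightarrow> 'x \<Rightarrow> 'x) \<Rightarrow> bool" where
  "left_banach_module B mul X act \<longleftrightarrow>
     banach_space X \<and> contractive_bilinear B X X act \<and>
     (\<forall>a \<in> carr B. \<forall>b \<in> carr B. \<forall>x \<in> carr X. act (mul a b) x = act a (act b x))"

definition right_banach_module ::
  "('b::ab_group_add) nspace \<Rightarrow> ('b \<Rightarrow> 'b \<Rightarrow> 'b) \<Rightarrow> ('y::ab_group_add) nspace \<Rightarrow> ('y \<Rightarrow> 'b \<Rightarrow> 'y) \<Rightarrow> bool" where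
  "right_banach_module B mul Y act \<longleftrightarrow>
     banach_space Y \<and> contractive_bilinear Y B Y act \<and>
     (\<forall>y \<in> carr Y. \<forall>a \<in> carr B. \<forall>b \<in> carr B. act y (mul a b) = act (act y a) b)"

definition banach_pair ::
  "('b::ab_group_add) nspace \<Rightarrow> ('b \<Rightarrow> 'b \<Rightarrow> 'b)
    \<Rightarrow> ('x::ab_group_add) nspace \<Rightarrow> ('b \<Rightarrow> 'x \<Rightarrow> 'x)
    \<Rightarrow> ('y::ab_group_add) nspace \<Rightarrow> ('y \<Rightarrow> 'b \<Rightarrow> 'y)
    \<Rightarrow> ('x \<Rightarrow> 'y \<Rightarrow> 'b) \<Rightarrow> bool" where
  "banach_pair B mul X lm Y rm pr \<longleftrightarrow>
     banach_algebra B mul \<and> left_banach_module B mul X lm \<and> right_banach_module B mul Y rm \<and>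
     contractive_bilinear X Y B pr \<and>
     (\<forall>b \<in> carr B. \<forall>x \<in> carr X. \<forall>y \<in> carr Y. pr (lm b x) y = mul b (pr x y)) \<and>
     (\<forall>x \<in> carr X. \<forall>y \<in> carr Y. \<forall>b \<in> carr B. pr x (rm y b) = mul (pr x y) b)"

definition norm_closure :: "('v::ab_group_add) nspace \<Rightarrow> 'v set \<Rightarrow> 'v set" where
  "norm_closure V S = {x \<in> carr V. \<forall>\<epsilon>>0. \<exists>s \<in> S \<inter> carr V. vnorm V (x - s) < \<epsilon>}"

definition nondegenerate_pair ::
  "('b::ab_group_add) nspace \<Rightarrow> ('x::ab_group_add) nspace \<Rightarrow> ('b \<Rightarrow> 'x \<Rightarrow> 'x)
    \<Rightarrow> ('y::ab_group_add) nspace \<Rightarrow> ('y \<Rightarrow> 'b \<Rightarrow> 'y) \<Rightarrow> bool" where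
  "nondegenerate_pair B X lm Y rm \<longleftrightarrow>
     norm_closure X (module.span (scal X) {lm b x | b x. b \<in> carr B \<and> x \<in> carr X}) = carr X \<and>
     norm_closure Y (module.span (scal Y) {rm y b | y b. y \<in> carr Y \<and> b \<in> carr B}) = carr Y"

text \<open>Operators on \<open>carr E\<close> are made total by the value 0 off \<open>carr E\<close>, so that equality of
  operators is equality of functions.\<close>

definition bounded_ops ::
  "('a::ab_group_add) nspace \<Rightarrow> ('b::ab_group_add) nspace \<Rightarrow> ('a \<Rightarrow> 'b) nspace" where
  "bounded_ops E F =
     \<lparr>carr = {T. (\<forall>x \<in> carr E. T x \<in> carr F) \<and> (\<forall>x. x \<notin> carr E \<longrightarrow> T x = 0) \<and>
        (\<forall>x \<in> carr E. \<forall>y \<in> carr E. T (x + y) = T x + T y) \<and>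
        (\<forall>x \<in> carr E. \<forall>c. T (scal E c x) = scal F c (T x)) \<and>
        (\<exists>C. \<forall>x \<in> carr E. vnorm F (T x) \<le> C * vnorm E x)},
      scal = (\<lambda>c T x. scal F c (T x)),
      vnorm = (\<lambda>T. Inf {C. 0 \<le> C \<and> (\<forall>x \<in> carr E. vnorm F (T x) \<le> C * vnorm E x)})\<rparr>"


section \<open>Direct sums of sequence spaces\<close>

definition lp_mem :: "ennreal \<Rightarrow> 'i set \<Rightarrow> ('i \<Rightarrow> 'v::real_normed_vector) \<Rightarrow> bool" where
  "lp_mem p A f \<longleftrightarrow>
     (if p = \<infinity> then bounded (f ` A)
      else (\<lambda>i. norm (f i) powr enn2real p) summable_on A)"

text \<open>Inserting 0 only makes the supremum over the empty set 0.\<close>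

definition lp_norm :: "ennreal \<Rightarrow> 'i set \<Rightarrow> ('i \<Rightarrow> 'v::real_normed_vector) \<Rightarrow> real" where
  "lp_norm p A f =
     (if p = \<infinity> then Sup (insert 0 ((\<lambda>i. norm (f i)) ` A))
      else (\<Sum>\<^sub>\<infinity>i\<in>A. norm (f i) powr enn2real p) powr (1 / enn2real p))"

text \<open>The \<open>\<ell>\<^sup>p\<close>-sum over v in V of \<open>\<ell>\<^sup>p\<close> of the fibre of \<open>\<pi> : A \<rightarrow> V\<close> over v. A family
  \<open>(\<xi>\<^sub>v)\<close> is encoded as one function on A, the disjoint union of the fibres, extended by zero.\<close>

definition lp_sum :: "ennreal \<Rightarrow> 'v set \<Rightarrow> 'a set \<Rightarrow> ('a \<Rightarrow> 'v) \<Rightarrow> ('a \<Rightarrow> complex) nspace" where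
  "lp_sum p V A \<pi> =
     \<lparr>carr = {\<xi>. (\<forall>x. x \<notin> A \<longrightarrow> \<xi> x = 0) \<and>
        (\<forall>v \<in> V. lp_mem p {a \<in> A. \<pi> a = v} \<xi>) \<and>
        lp_mem p V (\<lambda>v. lp_norm p {a \<in> A. \<pi> a = v} \<xi>)},
      scal = fscale,
      vnorm = (\<lambda>\<xi>. lp_norm p V (\<lambda>v. lp_norm p {a \<in> A. \<pi> a = v} \<xi>))\<rparr>"

definition EH :: "ennreal \<Rightarrow> 'h groupoid \<Rightarrow> ('h \<Rightarrow> complex) nspace" where
  "EH p H = lp_sum p (units H) (arrows H) (gsrc H)"

definition EZ :: "ennreal \<Rightarrow> 'h groupoid \<Rightarrow> ('g, 'h, 'z) correspondence \<Rightarrow> ('z \<Rightarrow> complex) nspace" where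
  "EZ p H Z = lp_sum p (units H) (cpts Z) (csrc Z)"


section \<open>The algebra of H and the pair of Z\<close>

text \<open>For functions in C(H), C(Z) and C(\<open>Z\<^sup>o\<^sup>p\<close>), all sums below have only finitely many nonzero terms.\<close>

definition lam :: "ennreal \<Rightarrow> 'h groupoid \<Rightarrow> ('h \<Rightarrow> complex) \<Rightarrow> ('h \<Rightarrow> complex) \<Rightarrow> 'h \<Rightarrow> complex" where
  "lam p H f = (\<lambda>\<xi> h. if \<xi> \<in> carr (EH p H) \<and> h \<in> arrows H
     then \<Sum>\<^sub>\<infinity>\<eta>\<in>{\<eta> \<in> arrows H. grng H \<eta> = grng H h}. f \<eta> * \<xi> (gmul H (ginv H \<eta>) h)
     else 0)"

definition Top :: "ennreal \<Rightarrow> 'h groupoid \<Rightarrow> ('g, 'h, 'z) correspondence \<Rightarrow> ('z \<Rightarrow> complex)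
    \<Rightarrow> ('h \<Rightarrow> complex) \<Rightarrow> 'z \<Rightarrow> complex" where
  "Top p H Z \<phi> = (\<lambda>\<xi> z. if \<xi> \<in> carr (EH p H) \<and> z \<in> cpts Z
     then \<Sum>\<^sub>\<infinity>h\<in>{h \<in> arrows H. gsrc H h = csrc Z z}. \<phi> (ract Z z (ginv H h)) * \<xi> h
     else 0)"

definition Sop :: "ennreal \<Rightarrow> 'h groupoid \<Rightarrow> ('g, 'h, 'z) correspondence \<Rightarrow> ('z opp \<Rightarrow> complex)
    \<Rightarrow> ('z \<Rightarrow> complex) \<Rightarrow> 'h \<Rightarrow> complex" where
  "Sop p H Z \<psi> = (\<lambda>\<zeta> h. if \<zeta> \<in> carr (EZ p H Z) \<and> h \<in> arrows H
     then \<Sum>\<^sub>\<infinity>z\<in>{z \<in> cpts Z. csrc Z z = gsrc H h}. \<psi> (bar (ract Z z (ginv H h))) * \<zeta> z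
     else 0)"

text \<open>The completions of C(H), C(Z) and C(\<open>Z\<^sup>o\<^sup>p\<close>) are realised as norm closures of the
  operators representing them; the product of \<open>Fred p H\<close> is composition.\<close>

definition Fred :: "ennreal \<Rightarrow> 'h groupoid \<Rightarrow> (('h \<Rightarrow> complex) \<Rightarrow> 'h \<Rightarrow> complex) nspace" where
  "Fred p H = (let W = bounded_ops (EH p H) (EH p H) in
     W\<lparr>carr := norm_closure W (lam p H ` Cfun (gtop H))\<rparr>)"

definition Ymod :: "ennreal \<Rightarrow> 'h groupoid \<Rightarrow> ('g, 'h, 'z) correspondence
    \<Rightarrow> (('h \<Rightarrow> complex) \<Rightarrow> 'z \<Rightarrow> complex) nspace" where
  "Ymod p H Z = (let W = bounded_ops (EH p H) (EZ p H Z) in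
     W\<lparr>carr := norm_closure W (Top p H Z ` Cfun (ctop Z))\<rparr>)"

definition Xmod :: "ennreal \<Rightarrow> 'h groupoid \<Rightarrow> ('g, 'h, 'z) correspondence
    \<Rightarrow> (('z \<Rightarrow> complex) \<Rightarrow> 'h \<Rightarrow> complex) nspace" where
  "Xmod p H Z = (let W = bounded_ops (EZ p H Z) (EH p H) in
     W\<lparr>carr := norm_closure W (Sop p H Z ` Cfun (opp_top (ctop Z)))\<rparr>)"

definition right_C_act :: "'h groupoid \<Rightarrow> ('g, 'h, 'z) correspondence
    \<Rightarrow> ('z \<Rightarrow> complex) \<Rightarrow> ('h \<Rightarrow> complex) \<Rightarrow> 'z \<Rightarrow> complex" where
  "right_C_act H Z \<phi> b = (\<lambda>z. if z \<in> cpts Z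
     then \<Sum>\<^sub>\<infinity>\<eta>\<in>{\<eta> \<in> arrows H. grng H \<eta> = csrc Z z}. \<phi> (ract Z z \<eta>) * b (ginv H \<eta>)
     else 0)"

definition left_C_act :: "'h groupoid \<Rightarrow> ('g, 'h, 'z) correspondence
    \<Rightarrow> ('h \<Rightarrow> complex) \<Rightarrow> ('z opp \<Rightarrow> complex) \<Rightarrow> 'z opp \<Rightarrow> complex" where
  "left_C_act H Z b \<psi> = (\<lambda>w. if unbar w \<in> cpts Z
     then \<Sum>\<^sub>\<infinity>\<eta>\<in>{\<eta> \<in> arrows H. grng H \<eta> = csrc Z (unbar w)}. b \<eta> * \<psi> (bar (ract Z (unbar w) \<eta>))
     else 0)"

definition C_pairing :: "'h groupoid \<Rightarrow> ('g, 'h, 'z) correspondence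
    \<Rightarrow> ('z opp \<Rightarrow> complex) \<Rightarrow> ('z \<Rightarrow> complex) \<Rightarrow> 'h \<Rightarrow> complex" where
  "C_pairing H Z \<psi> \<phi> = (\<lambda>\<eta>. if \<eta> \<in> arrows H
     then \<Sum>\<^sub>\<infinity>w\<in>{w \<in> cpts Z. csrc Z w = grng H \<eta>}. \<psi> (bar w) * \<phi> (ract Z w \<eta>)
     else 0)"

end

theory Submission
  imports Defs
begin

text \<open>All three kinds of operators are given by matrices: \<open>\<phi>\<close> in \<open>C(Z)\<close> acts with the entry
  \<open>\<phi>(zh\<^sup>-\<^sup>1)\<close> in row \<open>z\<close> and column \<open>h\<close>, and \<open>\<psi>\<close> in \<open>C(Z\<^sup>o\<^sup>p)\<close> with the transposed pattern; \<open>\<lambda>(b)\<close> is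
  the case of \<open>H\<close> acting on itself. The actions and the pairing are then composition of operators.
  Associativity and compatibility hold for free, the estimates are submultiplicativity of
  the operator norm, and everything passes to norm closures. What remains are three points.

  Boundedness. The entries of such a matrix are bounded, and the numbers of nonzero entries in a row and
  in a column are bounded uniformly. For the columns this holds because a compact set is covered by finitely
  many sheets of the local homeomorphism \<open>s\<^sub>Z\<close>, for the rows because freeness and properness bound the
  number of points of one \<open>H\<close>-orbit in a compact set (\<open>Cfun_tame\<close>). A matrix of this kind is bounded on
  \<open>\<ell>\<^sup>p\<close> for every \<open>p\<close> (\<open>kernel_bounded\<close>).

  Closure of the function spaces. The actions and the pairing stay inside \<open>C(Z)\<close>, \<open>C(Z\<^sup>o\<^sup>p)\<close> and
  \<open>C(H)\<close>. A partition of unity on the unit space reduces this to functions supported in sheets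
  (\<open>bilinear_Cfun\<close>). For them every sum has at most one term, and the product is a continuous compactly
  supported function on an explicit open Hausdorff set (\<open>right_C_act_sheets\<close>, \<open>pairing_sheets\<close>). By
  associativity of the matrix product these functions represent the composites (\<open>Top_lam\<close>, \<open>lam_Sop\<close>,
  \<open>Sop_Top\<close>).

  Nondegeneracy. Since the unit space is open in \<open>H\<close>, a compactly supported function on it that
  equals 1 on the sources of the support of \<open>\<phi>\<close> belongs to \<open>C(H)\<close> and fixes \<open>\<phi>\<close>
  (\<open>right_local_unit\<close>, \<open>left_local_unit\<close>).\<close>

section \<open>Sequence spaces\<close>

lemma enn2real_ge_1:
  assumes "1 \<le> p" "p \<noteq> \<infinity>" shows "1 \<le> enn2real p"
  using assms by (cases p) (auto simp: ennreal_1[symmetric] simp del: ennreal_1)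

lemma powr_root_le_iff:
  fixes x C r :: real
  assumes "0 \<le> x" "0 \<le> C" "1 \<le> r"
  shows "x powr (1 / r) \<le> C \<longleftrightarrow> x \<le> C powr r"
proof
  assume "x powr (1 / r) \<le> C"
  then have "(x powr (1 / r)) powr r \<le> C powr r"
    using assms by (intro powr_mono2) auto
  then show "x \<le> C powr r" using assms by (simp add: powr_powr)
next
  assume "x \<le> C powr r"
  then have "x powr (1 / r) \<le> (C powr r) powr (1 / r)"
    using assms by (intro powr_mono2) auto
  then show "x powr (1 / r) \<le> C" using assms by (simp add: powr_powr)
qed

lemma lp_norm_finite:
  assumes "finite F" "p \<noteq> \<infinity>"
  shows "lp_norm p F f = (\<Sum>i\<in>F. norm (f i) powr enn2real p) powr (1 / enn2real p)"
  using assms by (simp add: lp_norm_def)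

lemma lp_infinity_le_iff:
  fixes f :: "'i \<Rightarrow> 'v::real_normed_vector"
  assumes "0 \<le> C"
  shows "lp_mem \<infinity> A f \<and> lp_norm \<infinity> A f \<le> C \<longleftrightarrow> (\<forall>i\<in>A. norm (f i) \<le> C)"
proof
  assume h: "lp_mem \<infinity> A f \<and> lp_norm \<infinity> A f \<le> C"
  then obtain B where B: "\<forall>i\<in>A. norm (f i) \<le> B"
    by (auto simp: lp_mem_def bounded_iff)
  then have "bdd_above (insert 0 ((\<lambda>i. norm (f i)) ` A))"
    by (auto intro!: bdd_aboveI2)
  then have "norm (f i) \<le> lp_norm \<infinity> A f" if "i \<in> A" for i
    unfolding lp_norm_def using that by (auto intro!: cSup_upper)
  with h show "\<forall>i\<in>A. norm (f i) \<le> C" by force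
next
  assume h: "\<forall>i\<in>A. norm (f i) \<le> C"
  have "lp_mem \<infinity> A f" using h by (auto simp: lp_mem_def bounded_iff)
  moreover have "Sup (insert 0 ((\<lambda>i. norm (f i)) ` A)) \<le> C"
    by (rule cSup_least) (use h assms in auto)
  ultimately show "lp_mem \<infinity> A f \<and> lp_norm \<infinity> A f \<le> C"
    by (simp add: lp_norm_def)
qed

text \<open>The finite subsets see membership and norm at once. Every later estimate on \<open>\<ell>\<^sup>p\<close> is reduced
  by this criterion to a statement about finite sums, or finite maxima.\<close>

lemma lp_le_iff:
  fixes f :: "'i \<Rightarrow> 'v::real_normed_vector"
  assumes p: "1 \<le> p" and C: "0 \<le> C"
  shows "lp_mem p A f \<and> lp_norm p A f \<le> C \<longleftrightarrow> (\<forall>F. finite F \<and> F \<subseteq> A \<longrightarrow> lp_norm p F f \<le> C)"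
proof (cases "p = \<infinity>")
  case True
  have fin: "lp_norm \<infinity> F f \<le> C \<longleftrightarrow> (\<forall>i\<in>F. norm (f i) \<le> C)" if "finite F" for F
    using lp_infinity_le_iff[OF C, of F f] that by (auto simp: lp_mem_def)
  show ?thesis
    unfolding True lp_infinity_le_iff[OF C]
  proof
    assume "\<forall>i\<in>A. norm (f i) \<le> C"
    then show "\<forall>F. finite F \<and> F \<subseteq> A \<longrightarrow> lp_norm \<infinity> F f \<le> C" using fin by blast
  next
    assume h: "\<forall>F. finite F \<and> F \<subseteq> A \<longrightarrow> lp_norm \<infinity> F f \<le> C"
    show "\<forall>i\<in>A. norm (f i) \<le> C"
      using h fin[of "{_}"] by auto
  qed
next
  case False
  define r where "r = enn2real p"
  have r: "1 \<le> r" using enn2real_ge_1[OF p False] r_def by simp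
  let ?g = "\<lambda>i. norm (f i) powr r"
  have mem: "lp_mem p A f \<longleftrightarrow> ?g summable_on A" using False by (simp add: lp_mem_def r_def)
  have nrm: "lp_norm p A f \<le> C \<longleftrightarrow> infsum ?g A \<le> C powr r"
    using False by (simp add: lp_norm_def r_def[symmetric] powr_root_le_iff C r infsum_nonneg)
  have fin: "lp_norm p F f \<le> C \<longleftrightarrow> sum ?g F \<le> C powr r" if "finite F" for F
    using that False by (simp add: lp_norm_finite r_def[symmetric] powr_root_le_iff C r sum_nonneg)
  show ?thesis
  proof
    assume h: "lp_mem p A f \<and> lp_norm p A f \<le> C"
    then have "sum ?g F \<le> infsum ?g A" if "finite F" "F \<subseteq> A" for F
      using that mem by (intro finite_sum_le_infsum) auto
    then show "\<forall>F. finite F \<and> F \<subseteq> A \<longrightarrow> lp_norm p F f \<le> C"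
      using h nrm fin by fastforce
  next
    assume h: "\<forall>F. finite F \<and> F \<subseteq> A \<longrightarrow> lp_norm p F f \<le> C"
    then have b: "sum ?g F \<le> C powr r" if "finite F" "F \<subseteq> A" for F
      using fin that by blast
    have s: "?g summable_on A"
      by (rule nonneg_bdd_above_summable_on) (auto intro!: bdd_aboveI2 b)
    with infsum_le_finite_sums[OF s b] show "lp_mem p A f \<and> lp_norm p A f \<le> C"
      using mem nrm by blast
  qed
qed

lemma lp_norm_nonneg:
  assumes "lp_mem p A f" shows "0 \<le> lp_norm p A f"
proof (cases "p = \<infinity>")
  case True
  with assms obtain B where "\<forall>i\<in>A. norm (f i) \<le> B"
    by (auto simp: lp_mem_def bounded_iff)
  then have "bdd_above (insert 0 ((\<lambda>i. norm (f i)) ` A))"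
    by (auto intro!: bdd_aboveI2)
  then show ?thesis
    using True by (auto simp: lp_norm_def intro!: cSup_upper)
qed (simp add: lp_norm_def)

lemma lp_mem_finite: "finite F \<Longrightarrow> lp_mem p F f"
  by (simp add: lp_mem_def finite_imp_bounded)

lemma lp_norm_leI:
  fixes f :: "'i \<Rightarrow> 'v::real_normed_vector"
  assumes "1 \<le> p" "0 \<le> C" "\<And>F. finite F \<Longrightarrow> F \<subseteq> A \<Longrightarrow> lp_norm p F f \<le> C"
  shows "lp_mem p A f" "lp_norm p A f \<le> C"
  using lp_le_iff[OF assms(1,2), of A f] assms(3) by auto

lemma lp_norm_finite_le:
  fixes f :: "'i \<Rightarrow> 'v::real_normed_vector"
  assumes "1 \<le> p" "lp_mem p A f" "finite F" "F \<subseteq> A"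
  shows "lp_norm p F f \<le> lp_norm p A f"
  using lp_le_iff[OF assms(1) lp_norm_nonneg[OF assms(2)], of A f] assms by auto

lemma lp_norm_single:
  fixes f :: "'i \<Rightarrow> 'v::real_normed_vector"
  assumes "1 \<le> p"
  shows "lp_norm p {i} f = norm (f i)"
proof (cases "p = \<infinity>")
  case True
  then show ?thesis by (simp add: lp_norm_def cSup_eq_Max)
next
  case False
  then show ?thesis using enn2real_ge_1[OF assms False] by (simp add: lp_norm_finite powr_powr)
qed

lemma lp_point_le:
  fixes f :: "'i \<Rightarrow> 'v::real_normed_vector"
  assumes "1 \<le> p" "lp_mem p A f" "i \<in> A"
  shows "norm (f i) \<le> lp_norm p A f"
  using lp_norm_finite_le[OF assms(1,2), of "{i}"] assms by (simp add: lp_norm_single)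

lemma lp_scale:
  fixes f :: "'i \<Rightarrow> complex"
  assumes "1 \<le> p" "lp_mem p A f"
  shows "lp_mem p A (\<lambda>i. c * f i)" "lp_norm p A (\<lambda>i. c * f i) = cmod c * lp_norm p A f"
proof -
  have le: "lp_mem p A (\<lambda>i. c * f i) \<and> lp_norm p A (\<lambda>i. c * f i) \<le> cmod c * lp_norm p A f"
    if f: "lp_mem p A f" for f :: "'i \<Rightarrow> complex" and c
  proof (cases "p = \<infinity>")
    case True
    have "cmod (c * f i) \<le> cmod c * lp_norm p A f" if "i \<in> A" for i
      using lp_point_le[OF assms(1) f that] by (simp add: norm_mult mult_left_mono)
    then show ?thesis
      using lp_infinity_le_iff[of "cmod c * lp_norm p A f" A "\<lambda>i. c * f i"] lp_norm_nonneg[OF f] True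
      by simp
  next
    case False
    define r where "r = enn2real p"
    have r: "1 \<le> r" using enn2real_ge_1[OF assms(1) False] r_def by simp
    have e: "cmod (c * f i) powr r = cmod c powr r * cmod (f i) powr r" for i
      by (simp add: norm_mult powr_mult)
    have "(\<lambda>i. cmod c powr r * cmod (f i) powr r) summable_on A"
      using f False by (intro summable_on_cmult_right) (simp add: lp_mem_def r_def)
    then show ?thesis
      using False r by (simp add: lp_mem_def lp_norm_def r_def[symmetric] e infsum_cmult_right'
          powr_mult infsum_nonneg powr_powr)
  qed
  show m: "lp_mem p A (\<lambda>i. c * f i)" using le assms by blast
  show "lp_norm p A (\<lambda>i. c * f i) = cmod c * lp_norm p A f"
  proof (cases "c = 0")
    case True
    then show ?thesis using le[OF assms(2), of c] lp_norm_nonneg[OF m] by simp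
  next
    case False
    have "lp_norm p A f \<le> inverse (cmod c) * lp_norm p A (\<lambda>i. c * f i)"
      using le[OF m, of "inverse c"] False by (simp add: norm_inverse mult.assoc[symmetric])
    then have "cmod c * lp_norm p A f \<le> lp_norm p A (\<lambda>i. c * f i)"
      using False by (simp add: field_simps)
    then show ?thesis using le[OF assms(2), of c] by linarith
  qed
qed

lemma powr_convex_combination:
  fixes x y t r :: real
  assumes "0 \<le> x" "0 \<le> y" "0 \<le> t" "t \<le> 1" "1 \<le> r"
  shows "((1 - t) * x + t * y) powr r \<le> (1 - t) * x powr r + t * y powr r"
proof -
  have contraction: "(s * z) powr r \<le> s * z powr r" if "0 \<le> s" "s \<le> 1" "0 \<le> z" for s z :: real
  proof -
    have "s powr r \<le> s"
      using powr_mono'[of 1 r s] that assms by (cases "s = 0") auto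
    then show ?thesis using that by (simp add: powr_mult mult_right_mono)
  qed
  consider "x = 0" | "y = 0" | "0 < x" "0 < y" using assms by linarith
  then show ?thesis
  proof cases
    case 3
    then show ?thesis
      using convex_onD[OF powr_convex[OF assms(5)], of t x y] assms by simp
  qed (use contraction[of t y] contraction[of "1 - t" x] assms in auto)
qed

text \<open>Minkowski's inequality. Both functions are normalised by their bounds, and the normalised
  sum is then a convex combination to which convexity of the power function applies pointwise.\<close>

lemma minkowski_sum:
  fixes f g :: "'i \<Rightarrow> complex"
  assumes r: "1 \<le> r" and a: "0 < a" and b: "0 < b"
    and f: "(\<Sum>i\<in>F. cmod (f i) powr r) \<le> a powr r"
    and g: "(\<Sum>i\<in>F. cmod (g i) powr r) \<le> b powr r"
  shows "(\<Sum>i\<in>F. cmod (f i + g i) powr r) \<le> (a + b) powr r"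
proof -
  define t where "t = b / (a + b)"
  have t: "0 \<le> t" "t \<le> 1" "1 - t = a / (a + b)" using a b by (auto simp: t_def field_simps)
  have pt: "cmod (f i + g i) powr r \<le>
      (a + b) powr r * ((1 - t) * (cmod (f i) powr r / a powr r) + t * (cmod (g i) powr r / b powr r))" for i
  proof -
    have "cmod (f i + g i) powr r \<le> (cmod (f i) + cmod (g i)) powr r"
      using r by (intro powr_mono2 norm_triangle_ineq) auto
    also have "cmod (f i) + cmod (g i) = (a + b) * ((1 - t) * (cmod (f i) / a) + t * (cmod (g i) / b))"
      unfolding t(3) using a b by (simp add: t_def distrib_left)
    also have "\<dots> powr r = (a + b) powr r * ((1 - t) * (cmod (f i) / a) + t * (cmod (g i) / b)) powr r"
      using a b t by (simp add: powr_mult)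
    also have "\<dots> \<le> (a + b) powr r * ((1 - t) * (cmod (f i) / a) powr r + t * (cmod (g i) / b) powr r)"
      using a b t r by (intro mult_left_mono powr_convex_combination) auto
    finally show ?thesis using a b by (simp add: powr_divide)
  qed
  have "(\<Sum>i\<in>F. cmod (f i + g i) powr r) \<le> (a + b) powr r * ((1 - t) * ((\<Sum>i\<in>F. cmod (f i) powr r) / a powr r)
      + t * ((\<Sum>i\<in>F. cmod (g i) powr r) / b powr r))"
    using sum_mono[where K = F, OF pt] by (simp add: sum_distrib_left sum.distrib sum_divide_distrib distrib_left)
  also have "\<dots> \<le> (a + b) powr r * ((1 - t) * 1 + t * 1)"
    using a b f g t by (intro mult_left_mono add_mono) auto
  finally show ?thesis by simp
qed

lemma lp_triangle_finite:
  fixes f g :: "'i \<Rightarrow> complex"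
  assumes p: "1 \<le> p" and F: "finite F"
  shows "lp_norm p F (\<lambda>i. f i + g i) \<le> lp_norm p F f + lp_norm p F g"
proof (cases "p = \<infinity>")
  case True
  have "cmod (f i + g i) \<le> lp_norm p F f + lp_norm p F g" if "i \<in> F" for i
    using lp_point_le[OF p lp_mem_finite[OF F] that, of f] lp_point_le[OF p lp_mem_finite[OF F] that, of g]
      norm_triangle_ineq[of "f i" "g i"] by linarith
  then show ?thesis
    using lp_infinity_le_iff[of "lp_norm p F f + lp_norm p F g" F "\<lambda>i. f i + g i"] True
      lp_norm_nonneg[OF lp_mem_finite[OF F], of p] by (metis add_nonneg_nonneg)
next
  case False
  define r where "r = enn2real p"
  have r: "1 \<le> r" using enn2real_ge_1[OF p False] r_def by simp
  have iff: "lp_norm p F f \<le> C \<longleftrightarrow> (\<Sum>i\<in>F. cmod (f i) powr r) \<le> C powr r" if "0 \<le> C" for C and f :: "'i \<Rightarrow> complex"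
    using F False by (simp add: lp_norm_finite r_def[symmetric] powr_root_le_iff that r sum_nonneg)
  have n: "0 \<le> lp_norm p F f" for f :: "'i \<Rightarrow> complex" by (simp add: F lp_mem_finite lp_norm_nonneg)
  show ?thesis
  proof (rule field_le_epsilon)
    fix e :: real assume e: "0 < e"
    let ?a = "lp_norm p F f + e / 2" and ?b = "lp_norm p F g + e / 2"
    have "0 < ?a" "0 < ?b" using n e by (auto intro: add_nonneg_pos)
    moreover from this have "(\<Sum>i\<in>F. cmod (f i) powr r) \<le> ?a powr r" "(\<Sum>i\<in>F. cmod (g i) powr r) \<le> ?b powr r"
      using iff[of ?a f] iff[of ?b g] e by auto
    ultimately have "(\<Sum>i\<in>F. cmod (f i + g i) powr r) \<le> (?a + ?b) powr r"
      by (intro minkowski_sum[OF r])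
    then have "lp_norm p F (\<lambda>i. f i + g i) \<le> ?a + ?b"
      using iff[of "?a + ?b"] \<open>0 < ?a\<close> \<open>0 < ?b\<close> by auto
    then show "lp_norm p F (\<lambda>i. f i + g i) \<le> lp_norm p F f + lp_norm p F g + e" by simp
  qed
qed

lemma lp_triangle:
  fixes f g :: "'i \<Rightarrow> complex"
  assumes p: "1 \<le> p" and f: "lp_mem p A f" and g: "lp_mem p A g"
  shows "lp_mem p A (\<lambda>i. f i + g i)" "lp_norm p A (\<lambda>i. f i + g i) \<le> lp_norm p A f + lp_norm p A g"
proof -
  have n: "0 \<le> lp_norm p A f + lp_norm p A g" using lp_norm_nonneg f g by (metis add_nonneg_nonneg)
  have b: "lp_norm p F (\<lambda>i. f i + g i) \<le> lp_norm p A f + lp_norm p A g" if F: "finite F" "F \<subseteq> A" for F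
    using lp_triangle_finite[OF p F(1), of f g] lp_norm_finite_le[OF p f F] lp_norm_finite_le[OF p g F]
    by linarith
  show "lp_mem p A (\<lambda>i. f i + g i)" "lp_norm p A (\<lambda>i. f i + g i) \<le> lp_norm p A f + lp_norm p A g"
    by (rule lp_norm_leI[OF p n b]; assumption)+
qed

text \<open>Fatou's lemma for finite sets: a norm bound survives pointwise limits.\<close>

lemma lp_norm_limit_le:
  fixes f :: "nat \<Rightarrow> 'i \<Rightarrow> complex"
  assumes p: "1 \<le> p" and F: "finite F" and C: "0 \<le> C"
    and lim: "\<And>i. i \<in> F \<Longrightarrow> (\<lambda>n. f n i) \<longlonglongrightarrow> g i"
    and b: "\<And>n. n \<ge> N \<Longrightarrow> lp_norm p F (f n) \<le> C"
  shows "lp_norm p F g \<le> C"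
proof (cases "p = \<infinity>")
  case True
  have "cmod (g i) \<le> C" if "i \<in> F" for i
  proof (rule LIMSEQ_le_const2[OF tendsto_norm[OF lim[OF that]]], intro exI allI impI)
    fix n assume "N \<le> n"
    then show "cmod (f n i) \<le> C"
      using b[of n] lp_point_le[OF p lp_mem_finite[OF F] that, of "f n"] by linarith
  qed
  then show ?thesis using lp_infinity_le_iff[OF C, of F g] True by simp
next
  case False
  define r where "r = enn2real p"
  have r: "1 \<le> r" using enn2real_ge_1[OF p False] r_def by simp
  have iff: "lp_norm p F f \<le> C \<longleftrightarrow> (\<Sum>i\<in>F. cmod (f i) powr r) \<le> C powr r" for f :: "'i \<Rightarrow> complex"
    using F False by (simp add: lp_norm_finite r_def[symmetric] powr_root_le_iff C r sum_nonneg)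
  have "(\<lambda>n. \<Sum>i\<in>F. cmod (f n i) powr r) \<longlonglongrightarrow> (\<Sum>i\<in>F. cmod (g i) powr r)"
    using r by (intro tendsto_sum tendsto_powr2 tendsto_norm lim tendsto_const) auto
  then show ?thesis
    unfolding iff using b by (intro LIMSEQ_le_const2) (auto simp: iff)
qed

text \<open>Coordinates converge by completeness of the complex numbers, and the uniform bound on the tail survives
  the limit on each finite set.\<close>

lemma lp_complete:
  fixes f :: "nat \<Rightarrow> 'i \<Rightarrow> complex"
  assumes p: "1 \<le> p" and mem: "\<And>n. lp_mem p A (f n)"
    and cauchy: "\<And>e. 0 < e \<Longrightarrow> \<exists>N. \<forall>m\<ge>N. \<forall>n\<ge>N. lp_norm p A (\<lambda>i. f m i - f n i) < e"
  obtains g where "lp_mem p A g" "\<And>i. i \<notin> A \<Longrightarrow> g i = 0"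
    "(\<lambda>n. lp_norm p A (\<lambda>i. f n i - g i)) \<longlonglongrightarrow> 0"
proof -
  have diff: "lp_mem p A (\<lambda>i. u i - v i)" if "lp_mem p A u" "lp_mem p A v" for u v :: "'i \<Rightarrow> complex"
    using lp_triangle(1)[OF p that(1) lp_scale(1)[OF p that(2), of "-1"]] by simp
  have conv: "convergent (\<lambda>n. f n i)" if "i \<in> A" for i
  proof -
    have "Cauchy (\<lambda>n. f n i)"
      unfolding Cauchy_def
    proof (intro allI impI)
      fix e :: real assume "0 < e"
      from cauchy[OF this] obtain N where N: "\<forall>m\<ge>N. \<forall>n\<ge>N. lp_norm p A (\<lambda>i. f m i - f n i) < e" by blast
      show "\<exists>N. \<forall>m\<ge>N. \<forall>n\<ge>N. dist (f m i) (f n i) < e"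
        using lp_point_le[OF p diff[OF mem mem] that] N unfolding dist_norm by (meson le_less_trans)
    qed
    then show ?thesis by (simp add: Cauchy_convergent_iff)
  qed
  define g where "g i = (if i \<in> A then lim (\<lambda>n. f n i) else 0)" for i
  have lim: "(\<lambda>n. f n i) \<longlonglongrightarrow> g i" if "i \<in> A" for i
    using conv[OF that] that by (simp add: g_def convergent_LIMSEQ_iff)
  have tail: "\<exists>N. \<forall>n\<ge>N. lp_mem p A (\<lambda>i. f n i - g i) \<and> lp_norm p A (\<lambda>i. f n i - g i) \<le> e" if e: "0 < e" for e
  proof -
    from cauchy[OF e] obtain N where N: "\<forall>m\<ge>N. \<forall>n\<ge>N. lp_norm p A (\<lambda>i. f m i - f n i) < e" by blast
    have "lp_norm p F (\<lambda>i. f n i - g i) \<le> e" if F: "finite F" "F \<subseteq> A" and n: "n \<ge> N" for F n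
    proof (rule lp_norm_limit_le[OF p F(1), where f = "\<lambda>m i. f n i - f m i" and N = N])
      show "lp_norm p F (\<lambda>i. f n i - f m i) \<le> e" if "m \<ge> N" for m
        using lp_norm_finite_le[OF p diff[OF mem mem] F, of n m] N n that by fastforce
    qed (use F lim e in \<open>auto intro!: tendsto_diff\<close>)
    then show ?thesis
      using lp_norm_leI[OF p less_imp_le[OF e], of A] by metis
  qed
  from tail[of 1] obtain N where N: "lp_mem p A (\<lambda>i. f N i - g i)" by auto
  show ?thesis
  proof (rule that)
    show "lp_mem p A g" using diff[OF mem N, of N] by simp
    show "(\<lambda>n. lp_norm p A (\<lambda>i. f n i - g i)) \<longlonglongrightarrow> 0"
    proof (rule LIMSEQ_I)
      fix e :: real assume "0 < e"
      then obtain N where N: "\<forall>n\<ge>N. lp_mem p A (\<lambda>i. f n i - g i) \<and> lp_norm p A (\<lambda>i. f n i - g i) \<le> e / 2"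
        using tail[of "e/2"] by auto
      have "norm (lp_norm p A (\<lambda>i. f n i - g i) - 0) < e" if "n \<ge> N" for n
        using N that \<open>0 < e\<close> lp_norm_nonneg[of p A "\<lambda>i. f n i - g i"] by fastforce
      then show "\<exists>N. \<forall>n\<ge>N. norm (lp_norm p A (\<lambda>i. f n i - g i) - 0) < e" by blast
    qed
  qed (simp add: g_def)
qed

text \<open>An \<open>\<ell>\<^sup>p\<close>-sum of \<open>\<ell>\<^sup>p\<close>-spaces of fibres is the \<open>\<ell>\<^sup>p\<close>-space of the total set, since the
  same exponent is used twice.\<close>

lemma lp_fibres:
  fixes \<xi> :: "'a \<Rightarrow> complex" and \<pi> :: "'a \<Rightarrow> 'v"
  assumes p: "1 \<le> p" and \<pi>: "\<pi> ` A \<subseteq> V"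
  defines "fib \<equiv> \<lambda>v. {a \<in> A. \<pi> a = v}"
  shows "(\<forall>v\<in>V. lp_mem p (fib v) \<xi>) \<and> lp_mem p V (\<lambda>v. lp_norm p (fib v) \<xi>) \<longleftrightarrow> lp_mem p A \<xi>"
    and "lp_mem p A \<xi> \<Longrightarrow> lp_norm p V (\<lambda>v. lp_norm p (fib v) \<xi>) = lp_norm p A \<xi>"
proof -
  have "((\<forall>v\<in>V. lp_mem p (fib v) \<xi>) \<and> lp_mem p V (\<lambda>v. lp_norm p (fib v) \<xi>) \<longleftrightarrow> lp_mem p A \<xi>) \<and>
    (lp_mem p A \<xi> \<longrightarrow> lp_norm p V (\<lambda>v. lp_norm p (fib v) \<xi>) = lp_norm p A \<xi>)"
  proof (cases "p = \<infinity>")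
    case True
    have iff: "(\<forall>v\<in>V. lp_mem p (fib v) \<xi>) \<and> lp_mem p V (\<lambda>v. lp_norm p (fib v) \<xi>) \<and> lp_norm p V (\<lambda>v. lp_norm p (fib v) \<xi>) \<le> C
      \<longleftrightarrow> lp_mem p A \<xi> \<and> lp_norm p A \<xi> \<le> C" if C: "0 \<le> C" for C
    proof -
      have "(\<forall>v\<in>V. lp_mem p (fib v) \<xi>) \<and> lp_mem p V (\<lambda>v. lp_norm p (fib v) \<xi>) \<and> lp_norm p V (\<lambda>v. lp_norm p (fib v) \<xi>) \<le> C
         \<longleftrightarrow> (\<forall>v\<in>V. lp_mem p (fib v) \<xi> \<and> norm (lp_norm p (fib v) \<xi>) \<le> C)"
        using lp_infinity_le_iff[OF C, of V "\<lambda>v. lp_norm p (fib v) \<xi>"] True by blast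
      also have "\<dots> \<longleftrightarrow> (\<forall>v\<in>V. lp_mem p (fib v) \<xi> \<and> lp_norm p (fib v) \<xi> \<le> C)"
        using lp_norm_nonneg[of p _ \<xi>] by auto
      also have "\<dots> \<longleftrightarrow> (\<forall>a\<in>A. cmod (\<xi> a) \<le> C)"
        using lp_infinity_le_iff[OF C, of _ \<xi>] True \<pi> by (auto simp: fib_def)
      finally show ?thesis using lp_infinity_le_iff[OF C, of A \<xi>] True by simp
    qed
    have 1: "lp_mem p A \<xi>" "lp_norm p A \<xi> \<le> lp_norm p V (\<lambda>v. lp_norm p (fib v) \<xi>)"
      if "\<forall>v\<in>V. lp_mem p (fib v) \<xi>" "lp_mem p V (\<lambda>v. lp_norm p (fib v) \<xi>)"
      using iff[OF lp_norm_nonneg[OF that(2)]] that by auto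
    have 2: "\<forall>v\<in>V. lp_mem p (fib v) \<xi>" "lp_mem p V (\<lambda>v. lp_norm p (fib v) \<xi>)"
      "lp_norm p V (\<lambda>v. lp_norm p (fib v) \<xi>) \<le> lp_norm p A \<xi>" if "lp_mem p A \<xi>"
      using iff[OF lp_norm_nonneg[OF that]] that by auto
    show ?thesis using 1 2 by (meson antisym)
  next
    case False
    define r where "r = enn2real p"
    have r: "1 \<le> r" using enn2real_ge_1[OF p False] r_def by simp
    let ?g = "\<lambda>a. cmod (\<xi> a) powr r"
    have bij: "bij_betw snd (Sigma V fib) A"
      using \<pi> by (auto simp: fib_def bij_betw_def inj_on_def image_iff)
    have pw: "norm (lp_norm p (fib v) \<xi>) powr r = infsum ?g (fib v)" for v
      using False r by (simp add: lp_norm_def r_def[symmetric] powr_powr infsum_nonneg)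
    have mem: "lp_mem p B h \<longleftrightarrow> (\<lambda>x. norm (h x) powr r) summable_on B" for B :: "'b set" and h :: "'b \<Rightarrow> 'c::real_normed_vector"
      using False by (simp add: lp_mem_def r_def)
    have s: "?g summable_on A \<longleftrightarrow> (\<lambda>x. ?g (snd x)) summable_on Sigma V fib"
      using summable_on_reindex_bij_betw[OF bij, of ?g] by simp
    have "(\<forall>v\<in>V. lp_mem p (fib v) \<xi>) \<and> lp_mem p V (\<lambda>v. lp_norm p (fib v) \<xi>) \<longleftrightarrow> lp_mem p A \<xi>"
      unfolding mem pw s using Infinite_Sum.abs_summable_on_Sigma_iff[where f = "\<lambda>x. ?g (snd x)" and A = V and B = fib]
      by (simp add: infsum_nonneg)
    moreover have "lp_norm p V (\<lambda>v. lp_norm p (fib v) \<xi>) = lp_norm p A \<xi>" if m: "lp_mem p A \<xi>"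
    proof -
      have "(\<Sum>\<^sub>\<infinity>v\<in>V. infsum ?g (fib v)) = infsum (\<lambda>x. ?g (snd x)) (Sigma V fib)"
        using infsum_Sigma_banach[where f = "\<lambda>x. ?g (snd x)" and A = V and B = fib] m[unfolded mem s] by simp
      also have "\<dots> = infsum ?g A"
        by (rule infsum_reindex_bij_betw[OF bij])
      finally have "(\<Sum>\<^sub>\<infinity>v\<in>V. norm (lp_norm p (fib v) \<xi>) powr r) = infsum ?g A" by (simp only: pw)
      then show ?thesis using False by (simp add: lp_norm_def[of p V] lp_norm_def[of p A] r_def)
    qed
    ultimately show ?thesis by blast
  qed
  then show "(\<forall>v\<in>V. lp_mem p (fib v) \<xi>) \<and> lp_mem p V (\<lambda>v. lp_norm p (fib v) \<xi>) \<longleftrightarrow> lp_mem p A \<xi>"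
    and "lp_mem p A \<xi> \<Longrightarrow> lp_norm p V (\<lambda>v. lp_norm p (fib v) \<xi>) = lp_norm p A \<xi>" by blast+
qed

lemma carr_lp_sum:
  assumes "1 \<le> p" "\<pi> ` A \<subseteq> V"
  shows "\<xi> \<in> carr (lp_sum p V A \<pi>) \<longleftrightarrow> (\<forall>x. x \<notin> A \<longrightarrow> \<xi> x = 0) \<and> lp_mem p A \<xi>"
  using lp_fibres(1)[OF assms, of \<xi>] by (simp add: lp_sum_def)

lemma vnorm_lp_sum:
  assumes "1 \<le> p" "\<pi> ` A \<subseteq> V" "\<xi> \<in> carr (lp_sum p V A \<pi>)"
  shows "vnorm (lp_sum p V A \<pi>) \<xi> = lp_norm p A \<xi>"
  using lp_fibres(2)[OF assms(1,2), of \<xi>] assms(3) carr_lp_sum[OF assms(1,2)] by (simp add: lp_sum_def)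

lemma vector_space_fscale: "vector_space fscale"
  by unfold_locales (auto simp: fscale_def fun_eq_iff algebra_simps)

interpretation fscale: vector_space fscale
  by (rule vector_space_fscale)

lemma banach_lp_sum:
  fixes A :: "'a set" and \<pi> :: "'a \<Rightarrow> 'v"
  assumes p: "1 \<le> p" and \<pi>: "\<pi> ` A \<subseteq> V"
  shows "banach_space (lp_sum p V A \<pi>)"
proof -
  let ?E = "lp_sum p V A \<pi>"
  note carr = carr_lp_sum[OF p \<pi>]
  note norm = vnorm_lp_sum[OF p \<pi>]
  have sc: "scal ?E = fscale" by (simp add: lp_sum_def)
  have add: "x + y \<in> carr ?E" "vnorm ?E (x + y) \<le> vnorm ?E x + vnorm ?E y"
    if "x \<in> carr ?E" "y \<in> carr ?E" for x y
  proof -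
    show m: "x + y \<in> carr ?E"
      using that lp_triangle(1)[OF p, of A x y] by (auto simp: carr plus_fun_def)
    show "vnorm ?E (x + y) \<le> vnorm ?E x + vnorm ?E y"
      using that m lp_triangle(2)[OF p, of A x y] by (auto simp: carr norm plus_fun_def)
  qed
  have scale: "fscale c x \<in> carr ?E" "vnorm ?E (fscale c x) = cmod c * vnorm ?E x" if "x \<in> carr ?E" for x c
  proof -
    show m: "fscale c x \<in> carr ?E"
      using that lp_scale(1)[OF p, of A x c] by (auto simp: carr fscale_def)
    show "vnorm ?E (fscale c x) = cmod c * vnorm ?E x"
      using that m lp_scale(2)[OF p, of A x c] by (auto simp: carr norm fscale_def)
  qed
  have zero: "0 \<in> carr ?E" by (auto simp: carr lp_mem_def zero_fun_def bounded_iff)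
  have sub: "fscale.subspace (carr ?E)"
    using add(1) scale(1) zero by (intro fscale.subspaceI)
  have pos: "0 \<le> vnorm ?E x \<and> (vnorm ?E x = 0 \<longleftrightarrow> x = 0)" if x: "x \<in> carr ?E" for x
  proof -
    have "x = 0" if "lp_norm p A x = 0"
      using lp_point_le[OF p, of A x] x that by (force simp: carr)
    moreover have "lp_norm p A (0::'a \<Rightarrow> complex) = 0"
      using lp_scale(2)[OF p, of A x 0] x by (simp add: carr zero_fun_def)
    ultimately show ?thesis
      using x by (auto simp: carr norm[OF x] lp_norm_nonneg)
  qed
  have complete: "\<exists>x\<in>carr ?E. (\<lambda>n. vnorm ?E (\<sigma> n - x)) \<longlonglongrightarrow> 0"
    if \<sigma>: "\<forall>n. \<sigma> n \<in> carr ?E" and C: "\<forall>\<epsilon>>0. \<exists>N. \<forall>m\<ge>N. \<forall>n\<ge>N. vnorm ?E (\<sigma> m - \<sigma> n) < \<epsilon>" for \<sigma> :: "nat \<Rightarrow> 'a \<Rightarrow> complex"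
  proof -
    have d: "vnorm ?E (x - y) = lp_norm p A (\<lambda>i. x i - y i)" if "x \<in> carr ?E" "y \<in> carr ?E" for x y
      using norm[OF fscale.subspace_diff[OF sub that]] by (simp add: fun_diff_def)
    obtain g where g: "lp_mem p A g" "\<And>i. i \<notin> A \<Longrightarrow> g i = 0"
      "(\<lambda>n. lp_norm p A (\<lambda>i. \<sigma> n i - g i)) \<longlonglongrightarrow> 0"
    proof (rule lp_complete[OF p, of A \<sigma>])
      show "\<exists>N. \<forall>m\<ge>N. \<forall>n\<ge>N. lp_norm p A (\<lambda>i. \<sigma> m i - \<sigma> n i) < e" if "0 < e" for e
        using C \<sigma> d that by auto
    qed (use \<sigma> carr in auto)
    have "g \<in> carr ?E" using g by (simp add: carr)
    then show ?thesis using g(3) \<sigma> d by auto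
  qed
  show ?thesis
    unfolding banach_space_def sc
  proof (intro conjI ballI allI impI)
    fix \<sigma> :: "nat \<Rightarrow> 'a \<Rightarrow> complex"
    assume "(\<forall>n. \<sigma> n \<in> carr ?E) \<and> (\<forall>\<epsilon>>0. \<exists>N. \<forall>m\<ge>N. \<forall>n\<ge>N. vnorm ?E (\<sigma> m - \<sigma> n) < \<epsilon>)"
    then show "\<exists>x\<in>carr ?E. (\<lambda>n. vnorm ?E (\<sigma> n - x)) \<longlonglongrightarrow> 0"
      using complete by blast
  qed (simp_all add: vector_space_fscale sub scale(2) add(2) pos)
qed

section \<open>Functions with compact support on locally Hausdorff spaces\<close>

lemma continuous_map_mult_complex:
  fixes f g :: "'a \<Rightarrow> complex"
  assumes "continuous_map X euclidean f" "continuous_map X euclidean g"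
  shows "continuous_map X euclidean (\<lambda>x. f x * g x)"
  using assms by (simp add: continuous_map_atin tendsto_mult)

lemma continuous_map_of_real:
  "continuous_map X euclideanreal f \<Longrightarrow> continuous_map X euclidean (\<lambda>x. of_real (f x) :: complex)"
  by (simp add: continuous_map_atin tendsto_of_real)

text \<open>The next two facts trade the relative closure of the nonvanishing set for an arbitrary compact
  \<open>K \<subseteq> U\<close> that carries \<open>f\<close>. Such a \<open>K\<close> is closed in the Hausdorff set \<open>U\<close>, though perhaps not in \<open>X\<close>.\<close>

lemma Cc_onI:
  assumes "continuous_map (subtopology X U) euclidean f" and H: "Hausdorff_space (subtopology X U)"
    and K: "compactin X K" "K \<subseteq> U" and z: "\<And>x. x \<notin> K \<Longrightarrow> f x = 0"
  shows "f \<in> Cc_on X U"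
proof -
  have c: "compactin (subtopology X U) K" using K by (simp add: compactin_subtopology)
  then have cl: "closedin (subtopology X U) K" by (rule compactin_imp_closedin[OF H])
  have "subtopology X U closure_of {x \<in> U. f x \<noteq> 0} \<subseteq> K"
    using z by (intro closure_of_minimal[OF _ cl]) auto
  then have "compactin (subtopology X U) (subtopology X U closure_of {x \<in> U. f x \<noteq> 0})"
    by (intro closed_compactin[OF c] closedin_closure_of)
  then show ?thesis using assms K by (auto simp: Cc_on_def)
qed

lemma Cc_onD:
  assumes "f \<in> Cc_on X U" "openin X U"
  shows "continuous_map (subtopology X U) euclidean f"
    and "\<exists>K. compactin X K \<and> K \<subseteq> U \<and> (\<forall>x. x \<notin> K \<longrightarrow> f x = 0)"
proof -
  show "continuous_map (subtopology X U) euclidean f" using assms by (simp add: Cc_on_def)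
  let ?K = "subtopology X U closure_of {x \<in> U. f x \<noteq> 0}"
  have "{x \<in> U. f x \<noteq> 0} \<subseteq> ?K"
    using assms openin_subset[OF assms(2)] by (intro closure_of_subset) (auto simp: topspace_subtopology)
  then have "\<forall>x. x \<notin> ?K \<longrightarrow> f x = 0" using assms(1) by (auto simp: Cc_on_def)
  moreover have "compactin X ?K" "?K \<subseteq> U" using assms(1) by (auto simp: Cc_on_def compactin_subtopology)
  ultimately show "\<exists>K. compactin X K \<and> K \<subseteq> U \<and> (\<forall>x. x \<notin> K \<longrightarrow> f x = 0)" by blast
qed

lemma Cc_on_subset_Cfun:
  assumes "openin X U" "Hausdorff_space (subtopology X U)"
  shows "Cc_on X U \<subseteq> Cfun X"
  unfolding Cfun_def using assms by (auto intro!: fscale.span_base)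

lemma Cfun_subspace: "fscale.subspace (Cfun X)"
  by (simp add: Cfun_def fscale.subspace_span)

lemma Cfun_induct [consumes 1, case_names subspace base]:
  assumes "f \<in> Cfun X" "fscale.subspace {f. P f}"
    and "\<And>U f. openin X U \<Longrightarrow> Hausdorff_space (subtopology X U) \<Longrightarrow> f \<in> Cc_on X U \<Longrightarrow> P f"
  shows "P f"
  using assms(1) unfolding Cfun_def
  by (rule fscale.span_induct) (use assms in auto)

lemma subspace_fscaleI:
  assumes "P (\<lambda>x. 0)" "\<And>f g. P f \<Longrightarrow> P g \<Longrightarrow> P (\<lambda>x. f x + g x)" "\<And>c f. P f \<Longrightarrow> P (\<lambda>x. c * f x)"
  shows "fscale.subspace {f. P f}"
  using assms by (intro fscale.subspaceI) (auto simp: zero_fun_def plus_fun_def fscale_def)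

lemma Cfun_add: "f \<in> Cfun X \<Longrightarrow> g \<in> Cfun X \<Longrightarrow> (\<lambda>x. f x + g x) \<in> Cfun X"
  and Cfun_scale: "f \<in> Cfun X \<Longrightarrow> (\<lambda>x. c * f x) \<in> Cfun X"
  and Cfun_zero: "(\<lambda>x. 0) \<in> Cfun X"
  using fscale.subspace_add[OF Cfun_subspace] fscale.subspace_scale[OF Cfun_subspace]
    fscale.subspace_0[OF Cfun_subspace] by (auto simp: plus_fun_def fscale_def zero_fun_def)

lemma sum_fun_apply: "(\<Sum>i\<in>I. F i) x = (\<Sum>i\<in>I. F i x)"
  by (induction I rule: infinite_finite_induct) auto

lemma continuous_map_zero_extension:
  fixes g :: "'a \<Rightarrow> 'b::{topological_space,zero}"
  assumes W: "openin X W" "continuous_map (subtopology X W) euclidean g"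
    and C: "closedin X C" "C \<subseteq> W" and z: "\<And>x. x \<in> topspace X \<Longrightarrow> x \<notin> C \<Longrightarrow> g x = 0"
  shows "continuous_map X euclidean g"
proof (rule pasting_lemma[where I = UNIV and T = "\<lambda>b. if b then W else topspace X - C" and f = "\<lambda>_. g"])
  fix b :: bool
  show "openin X (if b then W else topspace X - C)" using W C by auto
  have "continuous_map (subtopology X (topspace X - C)) euclidean g"
    by (rule continuous_map_eq[where f = "\<lambda>_. 0"]) (use z in auto)
  then show "continuous_map (subtopology X (if b then W else topspace X - C)) euclidean g"
    using W by auto
qed (use C in \<open>auto intro: exI[of _ True] exI[of _ False]\<close>)

text \<open>The function separates \<open>K\<close> from the complement of an open neighbourhood that itself lies in a
  compact subset of \<open>S\<close>.\<close>

lemma Urysohn_compact_support: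
  assumes lc: "locally_compact_space Y" and H: "Hausdorff_space Y"
    and K: "compactin Y K" "K \<subseteq> S" and S: "openin Y S"
  obtains g C where "continuous_map Y euclideanreal g" "\<And>y. y \<in> topspace Y \<Longrightarrow> 0 \<le> g y"
    "\<And>y. y \<in> K \<Longrightarrow> g y = 1" "compactin Y C" "C \<subseteq> S" "\<And>y. y \<in> topspace Y \<Longrightarrow> y \<notin> C \<Longrightarrow> g y = 0"
proof -
  have lcS: "locally_compact_space (subtopology Y S)"
    using locally_compact_space_open_subset lc H S by blast
  have "Hausdorff_space (subtopology Y S)" by (simp add: H Hausdorff_space_subtopology)
  moreover have "compactin (subtopology Y S) K" using K by (simp add: compactin_subtopology)
  ultimately obtain U L where UL: "openin (subtopology Y S) U" "compactin (subtopology Y S) L" "K \<subseteq> U" "U \<subseteq> L"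
    using locally_compact_space_compact_closed_compact[of "subtopology Y S"] lcS by blast
  have U: "openin Y U" using UL(1) S openin_trans_full by blast
  have L: "compactin Y L" "L \<subseteq> S" using UL by (auto simp: compactin_subtopology)
  have cr: "completely_regular_space Y"
    using locally_compact_regular_imp_completely_regular_space lc H by blast
  obtain g where g: "continuous_map Y (subtopology euclideanreal {0..1}) g"
    "g ` (topspace Y - U) \<subseteq> {0}" "g ` K \<subseteq> {1}"
  proof (rule Urysohn_completely_regular_compact_closed[OF zero_le_one cr K(1)])
    show "closedin Y (topspace Y - U)" using U by blast
    show "disjnt K (topspace Y - U)" using UL by (auto simp: disjnt_def)
  qed (rule that)
  show thesis
  proof (rule that)
    show "continuous_map Y euclideanreal g" using g(1) continuous_map_into_fulltopology by blast
    show "0 \<le> g y" if "y \<in> topspace Y" for y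
      using g(1) that by (auto simp: continuous_map_in_subtopology Pi_iff)
    show "g y = 0" if "y \<in> topspace Y" "y \<notin> L" for y using g(2) UL that by blast
  qed (use g L in auto)
qed

text \<open>On a sheet \<open>f\<close> has a continuous inverse. For the source and range maps of a groupoid these sets
  play the role of bisections.\<close>

definition sheet :: "'a topology \<Rightarrow> 'b topology \<Rightarrow> ('a \<Rightarrow> 'b) \<Rightarrow> 'a set \<Rightarrow> bool" where
  "sheet X Y f U \<longleftrightarrow> openin X U \<and> openin Y (f ` U) \<and>
     homeomorphic_map (subtopology X U) (subtopology Y (f ` U)) f"

lemma sheet_openin: "sheet X Y f U \<Longrightarrow> openin X U"
  and sheet_image_openin: "sheet X Y f U \<Longrightarrow> openin Y (f ` U)"
  by (auto simp: sheet_def)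

lemma sheet_topspace: "sheet X Y f U \<Longrightarrow> topspace (subtopology X U) = U"
  using openin_subset by (fastforce simp: sheet_def topspace_subtopology)

lemma sheet_inj: "sheet X Y f U \<Longrightarrow> inj_on f U"
  using sheet_topspace[of X Y f U] homeomorphic_imp_injective_map unfolding sheet_def by metis

lemma sheet_continuous: "sheet X Y f U \<Longrightarrow> continuous_map (subtopology X U) Y f"
  using homeomorphic_imp_continuous_map continuous_map_into_fulltopology unfolding sheet_def by blast

lemma sheet_subset:
  assumes U: "sheet X Y f U" and V: "openin X V" "V \<subseteq> U"
  shows "sheet X Y f V"
proof -
  have h: "homeomorphic_map (subtopology X U) (subtopology Y (f ` U)) f" using U by (simp add: sheet_def)
  have t: "topspace (subtopology X U) = U" by (rule sheet_topspace[OF U])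
  have t': "topspace (subtopology Y (f ` U)) = f ` U" using U openin_subset by (fastforce simp: sheet_def topspace_subtopology)
  have "openin (subtopology X U) V" using V by (simp add: openin_subtopology_Int2 openin_open_subtopology sheet_openin[OF U])
  then have "openin (subtopology Y (f ` U)) (f ` V)"
    using homeomorphic_map_openness[OF h, of V] V(2) unfolding t by blast
  then have 1: "openin Y (f ` V)" using U openin_trans_full unfolding sheet_def by blast
  have "homeomorphic_map (subtopology (subtopology X U) V) (subtopology (subtopology Y (f ` U)) (f ` V)) f"
    by (rule homeomorphic_map_subtopologies[OF h]) (use V t t' in auto)
  moreover have "U \<inter> V = V" "f ` U \<inter> f ` V = f ` V" using V by auto
  ultimately show ?thesis using V 1 by (simp add: sheet_def subtopology_subtopology)
qed

lemma sheet_exists: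
  assumes f: "local_homeomorphism X Y f" and S: "openin X S" "x \<in> S"
  obtains U where "sheet X Y f U" "x \<in> U" "U \<subseteq> S"
proof -
  have "x \<in> topspace X" using S openin_subset by blast
  then obtain U where U: "sheet X Y f U" "x \<in> U"
    using f unfolding local_homeomorphism_def sheet_def by blast
  show thesis
    by (rule that[OF sheet_subset[OF U(1), of "U \<inter> S"]]) (use U S sheet_openin[OF U(1)] in auto)
qed

lemma sheet_section:
  assumes U: "sheet X Y f U"
  obtains \<sigma> where "continuous_map (subtopology Y (f ` U)) X \<sigma>" "\<And>u. u \<in> U \<Longrightarrow> \<sigma> (f u) = u"
    "\<And>y. y \<in> f ` U \<Longrightarrow> \<sigma> y \<in> U \<and> f (\<sigma> y) = y"
proof -
  obtain \<sigma> where \<sigma>: "homeomorphic_maps (subtopology X U) (subtopology Y (f ` U)) f \<sigma>"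
    using U by (auto simp: sheet_def homeomorphic_map_maps)
  have 1: "continuous_map (subtopology Y (f ` U)) X \<sigma>"
    using \<sigma> continuous_map_into_fulltopology unfolding homeomorphic_maps_def by blast
  have 2: "\<sigma> (f u) = u" if "u \<in> U" for u
    using \<sigma> that sheet_topspace[OF U] unfolding homeomorphic_maps_def by blast
  show thesis by (rule that[OF 1 2]) (auto simp: 2)
qed

lemma sheet_Hausdorff:
  assumes "sheet X Y f U" "Hausdorff_space Y"
  shows "Hausdorff_space (subtopology X U)"
  using Hausdorff_space_injective_preimage[OF assms(2) sheet_continuous[OF assms(1)]]
    sheet_inj[OF assms(1)] sheet_topspace[OF assms(1)] by simp

lemma sheet_lift:
  assumes U: "sheet X Y f U" and g: "continuous_map T Y g"
  obtains \<rho> where "openin T {t \<in> topspace T. g t \<in> f ` U}"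
    "continuous_map (subtopology T {t \<in> topspace T. g t \<in> f ` U}) X \<rho>"
    "\<And>t. g t \<in> f ` U \<Longrightarrow> \<rho> t \<in> U \<and> f (\<rho> t) = g t" "\<And>t u. u \<in> U \<Longrightarrow> f u = g t \<Longrightarrow> \<rho> t = u"
proof -
  let ?D = "{t \<in> topspace T. g t \<in> f ` U}"
  obtain \<sigma> where \<sigma>: "continuous_map (subtopology Y (f ` U)) X \<sigma>" "\<And>u. u \<in> U \<Longrightarrow> \<sigma> (f u) = u"
    "\<And>y. y \<in> f ` U \<Longrightarrow> \<sigma> y \<in> U \<and> f (\<sigma> y) = y" using sheet_section[OF U] by blast
  have "continuous_map (subtopology T ?D) (subtopology Y (f ` U)) g"
    by (intro continuous_map_into_subtopology continuous_map_from_subtopology g) auto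
  then have "continuous_map (subtopology T ?D) X (\<sigma> \<circ> g)" by (rule continuous_map_compose[OF _ \<sigma>(1)])
  then show thesis
    using that[of "\<sigma> \<circ> g"] openin_continuous_map_preimage[OF g sheet_image_openin[OF U]] \<sigma>(2,3)
    by (metis comp_apply)
qed

lemma Cfun_product:
  assumes Q: "openin T Q" "Hausdorff_space (subtopology T Q)"
    and c: "continuous_map (subtopology T D) X \<tau>" "continuous_map (subtopology T D) X' \<rho>" "Q \<subseteq> D"
    and \<phi>: "\<phi> \<in> Cc_on X U" "openin X U" "\<tau> ` Q \<subseteq> U" and b: "b \<in> Cc_on X' V" "openin X' V" "\<rho> ` Q \<subseteq> V"
    and F: "\<And>x. x \<in> Q \<Longrightarrow> F x = \<phi> (\<tau> x) * b (\<rho> x)"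
    and K: "compactin T K" "K \<subseteq> Q" "\<And>x. x \<notin> K \<Longrightarrow> F x = (0::complex)"
  shows "F \<in> Cfun T"
proof -
  have c1: "continuous_map (subtopology T Q) (subtopology X U) \<tau>"
    using continuous_map_from_subtopology_mono[OF c(1,3)] \<phi>(3) by (intro continuous_map_into_subtopology) auto
  have c2: "continuous_map (subtopology T Q) (subtopology X' V) \<rho>"
    using continuous_map_from_subtopology_mono[OF c(2,3)] b(3) by (intro continuous_map_into_subtopology) auto
  have "continuous_map (subtopology T Q) euclidean (\<lambda>x. (\<phi> \<circ> \<tau>) x * (b \<circ> \<rho>) x)"
    by (intro continuous_map_mult_complex continuous_map_compose[OF c1] continuous_map_compose[OF c2]
        Cc_onD(1)[OF \<phi>(1,2)] Cc_onD(1)[OF b(1,2)])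
  then have "continuous_map (subtopology T Q) euclidean F" by (rule continuous_map_eq) (simp add: F)
  then have "F \<in> Cc_on T Q" by (rule Cc_onI[OF _ Q(2) K])
  then show ?thesis using Cc_on_subset_Cfun[OF Q] by blast
qed

text \<open>Urysohn functions are needed on the base only: a bump on \<open>f ` W\<close> pulls back to the sheet, and its
  extension by zero stays continuous on \<open>U\<close> because the compact carrier is closed there.\<close>

lemma sheet_bump:
  assumes lc: "locally_compact_space Y" "Hausdorff_space Y"
    and W: "sheet X Y f W" "x \<in> W" and U: "openin X U" "Hausdorff_space (subtopology X U)" "W \<subseteq> U"
  obtains g C where "continuous_map (subtopology X U) euclideanreal g" "\<And>z. z \<in> U \<Longrightarrow> 0 \<le> g z"
    "g x = 1" "compactin X C" "C \<subseteq> W" "\<And>z. z \<notin> C \<Longrightarrow> g z = 0"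
proof -
  have fx: "f x \<in> topspace Y" "{f x} \<subseteq> f ` W" using W sheet_image_openin openin_subset by blast+
  obtain h C where h: "continuous_map Y euclideanreal h" "\<And>y. y \<in> topspace Y \<Longrightarrow> 0 \<le> h y"
    "\<And>y. y \<in> {f x} \<Longrightarrow> h y = 1" "compactin Y C" "C \<subseteq> f ` W" "\<And>y. y \<in> topspace Y \<Longrightarrow> y \<notin> C \<Longrightarrow> h y = 0"
    using Urysohn_compact_support[OF lc _ fx(2) sheet_image_openin[OF W(1)]] fx(1) by (metis compactin_sing)
  obtain \<sigma> where \<sigma>: "continuous_map (subtopology Y (f ` W)) X \<sigma>" "\<And>u. u \<in> W \<Longrightarrow> \<sigma> (f u) = u"
    "\<And>y. y \<in> f ` W \<Longrightarrow> \<sigma> y \<in> W \<and> f (\<sigma> y) = y" using sheet_section[OF W(1)] by blast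
  define g where "g z = (if z \<in> W then h (f z) else 0)" for z
  have fW: "f z \<in> topspace Y" if "z \<in> W" for z using that W(1) sheet_image_openin openin_subset by blast
  have c: "compactin X (\<sigma> ` C)"
    by (rule image_compactin[OF _ \<sigma>(1)]) (use h in \<open>simp add: compactin_subtopology\<close>)
  have CW: "\<sigma> ` C \<subseteq> W" using \<sigma>(3) h(5) by blast
  have z: "g z = 0" if "z \<notin> \<sigma> ` C" for z
  proof (cases "z \<in> W")
    case True
    then have "f z \<notin> C" using that \<sigma>(2) by force
    then show ?thesis using h(6) fW True by (simp add: g_def)
  qed (simp add: g_def)
  have cont: "continuous_map (subtopology X U) euclideanreal g"
  proof (rule continuous_map_zero_extension[where W = W and C = "\<sigma> ` C"])
    show "openin (subtopology X U) W" using W U sheet_openin by (metis openin_open_subtopology)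
    show "closedin (subtopology X U) (\<sigma> ` C)"
      by (rule compactin_imp_closedin[OF U(2)]) (use c CW U in \<open>auto simp: compactin_subtopology\<close>)
    have "continuous_map (subtopology X W) euclideanreal (h \<circ> f)"
      by (rule continuous_map_compose[OF sheet_continuous[OF W(1)] h(1)])
    then have "continuous_map (subtopology X W) euclideanreal g"
      by (rule continuous_map_eq) (auto simp: g_def)
    moreover have "subtopology (subtopology X U) W = subtopology X W"
      using U by (simp add: subtopology_subtopology Int_absorb1)
    ultimately show "continuous_map (subtopology (subtopology X U) W) euclideanreal g" by simp
  qed (use CW z in auto)
  show thesis
    by (rule that[OF cont _ _ c CW z]) (use h W fW in \<open>auto simp: g_def\<close>)
qed

text \<open>A partition of unity, pulled back from the base along finitely many sheets, cuts a compactly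
  supported function into pieces living on sheets. Dividing by \<open>max G (1/2)\<close> in place of the sum \<open>G\<close>
  of the bumps keeps the quotient continuous everywhere and changes nothing on the support,
  where \<open>G > 1/2\<close>.\<close>

lemma Cc_on_span_sheets:
  assumes f: "local_homeomorphism X Y f" and lc: "locally_compact_space Y" "Hausdorff_space Y"
    and U: "openin X U" "Hausdorff_space (subtopology X U)" and \<phi>: "\<phi> \<in> Cc_on X U"
  shows "\<phi> \<in> fscale.span (\<Union>{Cc_on X W | W. sheet X Y f W})"
proof -
  obtain K where K: "compactin X K" "K \<subseteq> U" "\<forall>x. x \<notin> K \<longrightarrow> \<phi> x = 0" using Cc_onD(2)[OF \<phi> U(1)] by blast
  define P where "P x W g C \<longleftrightarrow> sheet X Y f W \<and> W \<subseteq> U \<and> continuous_map (subtopology X U) euclideanreal g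
    \<and> (\<forall>z\<in>U. 0 \<le> g z) \<and> g x = 1 \<and> compactin X C \<and> C \<subseteq> W \<and> (\<forall>z. z \<notin> C \<longrightarrow> g z = 0)" for x W g C
  have "\<exists>W g C. P x W g C" if xK: "x \<in> K" for x
  proof -
    obtain W where W: "sheet X Y f W" "x \<in> W" "W \<subseteq> U" 
      by (rule sheet_exists[OF f U(1)]) (use K xK in auto)
    obtain g C where "continuous_map (subtopology X U) euclideanreal g" "\<And>z. z \<in> U \<Longrightarrow> 0 \<le> g z"
      "g x = 1" "compactin X C" "C \<subseteq> W" "\<And>z. z \<notin> C \<Longrightarrow> g z = 0"
      using sheet_bump[OF lc W(1,2) U W(3)] by metis
    then have "P x W g C" using W by (simp add: P_def)
    then show ?thesis by blast
  qed
  then obtain W g C where P: "\<And>x. x \<in> K \<Longrightarrow> P x (W x) (g x) (C x)" by metis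
  have W: "\<And>x. x \<in> K \<Longrightarrow> sheet X Y f (W x)" "\<And>x. x \<in> K \<Longrightarrow> W x \<subseteq> U"
    and g: "\<And>x. x \<in> K \<Longrightarrow> continuous_map (subtopology X U) euclideanreal (g x)"
      "\<And>x z. x \<in> K \<Longrightarrow> z \<in> U \<Longrightarrow> 0 \<le> g x z" "\<And>x. x \<in> K \<Longrightarrow> g x x = (1::real)"
    and C: "\<And>x. x \<in> K \<Longrightarrow> compactin X (C x)" "\<And>x. x \<in> K \<Longrightarrow> C x \<subseteq> W x"
      "\<And>x z. x \<in> K \<Longrightarrow> z \<notin> C x \<Longrightarrow> g x z = 0"
    using P by (auto simp: P_def)
  have tU: "topspace (subtopology X U) = U" using openin_subset[OF U(1)] by auto
  define V where "V x = {z \<in> U. g x z > 1/2}" for x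
  have V: "openin X (V x)" if "x \<in> K" for x
  proof -
    have "openin (subtopology X U) {z \<in> topspace (subtopology X U). g x z \<in> {1/2<..}}"
      by (rule openin_continuous_map_preimage[OF g(1)[OF that]]) simp
    then show ?thesis using openin_trans_full[OF _ U(1)] unfolding tU by (simp add: V_def)
  qed
  have "\<exists>\<F>. finite \<F> \<and> \<F> \<subseteq> V ` K \<and> K \<subseteq> \<Union>\<F>"
    using K(1) unfolding compactin_def
  proof (elim conjE allE impE)
    show "Ball (V ` K) (openin X) \<and> K \<subseteq> \<Union>(V ` K)"
      using V g(3) K(2) by (force simp: V_def)
  qed
  then obtain I where I: "finite I" "I \<subseteq> K" "K \<subseteq> (\<Union>x\<in>I. V x)"
    by (metis finite_subset_image)
  define G where "G z = (\<Sum>i\<in>I. g i z)" for z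
  have G: "G z > 1/2" if z: "z \<in> K" for z
  proof -
    obtain i where i: "i \<in> I" "z \<in> V i" using I z by blast
    have "g i z \<le> G z"
      unfolding G_def by (rule member_le_sum[OF i(1) _ I(1)]) (use g(2) I K z in blast)
    then show ?thesis using i by (simp add: V_def)
  qed
  have contG: "continuous_map (subtopology X U) euclideanreal (\<lambda>z. g i z / max (G z) (1/2))" if "i \<in> I" for i
    unfolding G_def using I g(1) that by (intro continuous_intros) (auto simp: max_def)
  define F where "F i = (\<lambda>z. \<phi> z * of_real (g i z / max (G z) (1/2)))" for i
  have "F i \<in> Cc_on X (W i)" if "i \<in> I" for i
  proof (rule Cc_onI)
    have iK: "i \<in> K" using that I by blast
    have "continuous_map (subtopology X U) euclidean (F i)"
      unfolding F_def by (intro continuous_map_mult_complex continuous_map_of_real contG that Cc_onD(1)[OF \<phi> U(1)])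
    then show "continuous_map (subtopology X (W i)) euclidean (F i)"
      using W(2)[OF iK] continuous_map_from_subtopology_mono by blast
    show "Hausdorff_space (subtopology X (W i))" by (rule sheet_Hausdorff[OF W(1)[OF iK] lc(2)])
    show "compactin X (C i)" "C i \<subseteq> W i" by (rule C[OF iK])+
    show "F i z = 0" if "z \<notin> C i" for z using C(3)[OF iK that] by (simp add: F_def)
  qed
  then have F: "F i \<in> \<Union>{Cc_on X W | W. sheet X Y f W}" if "i \<in> I" for i using W(1) I that by blast
  have "\<phi> = (\<Sum>i\<in>I. F i)"
  proof
    fix z
    have "(\<Sum>i\<in>I. F i) z = \<phi> z * of_real (G z / max (G z) (1/2))"
      by (simp add: sum_fun_apply F_def G_def sum_distrib_left sum_divide_distrib)
    also have "\<dots> = \<phi> z"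
    proof (cases "z \<in> K")
      case True
      then have "G z / max (G z) (1/2) = 1" using G[OF True] by simp
      then show ?thesis by simp
    qed (simp add: K)
    finally show "\<phi> z = (\<Sum>i\<in>I. F i) z" by simp
  qed
  also have "\<dots> \<in> fscale.span (\<Union>{Cc_on X W | W. sheet X Y f W})"
    by (intro fscale.span_sum fscale.span_base F)
  finally show ?thesis .
qed

lemma Cfun_sheet_induct [consumes 4, case_names subspace base]:
  assumes "local_homeomorphism X Y f" "locally_compact_space Y" "Hausdorff_space Y"
    and \<phi>: "\<phi> \<in> Cfun X" and sub: "fscale.subspace {f. P f}"
    and base: "\<And>U \<phi>. sheet X Y f U \<Longrightarrow> \<phi> \<in> Cc_on X U \<Longrightarrow> P \<phi>"
  shows "P \<phi>"
proof -
  have "\<phi> \<in> fscale.span (\<Union>{Cc_on X W | W. sheet X Y f W})"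
    using \<phi>
  proof (induction rule: Cfun_induct)
    case subspace
    then show ?case using fscale.subspace_span by simp
  next
    case (base U \<phi>)
    then show ?case using Cc_on_span_sheets assms(1-3) by blast
  qed
  then show ?thesis
    by (rule fscale.span_induct) (use sub base in auto)
qed

text \<open>The supports of the summands may have no common Hausdorff neighbourhood, but their images under a
  continuous map lie in one compact set.\<close>

lemma Cfun_support_image:
  assumes "continuous_map X Y f" "\<phi> \<in> Cfun X"
  shows "\<exists>K. compactin Y K \<and> (\<forall>x. \<phi> x \<noteq> 0 \<longrightarrow> x \<in> topspace X \<and> f x \<in> K)"
  using assms(2)
proof (induction rule: Cfun_induct)
  case subspace
  show ?case
  proof (rule subspace_fscaleI)
    show "\<exists>K. compactin Y K \<and> (\<forall>x. (0::complex) \<noteq> 0 \<longrightarrow> x \<in> topspace X \<and> f x \<in> K)"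
      by (rule exI[of _ "{}"]) auto
  next
    fix u v :: "'a \<Rightarrow> complex"
    assume "\<exists>K. compactin Y K \<and> (\<forall>x. u x \<noteq> 0 \<longrightarrow> x \<in> topspace X \<and> f x \<in> K)"
      and "\<exists>K. compactin Y K \<and> (\<forall>x. v x \<noteq> 0 \<longrightarrow> x \<in> topspace X \<and> f x \<in> K)"
    then obtain K L where "compactin Y K" "\<forall>x. u x \<noteq> 0 \<longrightarrow> x \<in> topspace X \<and> f x \<in> K"
      "compactin Y L" "\<forall>x. v x \<noteq> 0 \<longrightarrow> x \<in> topspace X \<and> f x \<in> L" by blast
    then show "\<exists>K. compactin Y K \<and> (\<forall>x. u x + v x \<noteq> 0 \<longrightarrow> x \<in> topspace X \<and> f x \<in> K)"
      by (intro exI[of _ "K \<union> L"]) (metis Un_iff add.right_neutral compactin_Un)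
  qed auto
next
  case (base U \<phi>)
  then obtain K where K: "compactin X K" "K \<subseteq> U" "\<forall>x. x \<notin> K \<longrightarrow> \<phi> x = 0" using Cc_onD(2) by blast
  then show ?case
    using image_compactin[OF K(1) assms(1)] compactin_subset_topspace[OF K(1)] by (intro exI[of _ "f ` K"]) blast
qed

lemma Cfun_zero_outside:
  assumes "\<phi> \<in> Cfun X" "x \<notin> topspace X" shows "\<phi> x = 0"
  using Cfun_support_image[OF continuous_map_id assms(1)] assms(2) by blast

lemma Cfun_pullback:
  assumes h: "homeomorphic_map X Y h" and \<phi>: "\<phi> \<in> Cfun Y"
  shows "(\<lambda>x. if x \<in> topspace X then \<phi> (h x) else 0) \<in> Cfun X"
  using \<phi>
proof (induction rule: Cfun_induct)
  case subspace
  show ?case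
  proof (rule subspace_fscaleI)
    fix u v :: "'b \<Rightarrow> complex" and c
    let ?p = "\<lambda>u x. if x \<in> topspace X then u (h x) else 0"
    assume u: "?p u \<in> Cfun X"
    have "?p (\<lambda>x. c * u x) = (\<lambda>x. c * ?p u x)" by auto
    then show "?p (\<lambda>x. c * u x) \<in> Cfun X" using Cfun_scale[OF u, of c] by simp
    assume v: "?p v \<in> Cfun X"
    have "?p (\<lambda>x. u x + v x) = (\<lambda>x. ?p u x + ?p v x)" by auto
    then show "?p (\<lambda>x. u x + v x) \<in> Cfun X" using Cfun_add[OF u v] by simp
  qed (simp add: Cfun_zero)
next
  case (base U \<phi>)
  obtain k where k: "homeomorphic_maps X Y h k" using h by (auto simp: homeomorphic_map_maps)
  then have hk: "continuous_map X Y h" "continuous_map Y X k" "\<And>x. x \<in> topspace X \<Longrightarrow> k (h x) = x"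
    "\<And>y. y \<in> topspace Y \<Longrightarrow> h (k y) = y" by (auto simp: homeomorphic_maps_def)
  obtain K where K: "compactin Y K" "K \<subseteq> U" "\<forall>x. x \<notin> K \<longrightarrow> \<phi> x = 0" using Cc_onD(2) base by blast
  have KY: "K \<subseteq> topspace Y" by (rule compactin_subset_topspace[OF K(1)])
  define U' where "U' = {x \<in> topspace X. h x \<in> U}"
  have U': "openin X U'" unfolding U'_def by (rule openin_continuous_map_preimage[OF hk(1) base(1)])
  have tU': "topspace (subtopology X U') = U'" using openin_subset[OF U'] by auto
  have c: "continuous_map (subtopology X U') (subtopology Y U) h"
    by (intro continuous_map_into_subtopology continuous_map_from_subtopology hk) (auto simp: U'_def)
  have H: "Hausdorff_space (subtopology X U')"
    by (rule Hausdorff_space_injective_preimage[OF base(2) c])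
      (unfold tU', metis (mono_tags, lifting) U'_def hk(3) inj_onI mem_Collect_eq)
  have "(\<lambda>x. if x \<in> topspace X then \<phi> (h x) else 0) \<in> Cc_on X U'"
  proof (rule Cc_onI[OF _ H])
    have "continuous_map (subtopology X U') euclidean (\<phi> \<circ> h)"
      by (rule continuous_map_compose[OF c Cc_onD(1)[OF base(3,1)]])
    then show "continuous_map (subtopology X U') euclidean (\<lambda>x. if x \<in> topspace X then \<phi> (h x) else 0)"
      by (rule continuous_map_eq) auto
    show "compactin X (k ` K)" by (rule image_compactin[OF K(1) hk(2)])
    show "k ` K \<subseteq> U'"
    proof
      fix x assume "x \<in> k ` K"
      then obtain y where y: "y \<in> K" "x = k y" by blast
      then have "y \<in> topspace Y" using KY by blast
      then show "x \<in> U'"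
        using y K(2) hk(4) continuous_map_image_subset_topspace[OF hk(2)] by (auto simp: U'_def)
    qed
    show "(if x \<in> topspace X then \<phi> (h x) else 0) = 0" if "x \<notin> k ` K" for x
      using that K hk(3) by (metis imageI)
  qed
  then show ?case using Cc_on_subset_Cfun[OF U' H] by blast
qed

section \<open>Operators between Banach spaces\<close>

text \<open>Norms and vector space operations of an \<open>nspace\<close> are controlled on its carrier only, so the usual norm
  calculus is derived here with membership conditions.\<close>

locale banach_carrier =
  fixes V :: "('v::ab_group_add) nspace"
  assumes banach: "banach_space V"
begin

sublocale vs: vector_space "scal V"
  using banach by (simp add: banach_space_def)

lemma subspace: "vs.subspace (carr V)"
  using banach by (simp add: banach_space_def)

lemmas zero_mem = vs.subspace_0[OF subspace]
  and add_mem = vs.subspace_add[OF subspace]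
  and diff_mem = vs.subspace_diff[OF subspace]
  and scale_mem = vs.subspace_scale[OF subspace]

lemma nonneg: "x \<in> carr V \<Longrightarrow> 0 \<le> vnorm V x"
  and eq_0: "x \<in> carr V \<Longrightarrow> vnorm V x = 0 \<longleftrightarrow> x = 0"
  and scale: "x \<in> carr V \<Longrightarrow> vnorm V (scal V c x) = cmod c * vnorm V x"
  and triangle: "x \<in> carr V \<Longrightarrow> y \<in> carr V \<Longrightarrow> vnorm V (x + y) \<le> vnorm V x + vnorm V y"
  using banach by (simp_all add: banach_space_def)

lemma norm_0: "vnorm V 0 = 0"
  using eq_0[OF zero_mem] by simp

lemma complete:
  assumes "\<And>n. \<sigma> n \<in> carr V"
    and "\<And>\<epsilon>. 0 < \<epsilon> \<Longrightarrow> \<exists>N. \<forall>m\<ge>N. \<forall>n\<ge>N. vnorm V (\<sigma> m - \<sigma> n) < \<epsilon>"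
  shows "\<exists>x\<in>carr V. (\<lambda>n. vnorm V (\<sigma> n - x)) \<longlonglongrightarrow> 0"
  using banach assms unfolding banach_space_def by blast

lemma norm_diff_commute:
  assumes "x \<in> carr V" "y \<in> carr V" shows "vnorm V (x - y) = vnorm V (y - x)"
  using scale[OF diff_mem[OF assms], of "-1"] by simp

lemma diff_triangle:
  assumes "x \<in> carr V" "y \<in> carr V" "z \<in> carr V"
  shows "vnorm V (x - z) \<le> vnorm V (x - y) + vnorm V (y - z)"
  using triangle[OF diff_mem[OF assms(1,2)] diff_mem[OF assms(2,3)]] by simp

lemma norm_triangle_sub:
  assumes "x \<in> carr V" "y \<in> carr V"
  shows "vnorm V x \<le> vnorm V y + vnorm V (x - y)"
  using triangle[OF assms(2) diff_mem[OF assms]] by simp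

lemma norm_limit_unique:
  assumes "\<And>n. s n \<in> carr V" "x \<in> carr V" "y \<in> carr V"
    and x: "(\<lambda>n. vnorm V (s n - x)) \<longlonglongrightarrow> 0" and y: "(\<lambda>n. vnorm V (s n - y)) \<longlonglongrightarrow> 0"
  shows "x = y"
proof -
  have "(\<lambda>n. vnorm V (s n - x) + vnorm V (s n - y)) \<longlonglongrightarrow> 0"
    using tendsto_add[OF x y] by simp
  moreover have "vnorm V (x - y) \<le> vnorm V (s n - x) + vnorm V (s n - y)" for n
    using diff_triangle[of x "s n" y] norm_diff_commute[of x "s n"] assms by simp
  ultimately have "vnorm V (x - y) \<le> 0"
    by (intro LIMSEQ_le_const) auto
  then have "vnorm V (x - y) = 0"
    using nonneg[OF diff_mem[OF assms(2,3)]] by simp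
  then show ?thesis using eq_0[OF diff_mem[OF assms(2,3)]] by simp
qed

lemma subset_norm_closure:
  assumes "S \<subseteq> carr V" shows "S \<subseteq> norm_closure V S"
  using assms by (auto simp: norm_closure_def norm_0 intro!: bexI)

text \<open>The closure is a closed subspace, and therefore inherits completeness.\<close>

lemma banach_norm_closure:
  assumes S: "vs.subspace S" "S \<subseteq> carr V"
  shows "banach_space (V\<lparr>carr := norm_closure V S\<rparr>)" (is "banach_space ?V")
proof -
  let ?N = "norm_closure V S"
  have closed: "x \<in> ?N"
    if x: "x \<in> carr V" and near: "\<And>\<epsilon>. 0 < \<epsilon> \<Longrightarrow> \<exists>y\<in>?N. vnorm V (y - x) < \<epsilon>" for x
    unfolding norm_closure_def
  proof (intro CollectI conjI allI impI x)
    fix \<epsilon> :: real assume "0 < \<epsilon>"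
    then obtain y where y: "y \<in> ?N" "vnorm V (y - x) < \<epsilon> / 2" using near[of "\<epsilon> / 2"] by auto
    obtain s where s: "s \<in> S" "s \<in> carr V" "vnorm V (y - s) < \<epsilon> / 2"
      using y(1) half_gt_zero[OF \<open>0 < \<epsilon>\<close>] unfolding norm_closure_def by blast
    have "y \<in> carr V" using y by (simp add: norm_closure_def)
    then have "vnorm V (x - s) < \<epsilon>"
      using diff_triangle[OF x _ s(2), of y] norm_diff_commute[OF x, of y] y s by simp
    then show "\<exists>s\<in>S \<inter> carr V. vnorm V (x - s) < \<epsilon>" using s by blast
  qed
  have sub: "vs.subspace (?N)"
  proof (rule vs.subspaceI)
    show "0 \<in> ?N" using subset_norm_closure[OF S(2)] vs.subspace_0[OF S(1)] by blast
  next
    fix x y assume x: "x \<in> ?N" and y: "y \<in> ?N"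
    then have c: "x \<in> carr V" "y \<in> carr V" by (auto simp: norm_closure_def)
    show "x + y \<in> ?N"
      unfolding norm_closure_def
    proof (intro CollectI conjI allI impI add_mem c)
      fix \<epsilon> :: real assume "0 < \<epsilon>"
      then have e: "0 < \<epsilon> / 2" by simp
      obtain s where s: "s \<in> S" "s \<in> carr V" "vnorm V (x - s) < \<epsilon> / 2"
        using x e unfolding norm_closure_def by blast
      obtain t where t: "t \<in> S" "t \<in> carr V" "vnorm V (y - t) < \<epsilon> / 2"
        using y e unfolding norm_closure_def by blast
      have "vnorm V ((x + y) - (s + t)) < \<epsilon>"
        using triangle[OF diff_mem[OF c(1) s(2)] diff_mem[OF c(2) t(2)]] s t by (simp add: algebra_simps)
      then show "\<exists>s\<in>S \<inter> carr V. vnorm V (x + y - s) < \<epsilon>"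
        using vs.subspace_add[OF S(1) s(1) t(1)] S(2) by blast
    qed
  next
    fix c x assume x: "x \<in> ?N"
    then have cx: "x \<in> carr V" by (auto simp: norm_closure_def)
    show "scal V c x \<in> ?N"
      unfolding norm_closure_def
    proof (intro CollectI conjI allI impI scale_mem cx)
      fix \<epsilon> :: real assume e: "0 < \<epsilon>"
      have "0 < \<epsilon> / (cmod c + 1)" using e by (simp add: add_nonneg_pos)
      then obtain s where s: "s \<in> S" "s \<in> carr V" "vnorm V (x - s) < \<epsilon> / (cmod c + 1)"
        using x unfolding norm_closure_def by blast
      have "vnorm V (scal V c x - scal V c s) = cmod c * vnorm V (x - s)"
        using scale[OF diff_mem[OF cx s(2)], of c] by (simp add: vs.scale_right_diff_distrib)
      also have "\<dots> \<le> (cmod c + 1) * vnorm V (x - s)"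
        using nonneg[OF diff_mem[OF cx s(2)]] by (intro mult_right_mono) auto
      also have "\<dots> < \<epsilon>"
        using s(3) by (simp add: pos_less_divide_eq add_nonneg_pos mult.commute)
      finally show "\<exists>s\<in>S \<inter> carr V. vnorm V (scal V c x - s) < \<epsilon>"
        using vs.subspace_scale[OF S(1) s(1)] S(2) by blast
    qed
  qed
  have sub_carr: "?N \<subseteq> carr V" by (auto simp: norm_closure_def)
  have comp: "\<exists>x\<in>?N. (\<lambda>n. vnorm V (\<sigma> n - x)) \<longlonglongrightarrow> 0"
    if \<sigma>: "\<forall>n. \<sigma> n \<in> ?N" and C: "\<forall>\<epsilon>>0. \<exists>N. \<forall>m\<ge>N. \<forall>n\<ge>N. vnorm V (\<sigma> m - \<sigma> n) < \<epsilon>" for \<sigma> :: "nat \<Rightarrow> 'v"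
  proof -
    obtain x where x: "x \<in> carr V" "(\<lambda>n. vnorm V (\<sigma> n - x)) \<longlonglongrightarrow> 0"
      using complete[of \<sigma>] \<sigma> C sub_carr by blast
    have "\<exists>y\<in>?N. vnorm V (y - x) < \<epsilon>" if "0 < \<epsilon>" for \<epsilon>
    proof -
      have "eventually (\<lambda>n. vnorm V (\<sigma> n - x) < \<epsilon>) sequentially"
        using order_tendstoD(2)[OF x(2) that] .
      then show ?thesis using \<sigma> by (auto simp: eventually_sequentially)
    qed
    then show ?thesis using closed[OF x(1)] x(2) by blast
  qed
  show ?thesis
    unfolding banach_space_def
  proof (intro conjI ballI allI impI)
    fix \<sigma> :: "nat \<Rightarrow> 'v"
    assume "(\<forall>n. \<sigma> n \<in> carr (?V)) \<and>
      (\<forall>\<epsilon>>0. \<exists>N. \<forall>m\<ge>N. \<forall>n\<ge>N. vnorm (?V) (\<sigma> m - \<sigma> n) < \<epsilon>)"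
    then show "\<exists>x\<in>carr (?V). (\<lambda>n. vnorm (?V) (\<sigma> n - x)) \<longlonglongrightarrow> 0"
      using comp[of \<sigma>] by simp
  next
    show "vector_space (scal (?V))"
      using vs.vector_space_axioms by simp
  qed (use sub sub_carr in \<open>auto simp: nonneg eq_0 scale triangle subset_iff\<close>)
qed

end

locale operator_space = E: banach_carrier E + F: banach_carrier F for E :: "('a::ab_group_add) nspace" and F :: "('b::ab_group_add) nspace"
begin

abbreviation "W \<equiv> bounded_ops E F"

lemma scal_W: "scal W = (\<lambda>c T x. scal F c (T x))"
  by (simp add: bounded_ops_def)

lemma opI:
  assumes "\<And>x. x \<in> carr E \<Longrightarrow> T x \<in> carr F" "\<And>x. x \<notin> carr E \<Longrightarrow> T x = 0"
    "\<And>x y. x \<in> carr E \<Longrightarrow> y \<in> carr E \<Longrightarrow> T (x + y) = T x + T y"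
    "\<And>c x. x \<in> carr E \<Longrightarrow> T (scal E c x) = scal F c (T x)"
    "\<And>x. x \<in> carr E \<Longrightarrow> vnorm F (T x) \<le> C * vnorm E x"
  shows "T \<in> carr W"
  using assms by (auto simp: bounded_ops_def intro!: exI[of _ C])

lemma op_mem: "T \<in> carr W \<Longrightarrow> x \<in> carr E \<Longrightarrow> T x \<in> carr F"
  and op_outside: "T \<in> carr W \<Longrightarrow> x \<notin> carr E \<Longrightarrow> T x = 0"
  and op_add: "T \<in> carr W \<Longrightarrow> x \<in> carr E \<Longrightarrow> y \<in> carr E \<Longrightarrow> T (x + y) = T x + T y"
  and op_scale: "T \<in> carr W \<Longrightarrow> x \<in> carr E \<Longrightarrow> T (scal E c x) = scal F c (T x)"
  by (auto simp: bounded_ops_def)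

lemma op_diff: "T \<in> carr W \<Longrightarrow> x \<in> carr E \<Longrightarrow> y \<in> carr E \<Longrightarrow> T (x - y) = T x - T y"
  using op_add[of T "x - y" y] E.diff_mem[of x y] by simp

lemma op_0: "T \<in> carr W \<Longrightarrow> T 0 = 0"
  using op_diff[of T 0 0] E.zero_mem by simp

lemma opnorm_le:
  assumes "0 \<le> C" "\<And>x. x \<in> carr E \<Longrightarrow> vnorm F (T x) \<le> C * vnorm E x"
  shows "vnorm W T \<le> C"
  unfolding bounded_ops_def nspace.select_convs
  by (rule cInf_lower) (use assms in \<open>auto intro!: bdd_belowI[of _ 0]\<close>)

lemma opnorm:
  assumes T: "T \<in> carr W"
  shows "0 \<le> vnorm W T" "x \<in> carr E \<Longrightarrow> vnorm F (T x) \<le> vnorm W T * vnorm E x"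
proof -
  let ?S = "{C. 0 \<le> C \<and> (\<forall>x \<in> carr E. vnorm F (T x) \<le> C * vnorm E x)}"
  obtain C where C: "\<forall>x \<in> carr E. vnorm F (T x) \<le> C * vnorm E x"
    using T by (auto simp: bounded_ops_def)
  have "vnorm F (T x) \<le> max C 0 * vnorm E x" if "x \<in> carr E" for x
  proof -
    have "C * vnorm E x \<le> max C 0 * vnorm E x"
      using E.nonneg[OF that] by (intro mult_right_mono) auto
    then show ?thesis using C that by force
  qed
  then have "max C 0 \<in> ?S" by auto
  then have ne: "?S \<noteq> {}" by blast
  have n: "vnorm W T = Inf ?S" by (simp add: bounded_ops_def)
  show "0 \<le> vnorm W T"
    unfolding n by (rule cInf_greatest[OF ne]) auto
  show "vnorm F (T x) \<le> vnorm W T * vnorm E x" if x: "x \<in> carr E"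
  proof (cases "vnorm E x = 0")
    case True
    then show ?thesis using C x by force
  next
    case False
    then have pos: "0 < vnorm E x" using E.nonneg[OF x] by simp
    have "vnorm F (T x) / vnorm E x \<le> Inf ?S"
      by (rule cInf_greatest[OF ne]) (use pos x in \<open>auto simp: pos_divide_le_eq\<close>)
    then show ?thesis unfolding n using pos by (simp add: pos_divide_le_eq)
  qed
qed

text \<open>A Cauchy sequence of operators converges pointwise; the Cauchy estimate, passed to the limit in one index,
  bounds the distance to the limit by \<open>e\<close> times the norm of the argument, uniformly in the argument.\<close>

lemma banach_bounded_ops: "banach_space W"
proof -
  have vs: "vector_space (scal W)"
    unfolding scal_W
    by unfold_locales (auto simp: fun_eq_iff F.vs.scale_right_distrib F.vs.scale_left_distrib)
  interpret Wvs: vector_space "scal W" by (rule vs)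
  have zero: "0 \<in> carr W"
    by (rule opI[where C = 0]) (auto simp: F.zero_mem F.norm_0)
  have add: "S + T \<in> carr W \<and> vnorm W (S + T) \<le> vnorm W S + vnorm W T"
    if S: "S \<in> carr W" and T: "T \<in> carr W" for S T
  proof -
    have b: "vnorm F ((S + T) x) \<le> (vnorm W S + vnorm W T) * vnorm E x" if x: "x \<in> carr E" for x
      using F.triangle[OF op_mem[OF S x] op_mem[OF T x]] opnorm(2)[OF S x] opnorm(2)[OF T x]
      by (simp add: distrib_right)
    have "S + T \<in> carr W"
      by (rule opI[OF _ _ _ _ b])
        (auto simp: S T op_mem op_outside op_add op_scale F.add_mem F.vs.scale_right_distrib algebra_simps)
    moreover have "vnorm W (S + T) \<le> vnorm W S + vnorm W T"
      by (rule opnorm_le[OF _ b]) (use opnorm(1) S T in auto)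
    ultimately show ?thesis by blast
  qed
  have scale_le: "scal W c T \<in> carr W \<and> vnorm W (scal W c T) \<le> cmod c * vnorm W T"
    if T: "T \<in> carr W" for c T
  proof -
    have b: "vnorm F (scal W c T x) \<le> (cmod c * vnorm W T) * vnorm E x" if x: "x \<in> carr E" for x
      using F.scale[OF op_mem[OF T x], of c] opnorm(2)[OF T x]
      by (simp add: scal_W mult_left_mono mult.assoc)
    have "scal W c T \<in> carr W"
      by (rule opI[OF _ _ _ _ b])
        (auto simp: scal_W T op_mem op_outside op_add op_scale F.scale_mem F.vs.scale_right_distrib
          F.vs.scale_scale mult.commute)
    moreover have "vnorm W (scal W c T) \<le> cmod c * vnorm W T"
      by (rule opnorm_le[OF _ b]) (use opnorm(1) T in auto)
    ultimately show ?thesis by blast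
  qed
  have norm_0: "vnorm W 0 = 0"
    using opnorm_le[of 0 0] opnorm(1)[OF zero] by (simp add: F.norm_0)
  have scale: "vnorm W (scal W c T) = cmod c * vnorm W T" if T: "T \<in> carr W" for c T
  proof (cases "c = 0")
    case True
    then have "scal W c T = 0" by (auto simp: scal_W)
    then show ?thesis using True norm_0 by simp
  next
    case False
    have "scal W (inverse c) (scal W c T) = T" using False by (simp add: scal_W)
    then have "vnorm W T \<le> inverse (cmod c) * vnorm W (scal W c T)"
      using scale_le[of "scal W c T" "inverse c"] scale_le[OF T, of c] by (simp add: norm_inverse)
    then have "cmod c * vnorm W T \<le> vnorm W (scal W c T)"
      using False by (simp add: field_simps)
    then show ?thesis using scale_le[OF T, of c] by simp
  qed
  have sub: "Wvs.subspace (carr W)"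
    using add scale_le zero by (intro Wvs.subspaceI) auto
  have eq_0: "vnorm W T = 0 \<longleftrightarrow> T = 0" if T: "T \<in> carr W" for T
  proof
    assume n: "vnorm W T = 0"
    have "T x = 0" if x: "x \<in> carr E" for x
      using opnorm(2)[OF T x] F.nonneg[OF op_mem[OF T x]] F.eq_0[OF op_mem[OF T x]] n by simp
    then show "T = 0" using op_outside[OF T] by (metis ext zero_fun_apply)
  qed (simp add: norm_0)
  have complete: "\<exists>L\<in>carr W. (\<lambda>n. vnorm W (\<sigma> n - L)) \<longlonglongrightarrow> 0"
    if \<sigma>: "\<And>n. \<sigma> n \<in> carr W" and C: "\<And>\<epsilon>. 0 < \<epsilon> \<Longrightarrow> \<exists>N. \<forall>m\<ge>N. \<forall>n\<ge>N. vnorm W (\<sigma> m - \<sigma> n) < \<epsilon>" for \<sigma>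
  proof -
    have diff: "S - T \<in> carr W" if "S \<in> carr W" "T \<in> carr W" for S T
      by (rule Wvs.subspace_diff[OF sub that])
    have cauchy: "vnorm F (\<sigma> m x - \<sigma> n x) \<le> vnorm W (\<sigma> m - \<sigma> n) * vnorm E x" if "x \<in> carr E" for m n x
      using opnorm(2)[OF diff[OF \<sigma> \<sigma>] that, of m n] by simp
    have "\<exists>y\<in>carr F. (\<lambda>n. vnorm F (\<sigma> n x - y)) \<longlonglongrightarrow> 0" if x: "x \<in> carr E" for x
    proof (rule F.complete)
      fix \<epsilon> :: real assume e: "0 < \<epsilon>"
      have pos: "0 < vnorm E x + 1" using E.nonneg[OF x] by simp
      then obtain N where N: "\<forall>m\<ge>N. \<forall>n\<ge>N. vnorm W (\<sigma> m - \<sigma> n) < \<epsilon> / (vnorm E x + 1)"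
        using C[of "\<epsilon> / (vnorm E x + 1)"] e by auto
      have "vnorm F (\<sigma> m x - \<sigma> n x) < \<epsilon>" if "m \<ge> N" "n \<ge> N" for m n
      proof -
        have "vnorm F (\<sigma> m x - \<sigma> n x) \<le> vnorm W (\<sigma> m - \<sigma> n) * (vnorm E x + 1)"
          using cauchy[OF x, of m n] opnorm(1)[OF diff[OF \<sigma> \<sigma>], of m n] by (simp add: distrib_left)
        also have "\<dots> < \<epsilon>" using N that pos by (simp add: pos_less_divide_eq)
        finally show ?thesis .
      qed
      then show "\<exists>N. \<forall>m\<ge>N. \<forall>n\<ge>N. vnorm F (\<sigma> m x - \<sigma> n x) < \<epsilon>" by blast
    qed (rule op_mem[OF \<sigma> x])
    then obtain L0 where L0: "\<And>x. x \<in> carr E \<Longrightarrow> L0 x \<in> carr F \<and> (\<lambda>n. vnorm F (\<sigma> n x - L0 x)) \<longlonglongrightarrow> 0"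
      by metis
    define L where "L x = (if x \<in> carr E then L0 x else 0)" for x
    have L: "L x \<in> carr F" "(\<lambda>n. vnorm F (\<sigma> n x - L x)) \<longlonglongrightarrow> 0" if "x \<in> carr E" for x
      using L0[OF that] that by (auto simp: L_def)
    have tail: "\<exists>N. \<forall>n\<ge>N. \<forall>x\<in>carr E. vnorm F (\<sigma> n x - L x) \<le> e * vnorm E x" if e: "0 < e" for e
    proof -
      obtain N where N: "\<forall>m\<ge>N. \<forall>n\<ge>N. vnorm W (\<sigma> m - \<sigma> n) < e" using C[OF e] by blast
      have "vnorm F (\<sigma> n x - L x) \<le> e * vnorm E x" if n: "n \<ge> N" and x: "x \<in> carr E" for n x
      proof (rule LIMSEQ_le_const)
        show "(\<lambda>m. e * vnorm E x + vnorm F (\<sigma> m x - L x)) \<longlonglongrightarrow> e * vnorm E x"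
          using tendsto_add[OF tendsto_const L(2)[OF x]] by simp
        have "vnorm F (\<sigma> n x - L x) \<le> e * vnorm E x + vnorm F (\<sigma> m x - L x)" if m: "m \<ge> N" for m
        proof -
          have "vnorm F (\<sigma> n x - \<sigma> m x) \<le> e * vnorm E x"
            using cauchy[OF x, of n m] mult_right_mono[OF less_imp_le E.nonneg[OF x], of "vnorm W (\<sigma> n - \<sigma> m)" e]
              N n m by force
          then show ?thesis
            using F.diff_triangle[OF op_mem[OF \<sigma> x] op_mem[OF \<sigma> x] L(1)[OF x], of n m] by linarith
        qed
        then show "\<exists>N. \<forall>m\<ge>N. vnorm F (\<sigma> n x - L x) \<le> e * vnorm E x + vnorm F (\<sigma> m x - L x)" by blast
      qed
      then show ?thesis by blast
    qed
    have add_lim: "L (x + y) = L x + L y" if x: "x \<in> carr E" and y: "y \<in> carr E" for x y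
    proof (rule F.norm_limit_unique[where s = "\<lambda>n. \<sigma> n (x + y)"])
      have "vnorm F (\<sigma> n (x + y) - (L x + L y)) \<le> vnorm F (\<sigma> n x - L x) + vnorm F (\<sigma> n y - L y)" for n
        using F.triangle[OF F.diff_mem[OF op_mem[OF \<sigma> x] L(1)[OF x]] F.diff_mem[OF op_mem[OF \<sigma> y] L(1)[OF y]], of n n]
        by (simp add: op_add[OF \<sigma> x y] algebra_simps)
      moreover have "0 \<le> vnorm F (\<sigma> n (x + y) - (L x + L y))" for n
        by (intro F.nonneg F.diff_mem F.add_mem op_mem[OF \<sigma>] E.add_mem L x y)
      ultimately show "(\<lambda>n. vnorm F (\<sigma> n (x + y) - (L x + L y))) \<longlonglongrightarrow> 0"
        by (intro tendsto_sandwich[OF _ _ tendsto_const tendsto_add_zero[OF L(2)[OF x] L(2)[OF y]]]) auto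
    qed (auto intro!: F.add_mem op_mem[OF \<sigma>] E.add_mem L x y)
    have scale_lim: "L (scal E c x) = scal F c (L x)" if x: "x \<in> carr E" for x c
    proof (rule F.norm_limit_unique[where s = "\<lambda>n. \<sigma> n (scal E c x)"])
      have "vnorm F (\<sigma> n (scal E c x) - scal F c (L x)) = cmod c * vnorm F (\<sigma> n x - L x)" for n
        using F.scale[OF F.diff_mem[OF op_mem[OF \<sigma> x] L(1)[OF x]], of c n]
        by (simp add: op_scale[OF \<sigma> x] F.vs.scale_right_diff_distrib)
      then show "(\<lambda>n. vnorm F (\<sigma> n (scal E c x) - scal F c (L x))) \<longlonglongrightarrow> 0"
        using tendsto_mult_left[OF L(2)[OF x], of "cmod c"] by simp
    qed (auto intro!: F.scale_mem op_mem[OF \<sigma>] E.scale_mem L x)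
    obtain N where N: "\<forall>n\<ge>N. \<forall>x\<in>carr E. vnorm F (\<sigma> n x - L x) \<le> 1 * vnorm E x" using tail[of 1] by auto
    have "L \<in> carr W"
    proof (rule opI[where C = "vnorm W (\<sigma> N) + 1"])
      fix x assume x: "x \<in> carr E"
      have "vnorm F (L x) \<le> vnorm F (\<sigma> N x) + vnorm F (\<sigma> N x - L x)"
        using F.norm_triangle_sub[OF L(1)[OF x] op_mem[OF \<sigma> x], of N]
          F.norm_diff_commute[OF L(1)[OF x] op_mem[OF \<sigma> x], of N] by simp
      then show "vnorm F (L x) \<le> (vnorm W (\<sigma> N) + 1) * vnorm E x"
        using opnorm(2)[OF \<sigma> x, of N] N x by (force simp: distrib_right)
    qed (auto simp: L add_lim scale_lim, simp add: L_def)
    moreover have "(\<lambda>n. vnorm W (\<sigma> n - L)) \<longlonglongrightarrow> 0"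
    proof (rule LIMSEQ_I)
      fix e :: real assume e: "0 < e"
      obtain N where N: "\<forall>n\<ge>N. \<forall>x\<in>carr E. vnorm F (\<sigma> n x - L x) \<le> e / 2 * vnorm E x"
        using tail[of "e / 2"] e by auto
      have "norm (vnorm W (\<sigma> n - L) - 0) < e" if "n \<ge> N" for n
        using opnorm_le[of "e / 2" "\<sigma> n - L"] opnorm(1)[OF diff[OF \<sigma> \<open>L \<in> carr W\<close>], of n] N that e by auto
      then show "\<exists>N. \<forall>n\<ge>N. norm (vnorm W (\<sigma> n - L) - 0) < e" by blast
    qed
    ultimately show ?thesis by blast
  qed
  show ?thesis
    unfolding banach_space_def
  proof (intro conjI ballI allI impI)
    fix \<sigma> :: "nat \<Rightarrow> 'a \<Rightarrow> 'b"
    assume "(\<forall>n. \<sigma> n \<in> carr W) \<and> (\<forall>\<epsilon>>0. \<exists>N. \<forall>m\<ge>N. \<forall>n\<ge>N. vnorm W (\<sigma> m - \<sigma> n) < \<epsilon>)"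
    then show "\<exists>L\<in>carr W. (\<lambda>n. vnorm W (\<sigma> n - L)) \<longlonglongrightarrow> 0"
      by (intro complete) auto
  qed (simp_all add: vs sub scale add eq_0 opnorm(1))
qed

end

lemma comp_bounded_ops:
  assumes "banach_space E" "banach_space F" "banach_space K"
    and S: "S \<in> carr (bounded_ops F K)" and T: "T \<in> carr (bounded_ops E F)"
  shows "S \<circ> T \<in> carr (bounded_ops E K)"
    and "vnorm (bounded_ops E K) (S \<circ> T) \<le> vnorm (bounded_ops F K) S * vnorm (bounded_ops E F) T"
proof -
  interpret EF: operator_space E F by unfold_locales (use assms in auto)
  interpret FK: operator_space F K by unfold_locales (use assms in auto)
  interpret EK: operator_space E K by unfold_locales (use assms in auto)
  have b: "vnorm K ((S \<circ> T) x) \<le> (vnorm FK.W S * vnorm EF.W T) * vnorm E x" if x: "x \<in> carr E" for x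
  proof -
    have "vnorm K (S (T x)) \<le> vnorm FK.W S * vnorm F (T x)"
      by (rule FK.opnorm(2)[OF S EF.op_mem[OF T x]])
    also have "\<dots> \<le> vnorm FK.W S * (vnorm EF.W T * vnorm E x)"
      by (intro mult_left_mono EF.opnorm(2)[OF T x] FK.opnorm(1)[OF S])
    finally show ?thesis by (simp add: mult.assoc)
  qed
  show "S \<circ> T \<in> carr EK.W"
    by (rule EK.opI[OF _ _ _ _ b])
      (auto simp: S T EF.op_mem FK.op_mem EF.op_outside FK.op_0 EF.op_add FK.op_add EF.op_scale FK.op_scale)
  show "vnorm EK.W (S \<circ> T) \<le> vnorm FK.W S * vnorm EF.W T"
    by (rule EK.opnorm_le[OF _ b]) (use EF.opnorm(1)[OF T] FK.opnorm(1)[OF S] in auto)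
qed

text \<open>The estimate rests on \<open>ST - st = (S - s)T + s(T - t)\<close>. The tolerance for \<open>t\<close> involves the norm of
  \<open>s\<close>, so \<open>s\<close> has to be chosen first.\<close>

lemma comp_norm_closure:
  assumes B: "banach_space E" "banach_space F" "banach_space K"
    and S: "S \<in> norm_closure (bounded_ops F K) \<S>" and T: "T \<in> norm_closure (bounded_ops E F) \<T>"
    and R: "\<And>s t. s \<in> \<S> \<Longrightarrow> t \<in> \<T> \<Longrightarrow> s \<circ> t \<in> \<R>"
  shows "S \<circ> T \<in> norm_closure (bounded_ops E K) \<R>"
proof -
  interpret EF: operator_space E F by unfold_locales (use B in auto)
  interpret FK: operator_space F K by unfold_locales (use B in auto)
  interpret EK: operator_space E K by unfold_locales (use B in auto)
  interpret WEF: banach_carrier EF.W by unfold_locales (rule EF.banach_bounded_ops)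
  interpret WFK: banach_carrier FK.W by unfold_locales (rule FK.banach_bounded_ops)
  interpret WEK: banach_carrier EK.W by unfold_locales (rule EK.banach_bounded_ops)
  note comp = comp_bounded_ops[OF B]
  have Sc: "S \<in> carr FK.W" and Tc: "T \<in> carr EF.W" using S T by (auto simp: norm_closure_def)
  show ?thesis
    unfolding norm_closure_def
  proof (intro CollectI conjI allI impI comp(1)[OF Sc Tc])
    fix \<epsilon> :: real assume e: "0 < \<epsilon>"
    define a where "a = \<epsilon> / 2 / (vnorm EF.W T + 1)"
    have a: "0 < a" using e EF.opnorm(1)[OF Tc] by (simp add: a_def)
    obtain s where s: "s \<in> \<S>" "s \<in> carr FK.W" "vnorm FK.W (S - s) < a"
      using S a unfolding norm_closure_def by blast
    define b where "b = \<epsilon> / 2 / (vnorm FK.W s + 1)"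
    have b: "0 < b" using e FK.opnorm(1)[OF s(2)] by (simp add: b_def)
    obtain t where t: "t \<in> \<T>" "t \<in> carr EF.W" "vnorm EF.W (T - t) < b"
      using T b unfolding norm_closure_def by blast
    note d1 = WFK.diff_mem[OF Sc s(2)] and d2 = WEF.diff_mem[OF Tc t(2)]
    have split: "(S \<circ> T) - (s \<circ> t) = ((S - s) \<circ> T) + (s \<circ> (T - t))"
    proof
      fix x
      show "((S \<circ> T) - (s \<circ> t)) x = (((S - s) \<circ> T) + (s \<circ> (T - t))) x"
        by (cases "x \<in> carr E")
          (auto simp: FK.op_diff[OF s(2)] EF.op_mem[OF Tc] EF.op_mem[OF t(2)] EF.op_outside[OF Tc]
            EF.op_outside[OF t(2)] FK.op_0[OF s(2)])
    qed
    have "vnorm EK.W ((S - s) \<circ> T) \<le> a * vnorm EF.W T"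
      using comp(2)[OF d1 Tc] mult_right_mono[OF less_imp_le[OF s(3)] EF.opnorm(1)[OF Tc]] by linarith
    also have "\<dots> < a * (vnorm EF.W T + 1)" using a by (simp add: distrib_left)
    also have "\<dots> = \<epsilon> / 2" using iffD1[OF nonzero_eq_divide_eq a_def] EF.opnorm(1)[OF Tc] by simp
    finally have 1: "vnorm EK.W ((S - s) \<circ> T) < \<epsilon> / 2" .
    have "vnorm EK.W (s \<circ> (T - t)) \<le> vnorm FK.W s * b"
      using comp(2)[OF s(2) d2] mult_left_mono[OF less_imp_le[OF t(3)] FK.opnorm(1)[OF s(2)]] by linarith
    also have "\<dots> < (vnorm FK.W s + 1) * b" using b by (simp add: distrib_right)
    also have "\<dots> = \<epsilon> / 2" using iffD1[OF nonzero_eq_divide_eq b_def] FK.opnorm(1)[OF s(2)] by (simp add: mult.commute)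
    finally have 2: "vnorm EK.W (s \<circ> (T - t)) < \<epsilon> / 2" .
    have "vnorm EK.W ((S \<circ> T) - (s \<circ> t)) < \<epsilon>"
      unfolding split using WEK.triangle[OF comp(1)[OF d1 Tc] comp(1)[OF s(2) d2]] 1 2 by linarith
    then show "\<exists>r\<in>\<R> \<inter> carr EK.W. vnorm EK.W ((S \<circ> T) - r) < \<epsilon>"
      using R[OF s(1) t(1)] comp(1)[OF s(2) t(2)] by blast
  qed
qed


section \<open>Kernels with uniformly finite rows and columns\<close>

lemma infsum_finite_superset:
  fixes f :: "'a \<Rightarrow> 'b::{comm_monoid_add,t2_space}"
  assumes "finite X" "X \<subseteq> A" "\<And>x. x \<in> A - X \<Longrightarrow> f x = 0"
  shows "infsum f A = sum f X"
proof -
  have "infsum f A = infsum f X"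
    by (rule infsum_cong_neutral) (use assms in auto)
  then show ?thesis using assms(1) by simp
qed

lemma infsum_eq_single:
  fixes f :: "'a \<Rightarrow> 'b::{comm_monoid_add,t2_space}"
  assumes "a \<in> A" "\<And>x. x \<in> A \<Longrightarrow> x \<noteq> a \<Longrightarrow> f x = 0"
  shows "infsum f A = f a"
  using infsum_finite_superset[of "{a}" A f] assms by auto

lemma infsum_eq_zero:
  fixes f :: "'a \<Rightarrow> 'b::{comm_monoid_add,t2_space}"
  assumes "\<And>x. x \<in> A \<Longrightarrow> f x = 0"
  shows "infsum f A = 0"
  using infsum_finite_superset[of "{}" A f] assms by auto

lemma infsum_mult_add_left:
  fixes f f' g :: "'a \<Rightarrow> complex"
  assumes "finite {x \<in> A. g x \<noteq> 0}"
  shows "(\<Sum>\<^sub>\<infinity>x\<in>A. (f x + f' x) * g x) = (\<Sum>\<^sub>\<infinity>x\<in>A. f x * g x) + (\<Sum>\<^sub>\<infinity>x\<in>A. f' x * g x)"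
proof -
  have "(\<lambda>x. h x * g x) summable_on A" for h
    by (rule finite_nonzero_values_imp_summable_on, rule finite_subset[OF _ assms]) auto
  then show ?thesis by (simp add: distrib_right infsum_add)
qed

lemma infsum_mult_add_right:
  fixes f f' g :: "'a \<Rightarrow> complex"
  assumes "finite {x \<in> A. g x \<noteq> 0}"
  shows "(\<Sum>\<^sub>\<infinity>x\<in>A. g x * (f x + f' x)) = (\<Sum>\<^sub>\<infinity>x\<in>A. g x * f x) + (\<Sum>\<^sub>\<infinity>x\<in>A. g x * f' x)"
  using infsum_mult_add_left[OF assms, of f f'] by (simp only: mult.commute)

lemma infsum_mult_scale:
  fixes f g :: "'a \<Rightarrow> complex"
  shows "(\<Sum>\<^sub>\<infinity>x\<in>A. (c * f x) * g x) = c * (\<Sum>\<^sub>\<infinity>x\<in>A. f x * g x)"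
    and "(\<Sum>\<^sub>\<infinity>x\<in>A. f x * (c * g x)) = c * (\<Sum>\<^sub>\<infinity>x\<in>A. f x * g x)"
  unfolding infsum_cmult_right'[symmetric] by (simp_all add: mult_ac)

text \<open>Finite rows make both sums finite, so that they may be exchanged.\<close>

lemma infsum_matrix_product:
  fixes f :: "'a \<Rightarrow> complex" and g :: "'a \<Rightarrow> 'b \<Rightarrow> complex"
  assumes f: "finite {x \<in> A. f x \<noteq> 0}" and g: "\<And>x. x \<in> A \<Longrightarrow> f x \<noteq> 0 \<Longrightarrow> finite {y \<in> B. g x y \<noteq> 0}"
  shows "(\<Sum>\<^sub>\<infinity>x\<in>A. f x * (\<Sum>\<^sub>\<infinity>y\<in>B. g x y * \<xi> y)) = (\<Sum>\<^sub>\<infinity>y\<in>B. (\<Sum>\<^sub>\<infinity>x\<in>A. f x * g x y) * \<xi> y)"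
proof -
  define X where "X = {x \<in> A. f x \<noteq> 0}"
  define Y where "Y = (\<Union>x\<in>X. {y \<in> B. g x y \<noteq> 0})"
  have fin: "finite X" "X \<subseteq> A" "finite Y" "Y \<subseteq> B" using f g by (auto simp: X_def Y_def)
  have col: "(\<Sum>\<^sub>\<infinity>x\<in>A. f x * g x y) = (\<Sum>x\<in>X. f x * g x y)" for y
    by (rule infsum_finite_superset[OF fin(1,2)]) (auto simp: X_def)
  have row: "(\<Sum>\<^sub>\<infinity>y\<in>B. g x y * \<xi> y) = (\<Sum>y\<in>Y. g x y * \<xi> y)" if "x \<in> X" for x
    by (rule infsum_finite_superset[OF fin(3,4)]) (use that in \<open>auto simp: Y_def\<close>)
  have "(\<Sum>\<^sub>\<infinity>x\<in>A. f x * (\<Sum>\<^sub>\<infinity>y\<in>B. g x y * \<xi> y)) = (\<Sum>x\<in>X. f x * (\<Sum>\<^sub>\<infinity>y\<in>B. g x y * \<xi> y))"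
    by (rule infsum_finite_superset[OF fin(1,2)]) (auto simp: X_def)
  also have "\<dots> = (\<Sum>x\<in>X. \<Sum>y\<in>Y. f x * g x y * \<xi> y)"
    by (rule sum.cong) (auto simp: row sum_distrib_left mult.assoc)
  also have "\<dots> = (\<Sum>y\<in>Y. (\<Sum>x\<in>X. f x * g x y) * \<xi> y)"
    by (subst sum.swap) (simp add: sum_distrib_right)
  also have "\<dots> = (\<Sum>\<^sub>\<infinity>y\<in>B. (\<Sum>\<^sub>\<infinity>x\<in>A. f x * g x y) * \<xi> y)"
  proof (subst infsum_finite_superset[OF fin(3,4)])
    fix y assume y: "y \<in> B - Y"
    have "(\<Sum>\<^sub>\<infinity>x\<in>A. f x * g x y) = 0"
      unfolding col using y by (intro sum.neutral) (auto simp: Y_def)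
    then show "(\<Sum>\<^sub>\<infinity>x\<in>A. f x * g x y) * \<xi> y = 0" by simp
  qed (simp add: col)
  finally show ?thesis .
qed

definition fin_le :: "nat \<Rightarrow> 'a set \<Rightarrow> bool" where
  "fin_le N S \<longleftrightarrow> finite S \<and> card S \<le> N"

lemma fin_le_subset: "fin_le N T \<Longrightarrow> S \<subseteq> T \<Longrightarrow> N \<le> M \<Longrightarrow> fin_le M S"
  unfolding fin_le_def using card_mono finite_subset by (metis le_trans)

lemma fin_le_Un: "fin_le N S \<Longrightarrow> fin_le M T \<Longrightarrow> fin_le (N + M) (S \<union> T)"
  unfolding fin_le_def using card_Un_le by (metis add_mono finite_Un le_trans)

lemma fin_le_image: "fin_le N T \<Longrightarrow> S \<subseteq> f ` T \<Longrightarrow> fin_le N S"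
  unfolding fin_le_def by (meson card_image_le card_mono finite_imageI finite_subset le_trans)

lemma fin_le_single: "(\<And>x y. x \<in> S \<Longrightarrow> y \<in> S \<Longrightarrow> x = y) \<Longrightarrow> fin_le 1 S"
  unfolding fin_le_def
  by (metis One_nat_def card.empty card_le_Suc0_iff_eq finite.emptyI finite_insert le0 subsetI
      finite_subset insertI1 ex_in_conv)

lemma fin_le_UN:
  assumes "finite I" "\<And>i. i \<in> I \<Longrightarrow> fin_le 1 (S i)"
  shows "fin_le (card I) (\<Union>i\<in>I. S i)"
proof -
  have "card (\<Union>i\<in>I. S i) \<le> (\<Sum>i\<in>I. card (S i))" by (rule card_UN_le[OF assms(1)])
  also have "\<dots> \<le> (\<Sum>i\<in>I. 1)" by (rule sum_mono) (use assms in \<open>simp add: fin_le_def\<close>)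
  finally show ?thesis using assms by (simp add: fin_le_def)
qed

text \<open>The value 0 off \<open>carr E\<close> is the convention of \<open>bounded_ops\<close>.\<close>

definition kernel_op ::
  "('b \<Rightarrow> complex) nspace \<Rightarrow> 'a set \<Rightarrow> ('a \<Rightarrow> 'b set) \<Rightarrow> ('a \<Rightarrow> 'b \<Rightarrow> complex) \<Rightarrow> ('b \<Rightarrow> complex) \<Rightarrow> 'a \<Rightarrow> complex" where
  "kernel_op E A J k = (\<lambda>\<xi> a. if \<xi> \<in> carr E \<and> a \<in> A then \<Sum>\<^sub>\<infinity>b\<in>J a. k a b * \<xi> b else 0)"

lemma kernel_op_add:
  assumes "\<And>a. a \<in> A \<Longrightarrow> finite {b \<in> J a. k a b \<noteq> 0}" "\<And>a. a \<in> A \<Longrightarrow> finite {b \<in> J a. l a b \<noteq> 0}"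
  shows "kernel_op E A J (\<lambda>a b. k a b + l a b) = kernel_op E A J k + kernel_op E A J l"
proof -
  have "(\<lambda>b. m a b * \<xi> b) summable_on J a" if "finite {b \<in> J a. m a b \<noteq> 0}" for m :: "'a \<Rightarrow> 'b \<Rightarrow> complex" and \<xi> a
    by (rule finite_nonzero_values_imp_summable_on, rule finite_subset[OF _ that]) auto
  then show ?thesis using assms by (simp add: kernel_op_def fun_eq_iff distrib_right infsum_add)
qed

lemma kernel_op_scale: "kernel_op E A J (\<lambda>a b. c * k a b) = (\<lambda>\<xi>. fscale c (kernel_op E A J k \<xi>))"
  by (auto simp: kernel_op_def fscale_def infsum_mult_scale fun_eq_iff)

text \<open>Composition multiplies the matrices, provided that all rows \<open>b\<close> that occur in row \<open>a\<close> are summed over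
  the same set \<open>M a\<close>. For fibrewise operators this is the fibre of the common source.\<close>

lemma kernel_op_comp:
  assumes mem: "\<And>\<xi>. \<xi> \<in> carr E \<Longrightarrow> kernel_op E B L l \<xi> \<in> carr F"
    and J: "\<And>a b. a \<in> A \<Longrightarrow> b \<in> J a \<Longrightarrow> b \<in> B \<and> L b = M a"
    and rows: "\<And>a. a \<in> A \<Longrightarrow> finite {b \<in> J a. k a b \<noteq> 0}" "\<And>b. b \<in> B \<Longrightarrow> finite {c \<in> L b. l b c \<noteq> 0}"
    and entries: "\<And>a c. a \<in> A \<Longrightarrow> c \<in> M a \<Longrightarrow> m a c = (\<Sum>\<^sub>\<infinity>b\<in>J a. k a b * l b c)"
  shows "kernel_op F A J k \<circ> kernel_op E B L l = kernel_op E A M m"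
proof (intro ext)
  fix \<xi> a
  show "(kernel_op F A J k \<circ> kernel_op E B L l) \<xi> a = kernel_op E A M m \<xi> a"
  proof (cases "\<xi> \<in> carr E \<and> a \<in> A")
    case True
    then have \<xi>: "\<xi> \<in> carr E" and a: "a \<in> A" by auto
    have "(kernel_op F A J k \<circ> kernel_op E B L l) \<xi> a = (\<Sum>\<^sub>\<infinity>b\<in>J a. k a b * kernel_op E B L l \<xi> b)"
      using mem[OF \<xi>] a by (simp add: kernel_op_def[of F])
    also have "\<dots> = (\<Sum>\<^sub>\<infinity>b\<in>J a. k a b * (\<Sum>\<^sub>\<infinity>c\<in>M a. l b c * \<xi> c))"
      by (rule infsum_cong) (use J[OF a] \<xi> in \<open>simp add: kernel_op_def\<close>)
    also have "\<dots> = (\<Sum>\<^sub>\<infinity>c\<in>M a. (\<Sum>\<^sub>\<infinity>b\<in>J a. k a b * l b c) * \<xi> c)"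
      by (rule infsum_matrix_product[OF rows(1)[OF a]]) (use J[OF a] rows(2) in metis)
    also have "\<dots> = (\<Sum>\<^sub>\<infinity>c\<in>M a. m a c * \<xi> c)"
      by (rule infsum_cong) (simp add: entries[OF a])
    finally show ?thesis using \<xi> a by (simp add: kernel_op_def)
  next
    case False
    have z: "kernel_op F A J k 0 = 0" by (simp add: kernel_op_def fun_eq_iff)
    show ?thesis
    proof (cases "\<xi> \<in> carr E")
      case True
      with False show ?thesis by (simp add: kernel_op_def)
    next
      case False
      then have "kernel_op E B L l \<xi> = 0" "kernel_op E A M m \<xi> = 0" by (simp_all add: kernel_op_def fun_eq_iff)
      then show ?thesis using z by simp
    qed
  qed
qed

lemma powr_sum_le:
  fixes x :: "'b \<Rightarrow> real" and r :: real
  assumes S: "finite S" "card S \<le> N" and x: "\<And>b. b \<in> S \<Longrightarrow> 0 \<le> x b" and r: "1 \<le> r"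
  shows "(\<Sum>b\<in>S. x b) powr r \<le> real N powr r * (\<Sum>b\<in>S. x b powr r)"
proof (cases "S = {}")
  case False
  define m where "m = Max (x ` S)"
  have "m \<in> x ` S" using S False by (simp add: m_def)
  then obtain b0 where b0: "b0 \<in> S" "m = x b0" by blast
  have "(\<Sum>b\<in>S. x b) \<le> of_nat (card S) * m"
    by (rule sum_bounded_above) (use S in \<open>auto simp: m_def\<close>)
  also have "\<dots> \<le> real N * m" using S x b0 by (intro mult_right_mono) auto
  finally have "(\<Sum>b\<in>S. x b) powr r \<le> (real N * m) powr r"
    using r x by (intro powr_mono2) (auto intro: sum_nonneg)
  also have "\<dots> = real N powr r * m powr r" using x b0 by (simp add: powr_mult)
  also have "m powr r \<le> (\<Sum>b\<in>S. x b powr r)"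
    using member_le_sum[OF b0(1), of "\<lambda>b. x b powr r"] S b0 by simp
  finally show ?thesis by (simp add: mult_left_mono)
qed simp

text \<open>A sum of at most \<open>N\<close> terms has \<open>p\<close>-th power at most \<open>N\<^sup>p\<close> times the sum of the \<open>p\<close>-th powers,
  and each coordinate enters at most \<open>N\<close> rows. For \<open>p = \<infinity>\<close> the bound on the rows is enough.\<close>

lemma kernel_bounded:
  fixes k :: "'a \<Rightarrow> 'b \<Rightarrow> complex" and J :: "'a \<Rightarrow> 'b set"
  assumes p: "1 \<le> p" and \<sigma>: "\<sigma> ` B \<subseteq> V" and \<pi>: "\<pi> ` A \<subseteq> V"
    and J: "\<And>a. a \<in> A \<Longrightarrow> J a \<subseteq> B"
    and C: "0 \<le> C" "\<And>a b. a \<in> A \<Longrightarrow> b \<in> J a \<Longrightarrow> cmod (k a b) \<le> C"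
    and N: "1 \<le> N"
    and rows: "\<And>a. a \<in> A \<Longrightarrow> fin_le N {b \<in> J a. k a b \<noteq> 0}"
    and cols: "\<And>b. b \<in> B \<Longrightarrow> fin_le N {a \<in> A. b \<in> J a \<and> k a b \<noteq> 0}"
  shows "kernel_op (lp_sum p V B \<sigma>) A J k \<in> carr (bounded_ops (lp_sum p V B \<sigma>) (lp_sum p V A \<pi>))"
    (is "?T \<in> _")
proof -
  let ?E = "lp_sum p V B \<sigma>" and ?F = "lp_sum p V A \<pi>"
  interpret operator_space ?E ?F
    by unfold_locales (use banach_lp_sum[OF p \<sigma>] banach_lp_sum[OF p \<pi>] in auto)
  note carrE = carr_lp_sum[OF p \<sigma>] and carrF = carr_lp_sum[OF p \<pi>]
  define S where "S a = {b \<in> J a. k a b \<noteq> 0}" for a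
  have S: "finite (S a)" "card (S a) \<le> N" "S a \<subseteq> B" if "a \<in> A" for a
    using rows[OF that] J[OF that] by (auto simp: S_def fin_le_def)
  have T: "?T \<xi> a = (\<Sum>b\<in>S a. k a b * \<xi> b)" if "\<xi> \<in> carr ?E" "a \<in> A" for \<xi> a
    using that infsum_finite_superset[of "S a" "J a" "\<lambda>b. k a b * \<xi> b"] S(1) by (auto simp: S_def kernel_op_def)
  have pt: "cmod (?T \<xi> a) \<le> C * (\<Sum>b\<in>S a. cmod (\<xi> b))" if "\<xi> \<in> carr ?E" "a \<in> A" for \<xi> a
  proof -
    have "cmod (?T \<xi> a) \<le> (\<Sum>b\<in>S a. cmod (k a b * \<xi> b))"
      unfolding T[OF that] by (rule norm_sum)
    also have "\<dots> \<le> (\<Sum>b\<in>S a. C * cmod (\<xi> b))"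
      using C(2)[OF that(2)] by (intro sum_mono) (auto simp: norm_mult S_def intro!: mult_right_mono)
    finally show ?thesis by (simp add: sum_distrib_left)
  qed
  \<comment> \<open>A row contributes \<open>C N\<close>, and the multiplicity \<open>N\<close> of each column only \<open>N\<^sup>1\<^sup>/\<^sup>p \<le> N\<close>.\<close>
  define D where "D = C * real N * real N"
  have D: "0 \<le> D" using C by (simp add: D_def)
  have bound: "lp_norm p F (?T \<xi>) \<le> D * lp_norm p B \<xi>"
    if \<xi>: "\<xi> \<in> carr ?E" and F: "finite F" "F \<subseteq> A" for \<xi> F
  proof -
    have mem: "lp_mem p B \<xi>" using \<xi> carrE by blast
    have n: "0 \<le> lp_norm p B \<xi>" by (rule lp_norm_nonneg[OF mem])
    show ?thesis
    proof (cases "p = \<infinity>")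
      case True
      have "cmod (?T \<xi> a) \<le> D * lp_norm p B \<xi>" if a: "a \<in> F" for a
      proof -
        have aA: "a \<in> A" using a F by blast
        have "(\<Sum>b\<in>S a. cmod (\<xi> b)) \<le> of_nat (card (S a)) * lp_norm p B \<xi>"
          by (rule sum_bounded_above) (use lp_point_le[OF p mem] S(3)[OF aA] in auto)
        also have "\<dots> \<le> real N * real N * lp_norm p B \<xi>"
        proof -
          have "real (card (S a)) \<le> real N" using S(2)[OF aA] by simp
          also have "\<dots> \<le> real N * real N" using N by (simp add: mult_le_cancel_left1)
          finally show ?thesis using n by (rule mult_right_mono)
        qed
        finally have "C * (\<Sum>b\<in>S a. cmod (\<xi> b)) \<le> C * (real N * real N * lp_norm p B \<xi>)"
          using C(1) by (rule mult_left_mono)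
        then show ?thesis using pt[OF \<xi> aA] by (simp add: D_def mult.assoc)
      qed
      then show ?thesis
        using lp_infinity_le_iff[of "D * lp_norm p B \<xi>" F "?T \<xi>"] n D True by simp
    next
      case False
      define r where "r = enn2real p"
      have r: "1 \<le> r" using enn2real_ge_1[OF p False] r_def by simp
      let ?x = "\<lambda>b. cmod (\<xi> b) powr r"
      define U where "U = (\<Union>a\<in>F. S a)"
      have U: "finite U" "U \<subseteq> B" using F S unfolding U_def by blast+
      have "lp_norm p U \<xi> \<le> lp_norm p B \<xi>" by (rule lp_norm_finite_le[OF p mem U])
      then have sumU: "sum ?x U \<le> lp_norm p B \<xi> powr r"
        using False n r by (simp add: lp_norm_finite[OF U(1)] r_def[symmetric] powr_root_le_iff sum_nonneg)
      have "(\<Sum>a\<in>F. cmod (?T \<xi> a) powr r) \<le> (\<Sum>a\<in>F. (C * real N) powr r * sum ?x (S a))"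
      proof (rule sum_mono)
        fix a assume "a \<in> F"
        then have a: "a \<in> A" using F by blast
        have "cmod (?T \<xi> a) powr r \<le> (C * (\<Sum>b\<in>S a. cmod (\<xi> b))) powr r"
          using r by (intro powr_mono2 pt[OF \<xi> a]) auto
        also have "\<dots> = C powr r * (\<Sum>b\<in>S a. cmod (\<xi> b)) powr r"
          using C by (simp add: powr_mult sum_nonneg)
        also have "\<dots> \<le> C powr r * (real N powr r * sum ?x (S a))"
          by (intro mult_left_mono powr_sum_le S(1,2)[OF a] r) auto
        finally show "cmod (?T \<xi> a) powr r \<le> (C * real N) powr r * sum ?x (S a)"
          using C by (simp add: powr_mult mult.assoc)
      qed
      also have "\<dots> = (C * real N) powr r * (\<Sum>a\<in>F. sum ?x (S a))"
        by (simp add: sum_distrib_left)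
      also have "(\<Sum>a\<in>F. sum ?x (S a)) \<le> real N * sum ?x U"
      proof -
        have "(\<Sum>a\<in>F. sum ?x (S a)) = (\<Sum>a\<in>F. sum ?x {b. b \<in> U \<and> b \<in> S a})"
          by (intro sum.cong refl arg_cong[where f = "sum ?x"]) (auto simp: U_def)
        also have "\<dots> = (\<Sum>b\<in>U. \<Sum>a\<in>{a. a \<in> F \<and> b \<in> S a}. ?x b)"
          by (rule sum.swap_restrict[OF F(1) U(1)])
        also have "\<dots> \<le> (\<Sum>b\<in>U. real N * ?x b)"
        proof (rule sum_mono)
          fix b assume b: "b \<in> U"
          have "card {a. a \<in> F \<and> b \<in> S a} \<le> card {a \<in> A. b \<in> J a \<and> k a b \<noteq> 0}"
            by (rule card_mono) (use cols b U F in \<open>auto simp: S_def fin_le_def\<close>)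
          also have "\<dots> \<le> N" using cols b U unfolding fin_le_def by blast
          finally show "(\<Sum>a\<in>{a. a \<in> F \<and> b \<in> S a}. ?x b) \<le> real N * ?x b"
            by (simp add: mult_right_mono)
        qed
        finally show ?thesis by (simp add: sum_distrib_left)
      qed
      also have "real N * sum ?x U \<le> real N powr r * lp_norm p B \<xi> powr r"
      proof (intro mult_mono sumU sum_nonneg)
        show "real N \<le> real N powr r" using powr_mono[of 1 r "real N"] N r by simp
      qed auto
      finally have "(\<Sum>a\<in>F. cmod (?T \<xi> a) powr r) \<le> (D * lp_norm p B \<xi>) powr r"
        using C n by (simp add: D_def powr_mult mult_left_mono mult.assoc)
      then show ?thesis
        using False D n r by (simp add: lp_norm_finite[OF F(1)] r_def[symmetric] powr_root_le_iff sum_nonneg)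
    qed
  qed
  have T_mem: "?T \<xi> \<in> carr ?F" and T_norm: "vnorm ?F (?T \<xi>) \<le> D * vnorm ?E \<xi>" if \<xi>: "\<xi> \<in> carr ?E" for \<xi>
  proof -
    have n: "0 \<le> D * lp_norm p B \<xi>" using D lp_norm_nonneg \<xi> carrE by (metis mult_nonneg_nonneg)
    have m: "lp_mem p A (?T \<xi>)" "lp_norm p A (?T \<xi>) \<le> D * lp_norm p B \<xi>"
      by (rule lp_norm_leI[OF p n bound[OF \<xi>]]; assumption)+
    then show c: "?T \<xi> \<in> carr ?F" by (simp add: carrF kernel_op_def)
    show "vnorm ?F (?T \<xi>) \<le> D * vnorm ?E \<xi>"
      using m(2) by (simp only: vnorm_lp_sum[OF p \<pi> c] vnorm_lp_sum[OF p \<sigma> \<xi>])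
  qed
  show ?thesis
  proof (rule opI[OF T_mem _ _ _ T_norm])
    show "?T x = 0" if "x \<notin> carr ?E" for x using that by (simp add: fun_eq_iff kernel_op_def)
    show "?T (x + y) = ?T x + ?T y" if "x \<in> carr ?E" "y \<in> carr ?E" for x y
    proof
      fix a
      show "?T (x + y) a = (?T x + ?T y) a"
      proof (cases "a \<in> A")
        case True
        have "?T (x + y) a = (\<Sum>b\<in>S a. k a b * (x + y) b)" by (rule T[OF E.add_mem[OF that] True])
        also have "\<dots> = ?T x a + ?T y a"
          unfolding T[OF that(1) True] T[OF that(2) True] by (simp add: distrib_left sum.distrib)
        finally show ?thesis by (simp only: plus_fun_apply)
      qed (simp add: kernel_op_def)
    qed
    show "?T (scal ?E c x) = scal ?F c (?T x)" if "x \<in> carr ?E" for c x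
    proof
      fix a
      have sc: "scal ?E = fscale" "scal ?F = fscale" by (simp_all add: lp_sum_def)
      show "?T (scal ?E c x) a = scal ?F c (?T x) a"
      proof (cases "a \<in> A")
        case True
        have "scal ?F c (?T x) a = c * ?T x a" unfolding sc by (simp add: fscale_def)
        then show ?thesis
          unfolding T[OF E.scale_mem[OF that] True] T[OF that True]
          by (simp add: sc fscale_def sum_distrib_left mult_ac)
      qed (simp add: sc fscale_def kernel_op_def)
    qed
  qed assumption+
qed

section \<open>Etale groupoids and their proper free right spaces\<close>

context algebraic_groupoid
begin

lemma units_arrows: "u \<in> units G \<Longrightarrow> u \<in> arrows G"
  and src_of_unit: "u \<in> units G \<Longrightarrow> gsrc G u = u"
  and rng_of_unit: "u \<in> units G \<Longrightarrow> grng G u = u"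
  by (auto simp: units_def)

lemma inv_mul_cancel:
  assumes "g \<in> arrows G" "h \<in> arrows G" "grng G g = grng G h"
  shows "gmul G g (gmul G (ginv G g) h) = h"
  using mul_assoc[of g "ginv G g" h] assms by (simp add: inv_closed src_inv rng_inv mul_inv rng_mul_self)

lemma mul_inv_cancel:
  assumes "g \<in> arrows G" "h \<in> arrows G" "gsrc G g = gsrc G h"
  shows "gmul G (gmul G g (ginv G h)) h = g"
  using mul_assoc[of g "ginv G h" h] mul_src[of g] assms by (simp add: inv_closed src_inv rng_inv inv_mul)

lemma inv_inv:
  assumes g: "g \<in> arrows G" shows "ginv G (ginv G g) = g"
proof -
  have "ginv G (ginv G g) = gmul G (ginv G (ginv G g)) (gmul G (ginv G g) g)"
    using mul_src[of "ginv G (ginv G g)"] g by (simp add: inv_closed src_inv rng_inv inv_mul)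
  also have "\<dots> = gmul G (gmul G (ginv G (ginv G g)) (ginv G g)) g"
    using mul_assoc[of "ginv G (ginv G g)" "ginv G g" g] g by (simp add: inv_closed src_inv rng_inv)
  also have "\<dots> = g" using g by (simp add: inv_closed src_inv inv_mul rng_mul_self)
  finally show ?thesis .
qed

lemma inv_unit:
  assumes u: "u \<in> units G" shows "ginv G u = u"
proof -
  have a: "u \<in> arrows G" using u by (rule units_arrows)
  have "gmul G u (ginv G u) = ginv G u"
    using rng_mul_self[of "ginv G u"] u a by (simp add: inv_closed rng_inv src_of_unit)
  then show ?thesis using mul_inv[OF a] rng_of_unit[OF u] by simp
qed

lemma inv_mul_inv:
  assumes "g \<in> arrows G" "h \<in> arrows G" "gsrc G g = gsrc G h"
  shows "ginv G (gmul G g (ginv G h)) = gmul G h (ginv G g)"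
proof -
  let ?k = "gmul G g (ginv G h)" and ?l = "gmul G h (ginv G g)"
  have k: "?k \<in> arrows G" "gsrc G ?k = grng G h" "grng G ?k = grng G g"
    using assms by (simp_all add: mul_closed inv_closed rng_inv src_mul src_inv rng_mul)
  have l: "?l \<in> arrows G" "gsrc G ?l = grng G g" "grng G ?l = grng G h"
    using assms by (simp_all add: mul_closed inv_closed rng_inv src_mul src_inv rng_mul)
  have "gmul G ?l ?k = gmul G (gmul G ?l g) (ginv G h)"
    using mul_assoc[of ?l g "ginv G h"] assms l by (simp add: inv_closed rng_inv)
  also have "\<dots> = grng G h" using mul_inv_cancel[of h g] assms by (simp add: mul_inv)
  finally have lk: "gmul G ?l ?k = grng G h" .
  have "ginv G ?k = gmul G (gmul G ?l ?k) (ginv G ?k)"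
    unfolding lk using rng_mul_self[of "ginv G ?k"] k by (simp add: inv_closed rng_inv)
  also have "\<dots> = gmul G ?l (gmul G ?k (ginv G ?k))"
    using k l by (intro mul_assoc) (simp_all add: inv_closed rng_inv)
  also have "\<dots> = ?l" using mul_src[OF l(1)] k l by (simp add: mul_inv)
  finally show ?thesis .
qed

end

context lc_etale_groupoid
begin

lemma topspace_unit_top: "topspace (unit_top G) = units G"
  using units_arrows by (auto simp: unit_top_def arrows_def)

lemma src_continuous: "continuous_map (gtop G) (unit_top G) (gsrc G)"
  and rng_continuous: "continuous_map (gtop G) (unit_top G) (grng G)"
  using src_local_homeo rng_local_homeo by (auto simp: local_homeomorphism_def)

text \<open>Near a unit \<open>u\<close>, an arrow \<open>x\<close> and its source lie in one sheet \<open>U\<close> of the source map and have the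
  same source, so \<open>x\<close> is a unit.\<close>

lemma units_open: "openin (gtop G) (units G)"
proof (subst openin_subopen, intro ballI)
  fix u assume u: "u \<in> units G"
  then have ua: "u \<in> topspace (gtop G)" using units_arrows by (simp add: arrows_def)
  obtain U where U: "sheet (gtop G) (unit_top G) (gsrc G) U" "u \<in> U"
    using sheet_exists[OF src_local_homeo openin_topspace ua] by metis
  have c: "continuous_map (gtop G) (gtop G) (gsrc G)"
    using src_continuous continuous_map_into_fulltopology unfolding unit_top_def by blast
  define W where "W = {x \<in> topspace (gtop G). gsrc G x \<in> U} \<inter> U"
  have "openin (gtop G) W"
    unfolding W_def by (intro openin_Int openin_continuous_map_preimage[OF c] sheet_openin[OF U(1)])
  moreover have "u \<in> W" using u ua U by (simp add: W_def src_of_unit)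
  moreover have "W \<subseteq> units G"
  proof
    fix x assume x: "x \<in> W"
    then have a: "x \<in> arrows G" by (simp add: W_def arrows_def)
    have "gsrc G (gsrc G x) = gsrc G x" using src_unit[OF a] src_of_unit by blast
    then have "gsrc G x = x" using sheet_inj[OF U(1)] x by (auto simp: W_def inj_on_def)
    then show "x \<in> units G" using src_unit[OF a] by simp
  qed
  ultimately show "\<exists>T. openin (gtop G) T \<and> u \<in> T \<and> T \<subseteq> units G" by blast
qed

lemma inv_homeomorphic: "homeomorphic_map (gtop G) (gtop G) (ginv G)"
  unfolding homeomorphic_map_maps homeomorphic_maps_def
  by (intro exI[of _ "ginv G"]) (auto simp: inv_continuous inv_inv arrows_def)

end

text \<open>The part of a correspondence that concerns the right action. The groupoid \<open>H\<close> acting on its own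
  arrows is a further instance, and for it the operators \<open>Top\<close> are the convolution operators.\<close>

locale proper_right_space = lc_etale_groupoid H for H :: "'h groupoid" +
  fixes Z :: "('g, 'h, 'z) correspondence"
  assumes csrc_local_homeo: "local_homeomorphism (ctop Z) (unit_top H) (csrc Z)"
    and ract_continuous: "continuous_map (ract_dom H Z) (ctop Z) (\<lambda>(z, h). ract Z z h)"
    and csrc_ract: "\<lbrakk>z \<in> cpts Z; h \<in> arrows H; csrc Z z = grng H h\<rbrakk> \<Longrightarrow> csrc Z (ract Z z h) = gsrc H h"
    and ract_unit: "z \<in> cpts Z \<Longrightarrow> ract Z z (csrc Z z) = z"
    and ract_mul: "\<lbrakk>z \<in> cpts Z; h \<in> arrows H; h' \<in> arrows H; csrc Z z = grng H h; gsrc H h = grng H h'\<rbrakk>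
          \<Longrightarrow> ract Z z (gmul H h h') = ract Z (ract Z z h) h'"
    and ract_free: "\<lbrakk>z \<in> cpts Z; h \<in> arrows H; csrc Z z = grng H h; ract Z z h = z\<rbrakk> \<Longrightarrow> h = csrc Z z"
    and ract_proper: "proper_map (ract_dom H Z) (prod_topology (ctop Z) (ctop Z)) (\<lambda>(z, h). (ract Z z h, z))"
begin

lemma csrc_continuous: "continuous_map (ctop Z) (unit_top H) (csrc Z)"
  using csrc_local_homeo by (simp add: local_homeomorphism_def)

lemma csrc_unit: "z \<in> cpts Z \<Longrightarrow> csrc Z z \<in> units H"
  using continuous_map_image_subset_topspace[OF csrc_continuous] topspace_unit_top by (auto simp: cpts_def)

lemma topspace_ract_dom: "(z, h) \<in> topspace (ract_dom H Z) \<longleftrightarrow> z \<in> cpts Z \<and> h \<in> arrows H \<and> csrc Z z = grng H h"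
  by (auto simp: ract_dom_def cpts_def arrows_def)

lemma ract_closed:
  assumes "z \<in> cpts Z" "h \<in> arrows H" "csrc Z z = grng H h" shows "ract Z z h \<in> cpts Z"
proof -
  have "(z, h) \<in> topspace (ract_dom H Z)" using assms by (simp add: topspace_ract_dom)
  then show ?thesis
    using continuous_map_image_subset_topspace[OF ract_continuous] by (force simp: cpts_def)
qed

lemma ract_inv_closed:
  assumes "z \<in> cpts Z" "h \<in> arrows H" "csrc Z z = gsrc H h"
  shows "ract Z z (ginv H h) \<in> cpts Z" "csrc Z (ract Z z (ginv H h)) = grng H h"
  using assms by (simp_all add: ract_closed csrc_ract inv_closed rng_inv src_inv)

lemma ract_ract_inv:
  assumes "z \<in> cpts Z" "h \<in> arrows H" "csrc Z z = grng H h"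
  shows "ract Z (ract Z z h) (ginv H h) = z"
  using ract_mul[of z h "ginv H h"] ract_unit[of z] assms by (simp add: inv_closed rng_inv mul_inv)

lemma ract_inv_ract:
  assumes "z \<in> cpts Z" "h \<in> arrows H" "csrc Z z = gsrc H h"
  shows "ract Z (ract Z z (ginv H h)) h = z"
  using ract_ract_inv[of z "ginv H h"] assms by (simp add: inv_closed rng_inv inv_inv)

text \<open>If \<open>zh = zk\<close> then \<open>kh\<^sup>-\<^sup>1\<close> fixes \<open>z\<close>, so it is a unit by freeness.\<close>

lemma ract_inj:
  assumes z: "z \<in> cpts Z" and h: "h \<in> arrows H" "csrc Z z = grng H h"
    and k: "k \<in> arrows H" "csrc Z z = grng H k" and eq: "ract Z z h = ract Z z k"
  shows "h = k"
proof -
  have s: "gsrc H h = gsrc H k" using csrc_ract[OF z h] csrc_ract[OF z k] eq by simp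
  have a: "gmul H k (ginv H h) \<in> arrows H" "grng H (gmul H k (ginv H h)) = grng H k"
    using h k s by (simp_all add: mul_closed rng_mul inv_closed rng_inv)
  have "ract Z z (gmul H k (ginv H h)) = ract Z (ract Z z h) (ginv H h)"
    using ract_mul[of z k "ginv H h"] z h k s eq by (simp add: inv_closed rng_inv)
  then have "ract Z z (gmul H k (ginv H h)) = z" using ract_ract_inv[OF z h] by simp
  then have e: "gmul H k (ginv H h) = grng H h"
    using ract_free[OF z a(1)] a(2) h k by simp
  have "k = gmul H (gmul H k (ginv H h)) h" using mul_inv_cancel[of k h] h k s by simp
  then show ?thesis using e rng_mul_self h by simp
qed

lemma continuous_map_ract:
  assumes "continuous_map T (ctop Z) f" "continuous_map T (gtop H) k"
    and "\<And>x. x \<in> topspace T \<Longrightarrow> csrc Z (f x) = grng H (k x)"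
  shows "continuous_map T (ctop Z) (\<lambda>x. ract Z (f x) (k x))"
proof -
  have "continuous_map T (ract_dom H Z) (\<lambda>x. (f x, k x))"
    unfolding ract_dom_def using assms
    by (intro continuous_map_into_subtopology continuous_map_pairedI) auto
  from continuous_map_compose[OF this ract_continuous] show ?thesis by (simp add: o_def)
qed

text \<open>The condition on the pairs is closed because the unit space is Hausdorff.\<close>

lemma compactin_fibre_product:
  assumes K: "compactin (ctop Z) K" and L: "compactin (gtop H) L"
  shows "compactin (ract_dom H Z) {(z, h). z \<in> K \<and> h \<in> L \<and> csrc Z z = grng H h}"
proof -
  let ?P = "prod_topology (ctop Z) (gtop H)"
  have "closedin ?P {x \<in> topspace ?P. (csrc Z \<circ> fst) x = (grng H \<circ> snd) x}"
    by (rule closedin_continuous_maps_eq[OF unit_Hausdorff])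
      (intro continuous_map_compose[OF continuous_map_fst csrc_continuous]
        continuous_map_compose[OF continuous_map_snd rng_continuous])+
  moreover have "compactin ?P (K \<times> L)" using K L by (simp add: compactin_Times)
  ultimately have c: "compactin ?P ({x \<in> topspace ?P. (csrc Z \<circ> fst) x = (grng H \<circ> snd) x} \<inter> K \<times> L)"
    by (rule closed_Int_compactin)
  have "{x \<in> topspace ?P. (csrc Z \<circ> fst) x = (grng H \<circ> snd) x} \<inter> K \<times> L
      = {(z, h). z \<in> K \<and> h \<in> L \<and> csrc Z z = grng H h}"
    using compactin_subset_topspace[OF K] compactin_subset_topspace[OF L] by auto
  then show ?thesis using c unfolding ract_dom_def compactin_subtopology by auto
qed

text \<open>Properness in the form in which it bounds supports: the arrows that carry some point of \<open>L\<close> into \<open>K\<close> are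
  the second coordinates of the compact preimage of \<open>K \<times> L\<close>.\<close>

lemma compactin_return_set:
  assumes K: "compactin (ctop Z) K" and L: "compactin (ctop Z) L"
  shows "compactin (gtop H) {h \<in> arrows H. \<exists>z\<in>L. csrc Z z = grng H h \<and> ract Z z h \<in> K}"
proof -
  let ?M = "{x \<in> topspace (ract_dom H Z). (\<lambda>(z, h). (ract Z z h, z)) x \<in> K \<times> L}"
  have "compactin (ract_dom H Z) ?M"
    by (rule compactin_proper_map_preimage[OF ract_proper]) (use K L in \<open>simp add: compactin_Times\<close>)
  then have c: "compactin (gtop H) (snd ` ?M)"
    by (rule image_compactin) (simp add: ract_dom_def continuous_map_from_subtopology continuous_map_snd)
  have "snd ` ?M = {h \<in> arrows H. \<exists>z\<in>L. csrc Z z = grng H h \<and> ract Z z h \<in> K}"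
  proof (intro equalityI subsetI)
    fix h assume "h \<in> {h \<in> arrows H. \<exists>z\<in>L. csrc Z z = grng H h \<and> ract Z z h \<in> K}"
    then obtain z where z: "h \<in> arrows H" "z \<in> L" "csrc Z z = grng H h" "ract Z z h \<in> K" by blast
    then have "(z, h) \<in> ?M" using compactin_subset_topspace[OF L] by (auto simp: topspace_ract_dom cpts_def)
    then show "h \<in> snd ` ?M" by force
  qed (auto simp: topspace_ract_dom)
  then show ?thesis using c by simp
qed


section \<open>Products of compactly supported functions\<close>

text \<open>On a product \<open>U \<cdot> V\<close> of sheets every point factors uniquely, the factors depend
  continuously on it, and the sum has a single term.\<close>

lemma right_C_act_sheets:
  assumes U: "sheet (ctop Z) (unit_top H) (csrc Z) U" and V: "sheet (gtop H) (unit_top H) (gsrc H) V"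
    and \<phi>: "\<phi> \<in> Cc_on (ctop Z) U" and b: "b \<in> Cc_on (gtop H) V"
  shows "right_C_act H Z \<phi> b \<in> Cfun (ctop Z)"
proof -
  let ?X = "ctop Z" and ?s = "csrc Z" and ?F = "right_C_act H Z \<phi> b"
  have VH: "V \<subseteq> arrows H" using openin_subset[OF sheet_openin[OF V]] by (simp add: arrows_def)
  define D where "D = {z \<in> topspace ?X. ?s z \<in> gsrc H ` V}"
  obtain \<sigma> where D: "openin ?X D" and cont\<sigma>: "continuous_map (subtopology ?X D) (gtop H) \<sigma>"
    and \<sigma>: "\<And>z. ?s z \<in> gsrc H ` V \<Longrightarrow> \<sigma> z \<in> V \<and> gsrc H (\<sigma> z) = ?s z" "\<And>z v. v \<in> V \<Longrightarrow> gsrc H v = ?s z \<Longrightarrow> \<sigma> z = v"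
    unfolding D_def by (rule sheet_lift[OF V csrc_continuous]) blast
  have Dc: "z \<in> cpts Z" if "z \<in> D" for z using that by (simp add: D_def cpts_def)
  have \<sigma>s: "\<sigma> z \<in> V" "\<sigma> z \<in> arrows H" "gsrc H (\<sigma> z) = ?s z" if "z \<in> D" for z
    using \<sigma>(1)[of z] that VH by (auto simp: D_def)
  \<comment> \<open>The factorisation is \<open>z = \<tau>(z) \<cdot> \<sigma>(z)\<close>; the product set is where \<open>\<tau>(z)\<close> lies in \<open>U\<close>.\<close>
  define \<tau> where "\<tau> z = ract Z z (ginv H (\<sigma> z))" for z
  have cont\<tau>: "continuous_map (subtopology ?X D) ?X \<tau>"
    unfolding \<tau>_def
  proof (rule continuous_map_ract)
    show "continuous_map (subtopology ?X D) ?X (\<lambda>z. z)"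
      using continuous_map_from_subtopology[OF continuous_map_id, of ?X D] by (simp add: id_def)
    show "continuous_map (subtopology ?X D) (gtop H) (\<lambda>z. ginv H (\<sigma> z))"
      using continuous_map_compose[OF cont\<sigma> inv_continuous] by (simp add: o_def)
    show "?s z = grng H (ginv H (\<sigma> z))" if "z \<in> topspace (subtopology ?X D)" for z
      using \<sigma>s[of z] that by (auto simp: rng_inv)
  qed
  have \<tau>: "csrc Z (\<tau> z) = grng H (\<sigma> z)" "ract Z (\<tau> z) (\<sigma> z) = z" if "z \<in> D" for z
    using ract_inv_closed(2)[OF Dc[OF that] \<sigma>s(2)[OF that]] ract_inv_ract[OF Dc[OF that] \<sigma>s(2)[OF that]]
      \<sigma>s(3)[OF that] by (simp_all add: \<tau>_def)
  define Q where "Q = {z \<in> D. \<tau> z \<in> U}"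
  have tD: "topspace (subtopology ?X D) = D" using openin_subset[OF D] by auto
  have Q: "openin ?X Q"
    using openin_trans_full[OF openin_continuous_map_preimage[OF cont\<tau> sheet_openin[OF U]] D] unfolding tD by (simp add: Q_def)
  have tQ: "topspace (subtopology ?X Q) = Q" using openin_subset[OF Q] by auto
  have inj: "inj_on ?s Q"
  proof (rule inj_onI)
    fix z z' assume z: "z \<in> Q" "z' \<in> Q" and eq: "?s z = ?s z'"
    then have d: "z \<in> D" "z' \<in> D" "\<tau> z \<in> U" "\<tau> z' \<in> U" by (auto simp: Q_def)
    have v: "\<sigma> z = \<sigma> z'" using \<sigma>(2)[of "\<sigma> z'" z] \<sigma>s[OF d(2)] eq by simp
    then have "\<tau> z = \<tau> z'" using sheet_inj[OF U] \<tau>(1) d by (simp add: inj_on_def)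
    then show "z = z'" using \<tau>(2) d v by metis
  qed
  have Haus: "Hausdorff_space (subtopology ?X Q)"
    by (rule Hausdorff_space_injective_preimage[OF unit_Hausdorff continuous_map_from_subtopology[OF csrc_continuous]])
      (use inj tQ in simp)
  have bV: "b v = 0" if "v \<notin> V" for v using b that by (simp add: Cc_on_def)
  have \<phi>U: "\<phi> z = 0" if "z \<notin> U" for z using \<phi> that by (simp add: Cc_on_def)
  have onD: "?F z = \<phi> (\<tau> z) * b (\<sigma> z)" if z: "z \<in> D" for z
  proof -
    let ?A = "{\<eta> \<in> arrows H. grng H \<eta> = ?s z}"
    have "?F z = (\<Sum>\<^sub>\<infinity>\<eta>\<in>?A. \<phi> (ract Z z \<eta>) * b (ginv H \<eta>))" using Dc[OF z] by (simp add: right_C_act_def)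
    also have "\<dots> = \<phi> (ract Z z (ginv H (\<sigma> z))) * b (ginv H (ginv H (\<sigma> z)))"
    proof (rule infsum_eq_single)
      show "ginv H (\<sigma> z) \<in> ?A" using \<sigma>s[OF z] by (simp add: inv_closed rng_inv)
      fix \<eta> assume \<eta>: "\<eta> \<in> ?A" "\<eta> \<noteq> ginv H (\<sigma> z)"
      have "ginv H \<eta> \<notin> V"
      proof
        assume "ginv H \<eta> \<in> V"
        then have "\<sigma> z = ginv H \<eta>" by (rule \<sigma>(2)) (use \<eta> in \<open>simp add: src_inv\<close>)
        then show False using \<eta> by (simp add: inv_inv)
      qed
      then show "\<phi> (ract Z z \<eta>) * b (ginv H \<eta>) = 0" by (simp add: bV)
    qed
    finally show ?thesis using \<sigma>s[OF z] by (simp add: inv_inv \<tau>_def)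
  qed
  have offD: "?F z = 0" if z: "z \<notin> D" for z
  proof (cases "z \<in> cpts Z")
    case True
    have "b (ginv H \<eta>) = 0" if "\<eta> \<in> arrows H" "grng H \<eta> = ?s z" for \<eta>
    proof (rule bV)
      show "ginv H \<eta> \<notin> V" using z True that src_inv by (force simp: D_def cpts_def)
    qed
    then show ?thesis using True by (auto simp: right_C_act_def intro!: infsum_eq_zero)
  qed (simp add: right_C_act_def)
  obtain K1 where K1: "compactin ?X K1" "K1 \<subseteq> U" "\<forall>x. x \<notin> K1 \<longrightarrow> \<phi> x = 0"
    using Cc_onD(2)[OF \<phi> sheet_openin[OF U]] by blast
  obtain K2 where K2: "compactin (gtop H) K2" "K2 \<subseteq> V" "\<forall>x. x \<notin> K2 \<longrightarrow> b x = 0"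
    using Cc_onD(2)[OF b sheet_openin[OF V]] by blast
  let ?M = "{(z, h). z \<in> K1 \<and> h \<in> K2 \<and> csrc Z z = grng H h}"
  define K where "K = (\<lambda>(z, h). ract Z z h) ` ?M"
  have K: "compactin ?X K"
    unfolding K_def by (rule image_compactin[OF compactin_fibre_product[OF K1(1) K2(1)] ract_continuous])
  have KQ: "K \<subseteq> Q"
  proof
    fix z assume "z \<in> K"
    then obtain u v where uv: "u \<in> K1" "v \<in> K2" "?s u = grng H v" "z = ract Z u v" by (auto simp: K_def)
    have m: "u \<in> cpts Z" "v \<in> arrows H" "v \<in> V" "u \<in> U"
      using uv K1 K2 VH compactin_subset_topspace[OF K1(1)] by (auto simp: cpts_def)
    have sz: "?s z = gsrc H v" using csrc_ract m uv by simp
    have "z \<in> D" using ract_closed[OF m(1,2) uv(3)] m sz uv by (auto simp: D_def cpts_def)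
    moreover have "\<tau> z = u" using \<sigma>(2)[OF m(3) sz[symmetric]] ract_ract_inv[OF m(1,2) uv(3)] uv by (simp add: \<tau>_def)
    ultimately show "z \<in> Q" using m by (simp add: Q_def)
  qed
  show ?thesis
  proof (rule Cfun_product[OF Q Haus cont\<tau> cont\<sigma> _ \<phi> sheet_openin[OF U] _ b sheet_openin[OF V] _ _ K KQ])
    show "?F z = 0" if z: "z \<notin> K" for z
    proof (cases "z \<in> D")
      case True
      have "\<not> (\<tau> z \<in> K1 \<and> \<sigma> z \<in> K2)"
      proof
        assume "\<tau> z \<in> K1 \<and> \<sigma> z \<in> K2"
        then have "(\<tau> z, \<sigma> z) \<in> ?M" using \<tau>(1)[OF True] by simp
        then have "z \<in> K" unfolding K_def using \<tau>(2)[OF True] by (metis (mono_tags, lifting) case_prod_conv imageI)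
        then show False using z by blast
      qed
      then show ?thesis using onD[OF True] K1(3) K2(3) by auto
    qed (rule offD)
  qed (use \<sigma>s(1) onD in \<open>auto simp: Q_def\<close>)
qed

text \<open>The arrows \<open>\<eta>\<close> with \<open>U \<cdot> \<eta>\<close> meeting \<open>W\<close> form an open set, on which freeness makes range and source
  jointly injective; it is Hausdorff even when the arrow space is not. Properness bounds the support.\<close>

lemma pairing_sheets:
  assumes U: "sheet (ctop Z) (unit_top H) (csrc Z) U" and W: "sheet (ctop Z) (unit_top H) (csrc Z) W"
    and \<theta>: "\<theta> \<in> Cc_on (ctop Z) U" and \<phi>: "\<phi> \<in> Cc_on (ctop Z) W"
  shows "C_pairing H Z (\<theta> \<circ> unbar) \<phi> \<in> Cfun (gtop H)"
proof -
  let ?X = "ctop Z" and ?s = "csrc Z" and ?r = "grng H" and ?F = "C_pairing H Z (\<theta> \<circ> unbar) \<phi>"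
  have UZ: "U \<subseteq> cpts Z" using openin_subset[OF sheet_openin[OF U]] by (simp add: cpts_def)
  define D where "D = {\<eta> \<in> topspace (gtop H). ?r \<eta> \<in> ?s ` U}"
  obtain \<sigma> where D: "openin (gtop H) D" and cont\<sigma>: "continuous_map (subtopology (gtop H) D) ?X \<sigma>"
    and \<sigma>: "\<And>\<eta>. ?r \<eta> \<in> ?s ` U \<Longrightarrow> \<sigma> \<eta> \<in> U \<and> ?s (\<sigma> \<eta>) = ?r \<eta>" "\<And>\<eta> u. u \<in> U \<Longrightarrow> ?s u = ?r \<eta> \<Longrightarrow> \<sigma> \<eta> = u"
    unfolding D_def by (rule sheet_lift[OF U rng_continuous]) blast
  have Da: "\<eta> \<in> arrows H" if "\<eta> \<in> D" for \<eta> using that by (simp add: D_def arrows_def)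
  have \<sigma>r: "\<sigma> \<eta> \<in> U" "\<sigma> \<eta> \<in> cpts Z" "?s (\<sigma> \<eta>) = ?r \<eta>" if "\<eta> \<in> D" for \<eta>
    using \<sigma>(1)[of \<eta>] that UZ by (auto simp: D_def)
  define \<tau> where "\<tau> \<eta> = ract Z (\<sigma> \<eta>) \<eta>" for \<eta>
  have cont\<tau>: "continuous_map (subtopology (gtop H) D) ?X \<tau>"
    unfolding \<tau>_def
  proof (rule continuous_map_ract[OF cont\<sigma>])
    show "continuous_map (subtopology (gtop H) D) (gtop H) (\<lambda>\<eta>. \<eta>)"
      using continuous_map_from_subtopology[OF continuous_map_id, of "gtop H" D] by (simp add: id_def)
  qed (use \<sigma>r in auto)
  have s\<tau>: "?s (\<tau> \<eta>) = gsrc H \<eta>" if "\<eta> \<in> D" for \<eta>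
    using csrc_ract[OF \<sigma>r(2)[OF that] Da[OF that] \<sigma>r(3)[OF that]] by (simp add: \<tau>_def)
  define Q where "Q = {\<eta> \<in> D. \<tau> \<eta> \<in> W}"
  have tD: "topspace (subtopology (gtop H) D) = D" using openin_subset[OF D] by auto
  have Q: "openin (gtop H) Q"
    using openin_trans_full[OF openin_continuous_map_preimage[OF cont\<tau> sheet_openin[OF W]] D] unfolding tD by (simp add: Q_def)
  have tQ: "topspace (subtopology (gtop H) Q) = Q" using openin_subset[OF Q] by auto
  have inj: "inj_on (\<lambda>\<eta>. (?r \<eta>, gsrc H \<eta>)) Q"
  proof (rule inj_onI)
    fix x y assume m: "x \<in> Q" "y \<in> Q" and eq: "(?r x, gsrc H x) = (?r y, gsrc H y)"
    then have d: "x \<in> D" "y \<in> D" "\<tau> x \<in> W" "\<tau> y \<in> W" by (auto simp: Q_def)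
    then have \<tau>: "\<tau> x = \<tau> y" using sheet_inj[OF W] s\<tau> eq by (simp add: inj_on_def)
    have "\<sigma> x = \<sigma> y" using \<sigma>(2)[of "\<sigma> y" x] \<sigma>r[OF d(2)] eq by simp
    then show "x = y"
      using ract_inj[OF \<sigma>r(2)[OF d(1)] Da[OF d(1)] \<sigma>r(3)[OF d(1)] Da[OF d(2)]] \<sigma>r(3)[OF d(1)] eq \<tau>
      by (simp add: \<tau>_def)
  qed
  have Haus: "Hausdorff_space (subtopology (gtop H) Q)"
  proof (rule Hausdorff_space_injective_preimage)
    show "Hausdorff_space (prod_topology (unit_top H) (unit_top H))"
      using unit_Hausdorff by (simp add: Hausdorff_space_prod_topology)
    show "continuous_map (subtopology (gtop H) Q) (prod_topology (unit_top H) (unit_top H)) (\<lambda>\<eta>. (?r \<eta>, gsrc H \<eta>))"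
      by (intro continuous_map_pairedI continuous_map_from_subtopology rng_continuous src_continuous)
  qed (use inj tQ in simp)
  have \<theta>U: "\<theta> z = 0" if "z \<notin> U" for z using \<theta> that by (simp add: Cc_on_def)
  have onD: "?F \<eta> = \<theta> (\<sigma> \<eta>) * \<phi> (\<tau> \<eta>)" if \<eta>: "\<eta> \<in> D" for \<eta>
  proof -
    let ?A = "{w \<in> cpts Z. ?s w = ?r \<eta>}"
    have "?F \<eta> = (\<Sum>\<^sub>\<infinity>w\<in>?A. \<theta> w * \<phi> (ract Z w \<eta>))" using Da[OF \<eta>] by (simp add: C_pairing_def)
    also have "\<dots> = \<theta> (\<sigma> \<eta>) * \<phi> (ract Z (\<sigma> \<eta>) \<eta>)"
    proof (rule infsum_eq_single)
      show "\<sigma> \<eta> \<in> ?A" using \<sigma>r[OF \<eta>] by simp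
      fix w assume w: "w \<in> ?A" "w \<noteq> \<sigma> \<eta>"
      then have "w \<notin> U" using \<sigma>(2)[of w \<eta>] by auto
      then show "\<theta> w * \<phi> (ract Z w \<eta>) = 0" by (simp add: \<theta>U)
    qed
    finally show ?thesis by (simp add: \<tau>_def)
  qed
  have offD: "?F \<eta> = 0" if \<eta>: "\<eta> \<notin> D" for \<eta>
  proof (cases "\<eta> \<in> arrows H")
    case True
    have "\<theta> w = 0" if "w \<in> cpts Z" "?s w = ?r \<eta>" for w
      by (rule \<theta>U) (use \<eta> True that in \<open>force simp: D_def arrows_def\<close>)
    then show ?thesis using True by (auto simp: C_pairing_def intro!: infsum_eq_zero)
  qed (simp add: C_pairing_def)
  obtain K1 where K1: "compactin ?X K1" "K1 \<subseteq> U" "\<forall>x. x \<notin> K1 \<longrightarrow> \<theta> x = 0"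
    using Cc_onD(2)[OF \<theta> sheet_openin[OF U]] by blast
  obtain K2 where K2: "compactin ?X K2" "K2 \<subseteq> W" "\<forall>x. x \<notin> K2 \<longrightarrow> \<phi> x = 0"
    using Cc_onD(2)[OF \<phi> sheet_openin[OF W]] by blast
  define K where "K = {h \<in> arrows H. \<exists>z\<in>K1. ?s z = ?r h \<and> ract Z z h \<in> K2}"
  have K: "compactin (gtop H) K" unfolding K_def by (rule compactin_return_set[OF K2(1) K1(1)])
  have KQ: "K \<subseteq> Q"
  proof
    fix h assume "h \<in> K"
    then obtain w where w: "h \<in> arrows H" "w \<in> K1" "?s w = ?r h" "ract Z w h \<in> K2" by (auto simp: K_def)
    then have wU: "w \<in> U" using K1 by blast
    then have "?r h \<in> ?s ` U" using w(3) by (metis imageI)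
    then have "h \<in> D" using w(1) by (simp add: D_def arrows_def)
    moreover have "\<tau> h = ract Z w h" using \<sigma>(2)[OF wU w(3)] by (simp add: \<tau>_def)
    ultimately show "h \<in> Q" using w(4) K2(2) by (auto simp: Q_def)
  qed
  show ?thesis
  proof (rule Cfun_product[OF Q Haus cont\<sigma> cont\<tau> _ \<theta> sheet_openin[OF U] _ \<phi> sheet_openin[OF W] _ _ K KQ])
    show "?F \<eta> = 0" if \<eta>: "\<eta> \<notin> K" for \<eta>
    proof (cases "\<eta> \<in> D")
      case True
      have "\<not> (\<sigma> \<eta> \<in> K1 \<and> \<tau> \<eta> \<in> K2)"
        using \<eta> Da[OF True] \<sigma>r(3)[OF True] by (auto simp: K_def \<tau>_def)
      then show ?thesis using onD[OF True] K1(3) K2(3) by auto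
    qed (rule offD)
  qed (use \<sigma>r(1) onD in \<open>auto simp: Q_def\<close>)
qed

end

section \<open>Uniform finiteness of supports\<close>

context proper_right_space
begin

text \<open>Bounds for the entries, columns and rows of the matrices of \<open>\<phi>\<close>. The second set is the part of the
  support in the fibre of \<open>z\<close>, the third its part in the orbit of \<open>z\<close>. All three bounds hold for sums
  with added constants.\<close>

definition tame_with :: "real \<Rightarrow> nat \<Rightarrow> ('z \<Rightarrow> complex) \<Rightarrow> bool" where
  "tame_with C N \<phi> \<longleftrightarrow> (\<forall>z\<in>cpts Z. cmod (\<phi> z) \<le> C \<and> fin_le N {w \<in> cpts Z. csrc Z w = csrc Z z \<and> \<phi> w \<noteq> 0} \<and>
     fin_le N {\<eta> \<in> arrows H. grng H \<eta> = csrc Z z \<and> \<phi> (ract Z z \<eta>) \<noteq> 0})"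

lemma compact_rng_fibres:
  assumes L: "compactin (gtop H) L"
  shows "\<exists>N. \<forall>v. fin_le N {h \<in> L. grng H h = v}"
proof -
  have "\<exists>V. sheet (gtop H) (unit_top H) (grng H) V \<and> x \<in> V" if "x \<in> L" for x
  proof -
    have "x \<in> topspace (gtop H)" using that compactin_subset_topspace[OF L] by blast
    then show ?thesis using sheet_exists[OF rng_local_homeo openin_topspace] by metis
  qed
  then obtain V where V: "\<And>x. x \<in> L \<Longrightarrow> sheet (gtop H) (unit_top H) (grng H) (V x)" "\<And>x. x \<in> L \<Longrightarrow> x \<in> V x"
    by metis
  have "\<exists>\<F>. finite \<F> \<and> \<F> \<subseteq> V ` L \<and> L \<subseteq> \<Union>\<F>"
    using L unfolding compactin_def
  proof (elim conjE allE impE)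
    show "Ball (V ` L) (openin (gtop H)) \<and> L \<subseteq> \<Union>(V ` L)" using V sheet_openin by blast
  qed
  then obtain I where I: "finite I" "I \<subseteq> L" "L \<subseteq> (\<Union>x\<in>I. V x)" by (metis finite_subset_image)
  have "fin_le (card I) {h \<in> L. grng H h = v}" for v
  proof (rule fin_le_subset[OF fin_le_UN[OF I(1)]])
    show "fin_le 1 {h \<in> V x. grng H h = v}" if "x \<in> I" for x
      by (rule fin_le_single) (use sheet_inj[OF V(1)] I that in \<open>auto simp: inj_on_def\<close>)
  qed (use I in auto)
  then show ?thesis by blast
qed

text \<open>The support meets an orbit \<open>z \<cdot> H\<close> in points \<open>w \<cdot> h\<close> with \<open>w\<close> one of them and \<open>h\<close> in a set of
  return arrows that is compact by properness; finitely many sheets of the range map cover it.\<close>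

lemma Cfun_tame:
  assumes "\<phi> \<in> Cfun (ctop Z)"
  shows "\<exists>C N. tame_with C N \<phi>"
  using csrc_local_homeo unit_locally_compact unit_Hausdorff assms
proof (induction rule: Cfun_sheet_induct)
  case subspace
  show ?case
  proof (rule subspace_fscaleI)
    show "\<exists>C N. tame_with C N (\<lambda>z. 0)"
      by (intro exI[of _ 0]) (simp add: tame_with_def fin_le_def)
  next
    fix u v assume "\<exists>C N. tame_with C N u" "\<exists>C N. tame_with C N v"
    then obtain C N D M where u: "tame_with C N u" and v: "tame_with D M v" by blast
    have "tame_with (C + D) (N + M) (\<lambda>z. u z + v z)"
      unfolding tame_with_def
    proof (intro ballI conjI)
      fix z assume z: "z \<in> cpts Z"
      show "cmod (u z + v z) \<le> C + D"
        using u v z norm_triangle_le[of "u z" "v z" "C + D"] by (simp add: tame_with_def add_mono)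
      show "fin_le (N + M) {w \<in> cpts Z. csrc Z w = csrc Z z \<and> u w + v w \<noteq> 0}"
        by (rule fin_le_subset[OF fin_le_Un[of N _ M]]) (use u v z in \<open>auto simp: tame_with_def\<close>)
      show "fin_le (N + M) {\<eta> \<in> arrows H. grng H \<eta> = csrc Z z \<and> u (ract Z z \<eta>) + v (ract Z z \<eta>) \<noteq> 0}"
        by (rule fin_le_subset[OF fin_le_Un[of N _ M]]) (use u v z in \<open>auto simp: tame_with_def\<close>)
    qed
    then show "\<exists>C N. tame_with C N (\<lambda>z. u z + v z)" by blast
  next
    fix c u assume "\<exists>C N. tame_with C N u"
    then obtain C N where u: "tame_with C N u" by blast
    have "tame_with (cmod c * C) N (\<lambda>z. c * u z)"
      unfolding tame_with_def
    proof (intro ballI conjI)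
      fix z assume z: "z \<in> cpts Z"
      show "cmod (c * u z) \<le> cmod c * C"
        using u z by (simp add: tame_with_def norm_mult mult_left_mono)
      show "fin_le N {w \<in> cpts Z. csrc Z w = csrc Z z \<and> c * u w \<noteq> 0}"
        by (rule fin_le_subset[of N]) (use u z in \<open>auto simp: tame_with_def\<close>)
      show "fin_le N {\<eta> \<in> arrows H. grng H \<eta> = csrc Z z \<and> c * u (ract Z z \<eta>) \<noteq> 0}"
        by (rule fin_le_subset[of N]) (use u z in \<open>auto simp: tame_with_def\<close>)
    qed
    then show "\<exists>C N. tame_with C N (\<lambda>z. c * u z)" by blast
  qed
next
  case (base U \<phi>)
  obtain K where K: "compactin (ctop Z) K" "K \<subseteq> U" "\<forall>x. x \<notin> K \<longrightarrow> \<phi> x = 0"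
    using Cc_onD(2)[OF base(2) sheet_openin[OF base(1)]] by blast
  have "compactin (subtopology (ctop Z) U) K" using K by (simp add: compactin_subtopology)
  then have "compact (\<phi> ` K)"
    using image_compactin[OF _ Cc_onD(1)[OF base(2) sheet_openin[OF base(1)]]] by (simp add: compactin_euclidean_iff)
  then have "bounded (\<phi> ` K)" by (rule compact_imp_bounded)
  then obtain C where C: "\<forall>y\<in>\<phi> ` K. cmod y \<le> C" unfolding bounded_iff ..
  have bound: "cmod (\<phi> z) \<le> max C 0" for z using C K(3) by (cases "z \<in> K") (auto simp: le_max_iff_disj)
  let ?L = "{h \<in> arrows H. \<exists>z\<in>K. csrc Z z = grng H h \<and> ract Z z h \<in> K}"
  obtain N where N: "\<And>v. fin_le N {h \<in> ?L. grng H h = v}"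
    using compact_rng_fibres[OF compactin_return_set[OF K(1) K(1)]] by blast
  have "tame_with (max C 0) (N + 1) \<phi>"
    unfolding tame_with_def
  proof (intro ballI conjI bound)
    fix z assume z: "z \<in> cpts Z"
    show "fin_le (N + 1) {w \<in> cpts Z. csrc Z w = csrc Z z \<and> \<phi> w \<noteq> 0}"
    proof (rule fin_le_subset[OF fin_le_single order_refl])
      fix x y assume "x \<in> {w \<in> cpts Z. csrc Z w = csrc Z z \<and> \<phi> w \<noteq> 0}" "y \<in> {w \<in> cpts Z. csrc Z w = csrc Z z \<and> \<phi> w \<noteq> 0}"
      then show "x = y" using sheet_inj[OF base(1)] K unfolding inj_on_def by (metis (mono_tags, lifting) mem_Collect_eq subsetD)
    qed simp
    let ?S = "{\<eta> \<in> arrows H. grng H \<eta> = csrc Z z \<and> \<phi> (ract Z z \<eta>) \<noteq> 0}"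
    show "fin_le (N + 1) ?S"
    proof (cases "?S = {}")
      case True
      show ?thesis unfolding True by (simp add: fin_le_def)
    next
      case False
      then obtain \<eta>0 where e: "\<eta>0 \<in> arrows H" "grng H \<eta>0 = csrc Z z" "\<phi> (ract Z z \<eta>0) \<noteq> 0" by auto
      let ?w = "ract Z z \<eta>0"
      have w: "?w \<in> K" "?w \<in> cpts Z" "csrc Z ?w = gsrc H \<eta>0"
        using e K z ract_closed csrc_ract by auto
      have "?S \<subseteq> gmul H \<eta>0 ` {h \<in> ?L. grng H h = gsrc H \<eta>0}"
      proof
        fix \<eta> assume "\<eta> \<in> ?S"
        then have \<eta>: "\<eta> \<in> arrows H" "grng H \<eta> = csrc Z z" "ract Z z \<eta> \<in> K" using K by auto
        let ?h = "gmul H (ginv H \<eta>0) \<eta>"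
        have h: "?h \<in> arrows H" "grng H ?h = gsrc H \<eta>0"
          using e \<eta> by (simp_all add: mul_closed rng_mul inv_closed src_inv rng_inv)
        have "ract Z ?w ?h = ract Z (ract Z ?w (ginv H \<eta>0)) \<eta>"
          using e \<eta> w by (intro ract_mul) (simp_all add: inv_closed rng_inv src_inv)
        also have "\<dots> = ract Z z \<eta>" using ract_ract_inv[OF z e(1)] e by simp
        finally have "?h \<in> ?L" using h w \<eta> by auto
        moreover have "\<eta> = gmul H \<eta>0 ?h" using inv_mul_cancel[of \<eta>0 \<eta>] e \<eta> by simp
        ultimately show "\<eta> \<in> gmul H \<eta>0 ` {h \<in> ?L. grng H h = gsrc H \<eta>0}" using h by blast
      qed
      then have "fin_le N ?S" by (rule fin_le_image[OF N])
      then show ?thesis by (rule fin_le_subset) auto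
    qed
  qed
  then show ?case by blast
qed

lemma tame_rows:
  assumes "tame_with C N \<phi>" "z \<in> cpts Z"
  shows "fin_le N {h \<in> arrows H. gsrc H h = csrc Z z \<and> \<phi> (ract Z z (ginv H h)) \<noteq> 0}"
proof (rule fin_le_image)
  show "fin_le N {\<eta> \<in> arrows H. grng H \<eta> = csrc Z z \<and> \<phi> (ract Z z \<eta>) \<noteq> 0}"
    using assms by (simp add: tame_with_def)
  show "{h \<in> arrows H. gsrc H h = csrc Z z \<and> \<phi> (ract Z z (ginv H h)) \<noteq> 0}
      \<subseteq> ginv H ` {\<eta> \<in> arrows H. grng H \<eta> = csrc Z z \<and> \<phi> (ract Z z \<eta>) \<noteq> 0}"
  proof
    fix h assume h: "h \<in> {h \<in> arrows H. gsrc H h = csrc Z z \<and> \<phi> (ract Z z (ginv H h)) \<noteq> 0}"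
    then have "h = ginv H (ginv H h)" "ginv H h \<in> arrows H" "grng H (ginv H h) = csrc Z z"
      by (simp_all add: inv_inv inv_closed rng_inv)
    then show "h \<in> ginv H ` {\<eta> \<in> arrows H. grng H \<eta> = csrc Z z \<and> \<phi> (ract Z z \<eta>) \<noteq> 0}" using h by blast
  qed
qed

text \<open>Translation by \<open>h\<close> identifies the column of \<open>h\<close> with the fibre over the range of \<open>h\<close>.\<close>

lemma tame_cols:
  assumes t: "tame_with C N \<phi>" and h: "h \<in> arrows H"
  shows "fin_le N {z \<in> cpts Z. csrc Z z = gsrc H h \<and> \<phi> (ract Z z (ginv H h)) \<noteq> 0}" (is "fin_le N ?S")
proof (cases "?S = {}")
  case False
  then obtain z0 where z0: "z0 \<in> cpts Z" "csrc Z z0 = gsrc H h" by blast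
  show ?thesis
  proof (rule fin_le_image)
    show "fin_le N {w \<in> cpts Z. csrc Z w = grng H h \<and> \<phi> w \<noteq> 0}"
      using t ract_inv_closed[OF z0(1) h z0(2)] by (force simp: tame_with_def)
    show "?S \<subseteq> (\<lambda>w. ract Z w h) ` {w \<in> cpts Z. csrc Z w = grng H h \<and> \<phi> w \<noteq> 0}"
    proof
      fix z assume z: "z \<in> ?S"
      then have "z = ract Z (ract Z z (ginv H h)) h" using ract_inv_ract h by simp
      moreover have "ract Z z (ginv H h) \<in> cpts Z" "csrc Z (ract Z z (ginv H h)) = grng H h"
        using ract_inv_closed z h by auto
      ultimately show "z \<in> (\<lambda>w. ract Z w h) ` {w \<in> cpts Z. csrc Z w = grng H h \<and> \<phi> w \<noteq> 0}"
        using z by blast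
    qed
  qed
next
  case True
  show ?thesis unfolding True by (simp add: fin_le_def)
qed

lemma fibres_in_units: "gsrc H ` arrows H \<subseteq> units H" "csrc Z ` cpts Z \<subseteq> units H"
  using src_unit csrc_unit by auto

lemma banach_EH: "1 \<le> p \<Longrightarrow> banach_space (EH p H)"
  and banach_EZ: "1 \<le> p \<Longrightarrow> banach_space (EZ p H Z)"
  unfolding EH_def EZ_def by (simp_all add: banach_lp_sum fibres_in_units)

text \<open>Normalises the constants for \<open>kernel_bounded\<close>, which asks for \<open>C \<ge> 0\<close> and \<open>N \<ge> 1\<close>.\<close>

lemma tame_weaken: "tame_with C N \<phi> \<Longrightarrow> tame_with (max C 0) (N + 1) \<phi>"
  unfolding tame_with_def by (auto simp: le_max_iff_disj intro: fin_le_subset)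

lemma Top_kernel: "Top p H Z \<phi> =
    kernel_op (EH p H) (cpts Z) (\<lambda>z. {h \<in> arrows H. gsrc H h = csrc Z z}) (\<lambda>z h. \<phi> (ract Z z (ginv H h)))"
  by (simp add: Top_def kernel_op_def)

lemma Sop_kernel: "Sop p H Z \<psi> =
    kernel_op (EZ p H Z) (arrows H) (\<lambda>h. {z \<in> cpts Z. csrc Z z = gsrc H h}) (\<lambda>h z. \<psi> (bar (ract Z z (ginv H h))))"
  by (simp add: Sop_def kernel_op_def)

lemma Top_bounded:
  assumes p: "1 \<le> p" and \<phi>: "\<phi> \<in> Cfun (ctop Z)"
  shows "Top p H Z \<phi> \<in> carr (bounded_ops (EH p H) (EZ p H Z))"
proof -
  obtain C N where "tame_with C N \<phi>" using Cfun_tame[OF \<phi>] by blast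
  then have t: "tame_with (max C 0) (N + 1) \<phi>" by (rule tame_weaken)
  show ?thesis
    unfolding Top_kernel EH_def EZ_def
  proof (rule kernel_bounded[OF p fibres_in_units, where C = "max C 0" and N = "N + 1"])
    show "cmod (\<phi> (ract Z z (ginv H h))) \<le> max C 0"
      if "z \<in> cpts Z" "h \<in> {h \<in> arrows H. gsrc H h = csrc Z z}" for z h
      using t ract_inv_closed(1)[of z h] that by (simp add: tame_with_def)
  qed (auto intro!: fin_le_subset[OF tame_rows[OF t]] fin_le_subset[OF tame_cols[OF t]])
qed

lemma Sop_bounded:
  assumes p: "1 \<le> p" and \<psi>: "\<psi> \<circ> bar \<in> Cfun (ctop Z)"
  shows "Sop p H Z \<psi> \<in> carr (bounded_ops (EZ p H Z) (EH p H))"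
proof -
  obtain C N where "tame_with C N (\<psi> \<circ> bar)" using Cfun_tame[OF \<psi>] by blast
  then have t: "tame_with (max C 0) (N + 1) (\<psi> \<circ> bar)" by (rule tame_weaken)
  show ?thesis
    unfolding Sop_kernel EH_def EZ_def
  proof (rule kernel_bounded[OF p fibres_in_units(2,1), where C = "max C 0" and N = "N + 1"])
    show "cmod (\<psi> (bar (ract Z z (ginv H h)))) \<le> max C 0"
      if "h \<in> arrows H" "z \<in> {z \<in> cpts Z. csrc Z z = gsrc H h}" for z h
      using t ract_inv_closed(1)[of z h] that by (simp add: tame_with_def)
  qed (auto intro!: fin_le_subset[OF tame_rows[OF t]] fin_le_subset[OF tame_cols[OF t]])
qed

lemma bij_ract:
  assumes h: "h \<in> arrows H"
  shows "bij_betw (\<lambda>z. ract Z z (ginv H h)) {z \<in> cpts Z. csrc Z z = gsrc H h} {w \<in> cpts Z. csrc Z w = grng H h}"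
  by (rule bij_betw_byWitness[where f' = "\<lambda>w. ract Z w h"])
    (use h in \<open>auto simp: ract_inv_ract ract_ract_inv ract_inv_closed ract_closed csrc_ract\<close>)

end

definition self_space :: "'h groupoid \<Rightarrow> ('h, 'h, 'h) correspondence" where
  "self_space H = \<lparr>ctop = gtop H, crng = grng H, csrc = gsrc H, lact = gmul H, ract = gmul H\<rparr>"

lemma self_space_simps [simp]:
  "ctop (self_space H) = gtop H" "csrc (self_space H) = gsrc H" "ract (self_space H) = gmul H"
  "cpts (self_space H) = arrows H"
  by (simp_all add: self_space_def cpts_def arrows_def)

context lc_etale_groupoid
begin

lemma bij_gmul:
  assumes k: "k \<in> arrows G"
  shows "bij_betw (\<lambda>h. gmul G k (ginv G h)) {h \<in> arrows G. gsrc G h = gsrc G k} {\<eta> \<in> arrows G. grng G \<eta> = grng G k}"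
proof (rule bij_betw_byWitness[where f' = "\<lambda>\<eta>. gmul G (ginv G \<eta>) k"])
  show "\<forall>h\<in>{h \<in> arrows G. gsrc G h = gsrc G k}. gmul G (ginv G (gmul G k (ginv G h))) k = h"
    using k by (simp add: inv_mul_inv mul_inv_cancel)
  show "\<forall>\<eta>\<in>{\<eta> \<in> arrows G. grng G \<eta> = grng G k}. gmul G k (ginv G (gmul G (ginv G \<eta>) k)) = \<eta>"
  proof
    fix \<eta> assume \<eta>: "\<eta> \<in> {\<eta> \<in> arrows G. grng G \<eta> = grng G k}"
    have "ginv G (gmul G (ginv G \<eta>) k) = gmul G (ginv G k) \<eta>"
      using inv_mul_inv[of "ginv G \<eta>" "ginv G k"] k \<eta> by (simp add: inv_closed src_inv inv_inv)
    then show "gmul G k (ginv G (gmul G (ginv G \<eta>) k)) = \<eta>" using inv_mul_cancel[of k \<eta>] k \<eta> by simp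
  qed
qed (use k in \<open>auto simp: mul_closed inv_closed src_inv rng_inv rng_mul src_mul\<close>)

text \<open>Right translation is proper because \<open>(z, h) \<mapsto> (zh, z)\<close> has the continuous inverse
  \<open>(x, z) \<mapsto> (z, z\<^sup>-\<^sup>1x)\<close> on the pairs with equal range, and these form a closed set.\<close>

lemma self_space_proper:
  "proper_map (ract_dom G (self_space G)) (prod_topology (gtop G) (gtop G)) (\<lambda>(z, h). (gmul G z h, z))"
proof -
  let ?D = "ract_dom G (self_space G)" and ?P = "prod_topology (gtop G) (gtop G)"
  let ?f = "\<lambda>(z, h). (gmul G z h, z)"
  have D: "?D = subtopology ?P {(g, h). gsrc G g = grng G h}" by (simp add: ract_dom_def)
  have tD: "(z, h) \<in> topspace ?D \<longleftrightarrow> z \<in> arrows G \<and> h \<in> arrows G \<and> gsrc G z = grng G h" for z h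
    by (auto simp: D arrows_def)
  have cancel: "gmul G (ginv G z) (gmul G z h) = h" if "(z, h) \<in> topspace ?D" for z h
    using inv_mul_cancel[of "ginv G z" h] that by (simp add: tD inv_closed rng_inv inv_inv)
  define R where "R = {x \<in> topspace ?P. (grng G \<circ> fst) x = (grng G \<circ> snd) x}"
  have R: "closedin ?P R"
    unfolding R_def
    by (rule closedin_continuous_maps_eq[OF unit_Hausdorff])
      (intro continuous_map_compose[OF continuous_map_fst rng_continuous]
        continuous_map_compose[OF continuous_map_snd rng_continuous])+
  have tR: "topspace (subtopology ?P R) = R" using closedin_subset[OF R] by auto
  let ?g = "\<lambda>x. (snd x, gmul G (ginv G (snd x)) (fst x))"
  have c: "continuous_map (subtopology ?P R) ?D ?g"
  proof -
    have f: "continuous_map (subtopology ?P R) (gtop G) fst" and s: "continuous_map (subtopology ?P R) (gtop G) snd"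
      by (intro continuous_map_from_subtopology continuous_map_fst continuous_map_snd)+
    have i: "continuous_map (subtopology ?P R) (gtop G) (\<lambda>x. ginv G (snd x))"
      using continuous_map_compose[OF s inv_continuous] by (simp add: o_def)
    have m: "snd x \<in> arrows G \<and> fst x \<in> arrows G \<and> grng G (fst x) = grng G (snd x)" if "x \<in> R" for x
      using that by (auto simp: R_def arrows_def)
    have "continuous_map (subtopology ?P R) (subtopology ?P {(g, h). gsrc G g = grng G h}) (\<lambda>x. (ginv G (snd x), fst x))"
      by (intro continuous_map_into_subtopology continuous_map_pairedI i f) (use m tR in \<open>auto simp: src_inv\<close>)
    from continuous_map_compose[OF this mul_continuous]
    have "continuous_map (subtopology ?P R) (gtop G) (\<lambda>x. gmul G (ginv G (snd x)) (fst x))" by (simp add: o_def)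
    then show ?thesis
      unfolding D
      by (intro continuous_map_into_subtopology continuous_map_pairedI s)
        (use m tR in \<open>auto simp: rng_mul inv_closed src_inv rng_inv\<close>)
  qed
  have "closed_map ?D ?P ?f"
    unfolding closed_map_def
  proof (intro allI impI)
    fix C assume C: "closedin ?D C"
    have eq: "?f ` C = {x \<in> R. ?g x \<in> C}"
    proof (intro equalityI subsetI)
      fix x assume "x \<in> ?f ` C"
      then obtain z h where zh: "(z, h) \<in> C" "x = (gmul G z h, z)" by auto
      then have t: "(z, h) \<in> topspace ?D" using closedin_subset[OF C] by blast
      then have "gmul G z h \<in> arrows G" "grng G (gmul G z h) = grng G z" "z \<in> arrows G"
        by (simp_all add: tD mul_closed rng_mul)
      then show "x \<in> {x \<in> R. ?g x \<in> C}" using zh cancel[OF t] by (simp add: R_def arrows_def)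
    next
      fix x assume "x \<in> {x \<in> R. ?g x \<in> C}"
      moreover obtain a z where "x = (a, z)" by fastforce
      ultimately have az: "x = (a, z)" "a \<in> arrows G" "z \<in> arrows G" "grng G a = grng G z" "(z, gmul G (ginv G z) a) \<in> C"
        by (auto simp: R_def arrows_def)
      then have "x = ?f (z, gmul G (ginv G z) a)" by (simp add: inv_mul_cancel)
      then show "x \<in> ?f ` C" using az(5) by blast
    qed
    have "closedin (subtopology ?P R) {x \<in> R. ?g x \<in> C}"
      using closedin_continuous_map_preimage[OF c C] unfolding tR .
    then show "closedin ?P (?f ` C)" unfolding eq by (rule closedin_trans_full[OF _ R])
  qed
  moreover have "inj_on ?f (topspace ?D)"
  proof (rule inj_onI)
    fix x y assume x: "x \<in> topspace ?D" and y: "y \<in> topspace ?D" and eq: "?f x = ?f y"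
    obtain z h z' h' where xy: "x = (z, h)" "y = (z', h')" by (metis surj_pair)
    then have "z = z'" "gmul G z h = gmul G z' h'" using eq by auto
    moreover have "gmul G (ginv G z) (gmul G z h) = h" "gmul G (ginv G z') (gmul G z' h') = h'"
      using cancel x y xy by blast+
    ultimately show "x = y" using xy by metis
  qed
  ultimately show ?thesis using injective_imp_proper_eq_closed_map by blast
qed

lemma self_space_right_space: "proper_right_space G (self_space G)"
proof (unfold_locales, goal_cases)
  case (6 z h)
  then show ?case
    using inv_mul_cancel[of "ginv G z" h] by (simp add: inv_closed rng_inv inv_inv inv_mul)
qed (simp_all add: src_local_homeo mul_continuous src_mul mul_src mul_assoc[symmetric] ract_dom_def
    self_space_proper[unfolded ract_dom_def self_space_simps])

lemma EZ_self_space: "EZ p G (self_space G) = EH p G"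
  by (simp add: EZ_def EH_def)

text \<open>Convolution operators are the kernel operators of \<open>H\<close> acting on itself, under \<open>\<eta> = hk\<^sup>-\<^sup>1\<close>.\<close>

lemma Top_self_space: "Top p G (self_space G) f = lam p G f"
proof (intro ext)
  fix \<xi> h
  show "Top p G (self_space G) f \<xi> h = lam p G f \<xi> h"
  proof (cases "\<xi> \<in> carr (EH p G) \<and> h \<in> arrows G")
    case True
    then have h: "h \<in> arrows G" by blast
    have "(\<Sum>\<^sub>\<infinity>k\<in>{k \<in> arrows G. gsrc G k = gsrc G h}. f (gmul G h (ginv G k)) * \<xi> k)
       = (\<Sum>\<^sub>\<infinity>k\<in>{k \<in> arrows G. gsrc G k = gsrc G h}. f (gmul G h (ginv G k)) * \<xi> (gmul G (ginv G (gmul G h (ginv G k))) h))"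
      by (rule infsum_cong) (use h in \<open>simp add: inv_mul_inv mul_inv_cancel\<close>)
    also have "\<dots> = (\<Sum>\<^sub>\<infinity>\<eta>\<in>{\<eta> \<in> arrows G. grng G \<eta> = grng G h}. f \<eta> * \<xi> (gmul G (ginv G \<eta>) h))"
      by (rule infsum_reindex_bij_betw[OF bij_gmul[OF h]])
    finally show ?thesis using True by (simp add: Top_def lam_def)
  qed (auto simp: Top_def lam_def)
qed

lemma lam_bounded:
  assumes "1 \<le> p" "f \<in> Cfun (gtop G)"
  shows "lam p G f \<in> carr (bounded_ops (EH p G) (EH p G))"
  using proper_right_space.Top_bounded[OF self_space_right_space assms(1), of f] assms(2)
  by (simp add: Top_self_space EZ_self_space)

lemma lam_kernel: "lam p G f =
    kernel_op (EH p G) (arrows G) (\<lambda>h. {k \<in> arrows G. gsrc G k = gsrc G h}) (\<lambda>h k. f (gmul G h (ginv G k)))"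
  unfolding Top_self_space[symmetric] Top_def kernel_op_def self_space_simps ..

lemma Cfun_finite:
  assumes f: "f \<in> Cfun (gtop G)"
  shows "h \<in> arrows G \<Longrightarrow> finite {k \<in> arrows G. gsrc G k = gsrc G h \<and> f (gmul G h (ginv G k)) \<noteq> 0}"
    and "v \<in> units G \<Longrightarrow> finite {\<eta> \<in> arrows G. grng G \<eta> = v \<and> f \<eta> \<noteq> 0}"
    and "v \<in> units G \<Longrightarrow> finite {\<eta> \<in> arrows G. grng G \<eta> = v \<and> f (ginv G \<eta>) \<noteq> 0}"
proof -
  interpret self: proper_right_space G "self_space G" by (rule self_space_right_space)
  obtain C N where t: "self.tame_with C N f" using self.Cfun_tame[of f] f by auto
  show "finite {k \<in> arrows G. gsrc G k = gsrc G h \<and> f (gmul G h (ginv G k)) \<noteq> 0}" if "h \<in> arrows G"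
    using self.tame_rows[OF t] that by (simp add: fin_le_def)
  assume v: "v \<in> units G"
  note va = units_arrows[OF v]
  have "finite {\<eta> \<in> arrows G. grng G \<eta> = v \<and> f (gmul G v \<eta>) \<noteq> 0}"
    using t va src_of_unit[OF v] by (force simp: self.tame_with_def fin_le_def)
  moreover have "{\<eta> \<in> arrows G. grng G \<eta> = v \<and> f (gmul G v \<eta>) \<noteq> 0} = {\<eta> \<in> arrows G. grng G \<eta> = v \<and> f \<eta> \<noteq> 0}"
    using rng_mul_self by auto
  ultimately show "finite {\<eta> \<in> arrows G. grng G \<eta> = v \<and> f \<eta> \<noteq> 0}" by simp
  have "finite {w \<in> arrows G. gsrc G w = v \<and> f w \<noteq> 0}"
    using t va src_of_unit[OF v] by (force simp: self.tame_with_def fin_le_def)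
  moreover have "{\<eta> \<in> arrows G. grng G \<eta> = v \<and> f (ginv G \<eta>) \<noteq> 0} \<subseteq> ginv G ` {w \<in> arrows G. gsrc G w = v \<and> f w \<noteq> 0}"
  proof
    fix \<eta> assume \<eta>: "\<eta> \<in> {\<eta> \<in> arrows G. grng G \<eta> = v \<and> f (ginv G \<eta>) \<noteq> 0}"
    then have "\<eta> = ginv G (ginv G \<eta>)" "ginv G \<eta> \<in> {w \<in> arrows G. gsrc G w = v \<and> f w \<noteq> 0}"
      by (simp_all add: inv_inv inv_closed src_inv)
    then show "\<eta> \<in> ginv G ` {w \<in> arrows G. gsrc G w = v \<and> f w \<noteq> 0}" by blast
  qed
  ultimately show "finite {\<eta> \<in> arrows G. grng G \<eta> = v \<and> f (ginv G \<eta>) \<noteq> 0}"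
    using finite_surj by blast
qed

end

section \<open>Bilinearity\<close>

lemma topspace_opp_top: "topspace (opp_top X) = {w. unbar w \<in> topspace X}"
  by (auto simp: opp_top_def topspace_pullback_topology image_iff) (metis opp.collapse)

lemma bar_homeomorphic: "homeomorphic_map X (opp_top X) bar"
  and unbar_homeomorphic: "homeomorphic_map (opp_top X) X unbar"
proof -
  have "continuous_map (opp_top X) X (id \<circ> unbar)"
    unfolding opp_top_def by (rule continuous_map_pullback[OF continuous_map_id])
  then have u: "continuous_map (opp_top X) X unbar" by simp
  have b: "continuous_map X (opp_top X) bar"
    unfolding opp_top_def by (rule continuous_map_pullback') (auto simp: o_def continuous_map_id[unfolded id_def])
  show "homeomorphic_map X (opp_top X) bar" "homeomorphic_map (opp_top X) X unbar"
    unfolding homeomorphic_map_maps homeomorphic_maps_def using u b by auto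
qed

lemma Cfun_bar:
  assumes "\<psi> \<in> Cfun (opp_top X)" shows "\<psi> \<circ> bar \<in> Cfun X"
proof -
  have "\<psi> \<circ> bar = (\<lambda>x. if x \<in> topspace X then \<psi> (bar x) else 0)"
    using Cfun_zero_outside[OF assms] by (auto simp: topspace_opp_top fun_eq_iff)
  then show ?thesis using Cfun_pullback[OF bar_homeomorphic assms] by simp
qed

lemma Cfun_unbar:
  assumes "\<theta> \<in> Cfun X" shows "\<theta> \<circ> unbar \<in> Cfun (opp_top X)"
proof -
  have "\<theta> \<circ> unbar = (\<lambda>w. if w \<in> topspace (opp_top X) then \<theta> (unbar w) else 0)"
    using Cfun_zero_outside[OF assms] by (auto simp: topspace_opp_top fun_eq_iff)
  then show ?thesis using Cfun_pullback[OF unbar_homeomorphic assms] by simp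
qed

lemma bar_unbar: "(\<psi> \<circ> bar) \<circ> unbar = \<psi>"
  by (simp add: fun_eq_iff)

text \<open>Functions on sheets span both arguments, so bilinearity leaves only products of such functions to
  check.\<close>

lemma bilinear_Cfun:
  assumes Y: "locally_compact_space Y" "Hausdorff_space Y"
    and f: "local_homeomorphism X Y f" and g: "local_homeomorphism X' Y g"
    and add_left: "\<And>u v b. b \<in> Cfun X' \<Longrightarrow> B (\<lambda>x. u x + v x) b = (\<lambda>z. B u b z + B v b z)"
    and add_right: "\<And>a u v. a \<in> Cfun X \<Longrightarrow> B a (\<lambda>x. u x + v x) = (\<lambda>z. B a u z + B a v z)"
    and scale_left: "\<And>c u b. B (\<lambda>x. c * u x) b = (\<lambda>z. c * B u b z)"
    and scale_right: "\<And>c a u. B a (\<lambda>x. c * u x) = (\<lambda>z. c * B a u z)"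
    and sheets: "\<And>U V a b. sheet X Y f U \<Longrightarrow> sheet X' Y g V \<Longrightarrow> a \<in> Cc_on X U \<Longrightarrow> b \<in> Cc_on X' V \<Longrightarrow> B a b \<in> Cfun W"
    and a: "a \<in> Cfun X" and b: "b \<in> Cfun X'"
  shows "B a b \<in> Cfun W"
  using f Y a
proof (induction rule: Cfun_sheet_induct)
  case subspace
  show ?case
  proof (rule subspace_fscaleI)
    show "B (\<lambda>x. 0) b \<in> Cfun W" using scale_left[of 0 "\<lambda>x. 0" b] by (simp add: Cfun_zero)
  qed (auto simp: add_left[OF b] scale_left Cfun_add Cfun_scale)
next
  case (base U a)
  have a: "a \<in> Cfun X"
    using base Cc_on_subset_Cfun[OF sheet_openin sheet_Hausdorff[OF _ Y(2)]] by blast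
  show ?case
    using g Y b
  proof (induction rule: Cfun_sheet_induct)
    case subspace
    show ?case
    proof (rule subspace_fscaleI)
      show "B a (\<lambda>x. 0) \<in> Cfun W" using scale_right[of a 0 "\<lambda>x. 0"] by (simp add: Cfun_zero)
    qed (auto simp: add_right[OF a] scale_right Cfun_add Cfun_scale)
  qed (rule sheets[OF base(1) _ base(2)])
qed

context proper_right_space
begin

lemma Cfun_finite_rows:
  assumes "\<phi> \<in> Cfun (ctop Z)" "z \<in> cpts Z"
  shows "finite {h \<in> arrows H. gsrc H h = csrc Z z \<and> \<phi> (ract Z z (ginv H h)) \<noteq> 0}"
    and "finite {\<eta> \<in> arrows H. grng H \<eta> = csrc Z z \<and> \<phi> (ract Z z \<eta>) \<noteq> 0}"
proof -
  obtain C N where t: "tame_with C N \<phi>" using Cfun_tame[OF assms(1)] by blast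
  show "finite {h \<in> arrows H. gsrc H h = csrc Z z \<and> \<phi> (ract Z z (ginv H h)) \<noteq> 0}"
    using tame_rows[OF t assms(2)] by (simp add: fin_le_def)
  show "finite {\<eta> \<in> arrows H. grng H \<eta> = csrc Z z \<and> \<phi> (ract Z z \<eta>) \<noteq> 0}"
    using t assms(2) by (simp add: tame_with_def fin_le_def)
qed

lemma Cfun_finite_cols:
  assumes "\<phi> \<in> Cfun (ctop Z)" "h \<in> arrows H"
  shows "finite {z \<in> cpts Z. csrc Z z = gsrc H h \<and> \<phi> (ract Z z (ginv H h)) \<noteq> 0}"
proof -
  obtain C N where "tame_with C N \<phi>" using Cfun_tame[OF assms(1)] by blast
  from tame_cols[OF this assms(2)] show ?thesis by (simp add: fin_le_def)
qed

lemma Cfun_finite_fibre: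
  assumes "\<phi> \<in> Cfun (ctop Z)"
  shows "finite {w \<in> cpts Z. csrc Z w = v \<and> \<phi> w \<noteq> 0}"
proof (cases "\<exists>z\<in>cpts Z. csrc Z z = v")
  case True
  then obtain z where z: "z \<in> cpts Z" "csrc Z z = v" by blast
  obtain C N where "tame_with C N \<phi>" using Cfun_tame[OF assms] by blast
  then show ?thesis using z unfolding tame_with_def fin_le_def by blast
next
  case False
  then have e: "{w \<in> cpts Z. csrc Z w = v \<and> \<phi> w \<noteq> 0} = {}" by blast
  show ?thesis unfolding e by simp
qed

text \<open>Up to inversion of \<open>\<eta>\<close> this is a column of the matrix.\<close>

lemma Cfun_finite_translate:
  assumes "\<phi> \<in> Cfun (ctop Z)" "\<eta> \<in> arrows H"
  shows "finite {w \<in> cpts Z. csrc Z w = grng H \<eta> \<and> \<phi> (ract Z w \<eta>) \<noteq> 0}"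
  using Cfun_finite_cols[OF assms(1), of "ginv H \<eta>"] assms(2) by (simp add: inv_closed src_inv inv_inv)

lemma right_C_act_Cfun:
  assumes \<phi>: "\<phi> \<in> Cfun (ctop Z)" and b: "b \<in> Cfun (gtop H)"
  shows "right_C_act H Z \<phi> b \<in> Cfun (ctop Z)"
proof (rule bilinear_Cfun[where f = "csrc Z" and g = "gsrc H", OF unit_locally_compact unit_Hausdorff
      csrc_local_homeo src_local_homeo _ _ _ _ right_C_act_sheets \<phi> b])
  fix u v b assume b: "b \<in> Cfun (gtop H)"
  show "right_C_act H Z (\<lambda>x. u x + v x) b = (\<lambda>z. right_C_act H Z u b z + right_C_act H Z v b z)"
    using infsum_mult_add_left[of "{\<eta> \<in> arrows H. grng H \<eta> = csrc Z z}" "\<lambda>\<eta>. b (ginv H \<eta>)" for z]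
      Cfun_finite(3)[OF b csrc_unit] by (auto simp: right_C_act_def conj_assoc fun_eq_iff)
next
  fix \<phi> u v assume \<phi>: "\<phi> \<in> Cfun (ctop Z)"
  show "right_C_act H Z \<phi> (\<lambda>x. u x + v x) = (\<lambda>z. right_C_act H Z \<phi> u z + right_C_act H Z \<phi> v z)"
    using infsum_mult_add_right[of "{\<eta> \<in> arrows H. grng H \<eta> = csrc Z z}" "\<lambda>\<eta>. \<phi> (ract Z z \<eta>)" for z]
      Cfun_finite_rows(2)[OF \<phi>] by (auto simp: right_C_act_def conj_assoc fun_eq_iff)
qed (auto simp: right_C_act_def infsum_mult_scale fun_eq_iff)

lemma C_pairing_Cfun:
  assumes \<psi>: "\<psi> \<in> Cfun (opp_top (ctop Z))" and \<phi>: "\<phi> \<in> Cfun (ctop Z)"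
  shows "C_pairing H Z \<psi> \<phi> \<in> Cfun (gtop H)"
proof -
  have "C_pairing H Z ((\<psi> \<circ> bar) \<circ> unbar) \<phi> \<in> Cfun (gtop H)"
  proof (rule bilinear_Cfun[where f = "csrc Z" and g = "csrc Z" and B = "\<lambda>\<theta>. C_pairing H Z (\<theta> \<circ> unbar)",
        OF unit_locally_compact unit_Hausdorff csrc_local_homeo csrc_local_homeo _ _ _ _ pairing_sheets Cfun_bar[OF \<psi>] \<phi>])
    fix u v \<phi> assume \<phi>: "\<phi> \<in> Cfun (ctop Z)"
    show "C_pairing H Z ((\<lambda>x. u x + v x) \<circ> unbar) \<phi> = (\<lambda>z. C_pairing H Z (u \<circ> unbar) \<phi> z + C_pairing H Z (v \<circ> unbar) \<phi> z)"
      using infsum_mult_add_left[of "{w \<in> cpts Z. csrc Z w = grng H \<eta>}" "\<lambda>w. \<phi> (ract Z w \<eta>)" for \<eta>]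
        Cfun_finite_translate[OF \<phi>] by (auto simp: C_pairing_def conj_assoc fun_eq_iff)
  next
    fix \<theta> u v assume \<theta>: "\<theta> \<in> Cfun (ctop Z)"
    show "C_pairing H Z (\<theta> \<circ> unbar) (\<lambda>x. u x + v x) = (\<lambda>z. C_pairing H Z (\<theta> \<circ> unbar) u z + C_pairing H Z (\<theta> \<circ> unbar) v z)"
      using infsum_mult_add_right[of "{w \<in> cpts Z. csrc Z w = grng H \<eta>}" \<theta> for \<eta>]
        Cfun_finite_fibre[OF \<theta>] by (auto simp: C_pairing_def conj_assoc fun_eq_iff)
  qed (auto simp: C_pairing_def infsum_mult_scale fun_eq_iff)
  then show ?thesis by (simp add: bar_unbar)
qed

text \<open>Carries closure of the function space and local units from the right action to the left one.\<close>

lemma left_C_act_eq_right: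
  "left_C_act H Z b \<psi> = right_C_act H Z (\<psi> \<circ> bar) (\<lambda>\<eta>. if \<eta> \<in> topspace (gtop H) then b (ginv H \<eta>) else 0) \<circ> unbar"
  (is "_ = right_C_act H Z _ ?b \<circ> _")
proof
  fix w
  have "(\<Sum>\<^sub>\<infinity>\<eta>\<in>{\<eta> \<in> arrows H. grng H \<eta> = csrc Z (unbar w)}. b \<eta> * \<psi> (bar (ract Z (unbar w) \<eta>))) =
    (\<Sum>\<^sub>\<infinity>\<eta>\<in>{\<eta> \<in> arrows H. grng H \<eta> = csrc Z (unbar w)}. \<psi> (bar (ract Z (unbar w) \<eta>)) * ?b (ginv H \<eta>))"
    by (rule infsum_cong) (use inv_closed in \<open>auto simp: inv_inv arrows_def\<close>)
  then show "left_C_act H Z b \<psi> w = (right_C_act H Z (\<psi> \<circ> bar) ?b \<circ> unbar) w"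
    by (simp add: left_C_act_def right_C_act_def)
qed

lemma left_C_act_Cfun:
  assumes "b \<in> Cfun (gtop H)" "\<psi> \<in> Cfun (opp_top (ctop Z))"
  shows "left_C_act H Z b \<psi> \<in> Cfun (opp_top (ctop Z))"
  unfolding left_C_act_eq_right
  by (intro Cfun_unbar right_C_act_Cfun Cfun_bar assms Cfun_pullback[OF inv_homeomorphic])


section \<open>Composition of the operators\<close>

lemma Top_add:
  assumes u: "u \<in> Cfun (ctop Z)" and v: "v \<in> Cfun (ctop Z)"
  shows "Top p H Z (\<lambda>x. u x + v x) = Top p H Z u + Top p H Z v"
  unfolding Top_kernel
  by (rule kernel_op_add) (simp_all add: Cfun_finite_rows(1)[OF u] Cfun_finite_rows(1)[OF v] conj_assoc)

lemma Top_scale: "Top p H Z (\<lambda>x. c * u x) = (\<lambda>\<xi>. fscale c (Top p H Z u \<xi>))"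
  unfolding Top_kernel by (rule kernel_op_scale)

lemma Sop_add:
  assumes u: "u \<in> Cfun (opp_top (ctop Z))" and v: "v \<in> Cfun (opp_top (ctop Z))"
  shows "Sop p H Z (\<lambda>x. u x + v x) = Sop p H Z u + Sop p H Z v"
  unfolding Sop_kernel
  by (rule kernel_op_add)
    (use Cfun_finite_cols[OF Cfun_bar[OF u]] Cfun_finite_cols[OF Cfun_bar[OF v]] in \<open>simp_all add: conj_assoc\<close>)

lemma Sop_scale: "Sop p H Z (\<lambda>x. c * u x) = (\<lambda>\<xi>. fscale c (Sop p H Z u \<xi>))"
  unfolding Sop_kernel by (rule kernel_op_scale)

lemma ract_inv_gmul:
  assumes "z \<in> cpts Z" "h \<in> arrows H" "csrc Z z = gsrc H h" "k \<in> arrows H" "gsrc H k = gsrc H h"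
  shows "ract Z (ract Z z (ginv H h)) (gmul H h (ginv H k)) = ract Z z (ginv H k)"
proof -
  have "ract Z (ract Z z (ginv H h)) (gmul H h (ginv H k)) = ract Z (ract Z (ract Z z (ginv H h)) h) (ginv H k)"
    using assms by (intro ract_mul) (simp_all add: ract_inv_closed inv_closed rng_inv)
  then show ?thesis using ract_inv_ract assms by simp
qed

text \<open>In each of the three composition formulas the kernel of the composite is the matrix product of
  the kernels, and a bijection of fibres turns its entries into the entries of the stated product.\<close>

lemma Top_lam:
  assumes p: "1 \<le> p" and \<phi>: "\<phi> \<in> Cfun (ctop Z)" and b: "b \<in> Cfun (gtop H)"
  shows "Top p H Z \<phi> \<circ> lam p H b = Top p H Z (right_C_act H Z \<phi> b)"
proof -
  interpret operator_space "EH p H" "EH p H" by unfold_locales (rule banach_EH[OF p])+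
  show ?thesis
    unfolding Top_kernel lam_kernel
  proof (rule kernel_op_comp)
    fix z k assume z: "z \<in> cpts Z" and "k \<in> {h \<in> arrows H. gsrc H h = csrc Z z}"
    then have k: "k \<in> arrows H" "csrc Z z = gsrc H k" by auto
    have "right_C_act H Z \<phi> b (ract Z z (ginv H k)) =
        (\<Sum>\<^sub>\<infinity>\<eta>\<in>{\<eta> \<in> arrows H. grng H \<eta> = grng H k}. \<phi> (ract Z (ract Z z (ginv H k)) \<eta>) * b (ginv H \<eta>))"
      using ract_inv_closed[OF z k] by (simp add: right_C_act_def)
    also have "\<dots> = (\<Sum>\<^sub>\<infinity>h\<in>{h \<in> arrows H. gsrc H h = gsrc H k}.
        \<phi> (ract Z (ract Z z (ginv H k)) (gmul H k (ginv H h))) * b (ginv H (gmul H k (ginv H h))))"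
      by (rule infsum_reindex_bij_betw[OF bij_gmul[OF k(1)], symmetric])
    also have "\<dots> = (\<Sum>\<^sub>\<infinity>h\<in>{h \<in> arrows H. gsrc H h = csrc Z z}. \<phi> (ract Z z (ginv H h)) * b (gmul H h (ginv H k)))"
      unfolding k(2) by (rule infsum_cong) (simp add: ract_inv_gmul[OF z k] inv_mul_inv k)
    finally show "right_C_act H Z \<phi> b (ract Z z (ginv H k)) =
        (\<Sum>\<^sub>\<infinity>h\<in>{h \<in> arrows H. gsrc H h = csrc Z z}. \<phi> (ract Z z (ginv H h)) * b (gmul H h (ginv H k)))" .
  qed (use op_mem[OF lam_bounded[OF p b]] Cfun_finite_rows(1)[OF \<phi>] Cfun_finite(1)[OF b]
      in \<open>simp_all add: conj_assoc lam_kernel[symmetric]\<close>)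
qed

lemma Sop_mem:
  assumes "1 \<le> p" "\<psi> \<in> Cfun (opp_top (ctop Z))"
  shows "Sop p H Z \<psi> \<in> carr (bounded_ops (EZ p H Z) (EH p H))"
  by (rule Sop_bounded[OF assms(1) Cfun_bar[OF assms(2)]])

lemma lam_Sop:
  assumes p: "1 \<le> p" and b: "b \<in> Cfun (gtop H)" and \<psi>: "\<psi> \<in> Cfun (opp_top (ctop Z))"
  shows "lam p H b \<circ> Sop p H Z \<psi> = Sop p H Z (left_C_act H Z b \<psi>)"
proof -
  interpret operator_space "EZ p H Z" "EH p H" by unfold_locales (rule banach_EH[OF p] banach_EZ[OF p])+
  show ?thesis
    unfolding Sop_kernel lam_kernel
  proof (rule kernel_op_comp)
    fix h z assume h: "h \<in> arrows H" and "z \<in> {z \<in> cpts Z. csrc Z z = gsrc H h}"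
    then have z: "z \<in> cpts Z" "csrc Z z = gsrc H h" by auto
    have "left_C_act H Z b \<psi> (bar (ract Z z (ginv H h))) =
        (\<Sum>\<^sub>\<infinity>\<eta>\<in>{\<eta> \<in> arrows H. grng H \<eta> = grng H h}. b \<eta> * \<psi> (bar (ract Z (ract Z z (ginv H h)) \<eta>)))"
      using ract_inv_closed[OF z(1) h z(2)] by (simp add: left_C_act_def)
    also have "\<dots> = (\<Sum>\<^sub>\<infinity>k\<in>{k \<in> arrows H. gsrc H k = gsrc H h}.
        b (gmul H h (ginv H k)) * \<psi> (bar (ract Z (ract Z z (ginv H h)) (gmul H h (ginv H k)))))"
      by (rule infsum_reindex_bij_betw[OF bij_gmul[OF h], symmetric])
    also have "\<dots> = (\<Sum>\<^sub>\<infinity>k\<in>{k \<in> arrows H. gsrc H k = gsrc H h}. b (gmul H h (ginv H k)) * \<psi> (bar (ract Z z (ginv H k))))"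
      by (rule infsum_cong) (simp add: ract_inv_gmul[OF z(1) h z(2)])
    finally show "left_C_act H Z b \<psi> (bar (ract Z z (ginv H h))) =
        (\<Sum>\<^sub>\<infinity>k\<in>{k \<in> arrows H. gsrc H k = gsrc H h}. b (gmul H h (ginv H k)) * \<psi> (bar (ract Z z (ginv H k))))" .
  qed (use op_mem[OF Sop_mem[OF p \<psi>]] Cfun_finite_cols[OF Cfun_bar[OF \<psi>]] Cfun_finite(1)[OF b]
      in \<open>simp_all add: conj_assoc Sop_kernel[symmetric]\<close>)
qed

lemma Sop_Top:
  assumes p: "1 \<le> p" and \<psi>: "\<psi> \<in> Cfun (opp_top (ctop Z))" and \<phi>: "\<phi> \<in> Cfun (ctop Z)"
  shows "Sop p H Z \<psi> \<circ> Top p H Z \<phi> = lam p H (C_pairing H Z \<psi> \<phi>)"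
proof -
  interpret operator_space "EH p H" "EZ p H Z" by unfold_locales (rule banach_EH[OF p] banach_EZ[OF p])+
  show ?thesis
    unfolding Sop_kernel Top_kernel lam_kernel
  proof (rule kernel_op_comp)
    fix h k assume h: "h \<in> arrows H" and "k \<in> {k \<in> arrows H. gsrc H k = gsrc H h}"
    then have k: "k \<in> arrows H" "gsrc H k = gsrc H h" by auto
    have "C_pairing H Z \<psi> \<phi> (gmul H h (ginv H k)) =
        (\<Sum>\<^sub>\<infinity>w\<in>{w \<in> cpts Z. csrc Z w = grng H h}. \<psi> (bar w) * \<phi> (ract Z w (gmul H h (ginv H k))))"
      using h k by (simp add: C_pairing_def mul_closed rng_mul inv_closed rng_inv)
    also have "\<dots> = (\<Sum>\<^sub>\<infinity>z\<in>{z \<in> cpts Z. csrc Z z = gsrc H h}.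
        \<psi> (bar (ract Z z (ginv H h))) * \<phi> (ract Z (ract Z z (ginv H h)) (gmul H h (ginv H k))))"
      by (rule infsum_reindex_bij_betw[OF bij_ract[OF h], symmetric])
    also have "\<dots> = (\<Sum>\<^sub>\<infinity>z\<in>{z \<in> cpts Z. csrc Z z = gsrc H h}. \<psi> (bar (ract Z z (ginv H h))) * \<phi> (ract Z z (ginv H k)))"
      by (rule infsum_cong) (simp add: ract_inv_gmul[OF _ h _ k])
    finally show "C_pairing H Z \<psi> \<phi> (gmul H h (ginv H k)) =
        (\<Sum>\<^sub>\<infinity>z\<in>{z \<in> cpts Z. csrc Z z = gsrc H h}. \<psi> (bar (ract Z z (ginv H h))) * \<phi> (ract Z z (ginv H k)))" .
  qed (use op_mem[OF Top_bounded[OF p \<phi>]] Cfun_finite_cols[OF Cfun_bar[OF \<psi>]] Cfun_finite_rows(1)[OF \<phi>]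
      in \<open>simp_all add: conj_assoc Top_kernel[symmetric]\<close>)
qed


section \<open>Local units\<close>

text \<open>A function on the unit space that equals 1 on the compact set of sources of the support
  acts as the identity, so every operator from \<open>C(Z)\<close> lies in the image of the action itself.\<close>

lemma local_unit:
  assumes \<theta>: "\<theta> \<in> Cfun (ctop Z)"
  obtains b where "b \<in> Cfun (gtop H)" "\<And>h. h \<notin> units H \<Longrightarrow> b h = 0" "\<And>z. \<theta> z \<noteq> 0 \<Longrightarrow> b (csrc Z z) = 1"
proof -
  obtain K where K: "compactin (unit_top H) K" "\<forall>z. \<theta> z \<noteq> 0 \<longrightarrow> z \<in> topspace (ctop Z) \<and> csrc Z z \<in> K"
    using Cfun_support_image[OF csrc_continuous \<theta>] by blast
  obtain g C where g: "continuous_map (unit_top H) euclideanreal g" "\<And>y. y \<in> K \<Longrightarrow> g y = 1"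
    "compactin (unit_top H) C" "\<And>y. y \<in> topspace (unit_top H) \<Longrightarrow> y \<notin> C \<Longrightarrow> g y = 0"
    using Urysohn_compact_support[OF unit_locally_compact unit_Hausdorff K(1) compactin_subset_topspace[OF K(1)] openin_topspace]
    by metis
  define b where "b h = (if h \<in> units H then complex_of_real (g h) else 0)" for h
  have "b \<in> Cc_on (gtop H) (units H)"
  proof (rule Cc_onI)
    have "continuous_map (unit_top H) euclidean b"
      by (rule continuous_map_eq[OF continuous_map_of_real[OF g(1)]]) (simp add: b_def topspace_unit_top)
    then show "continuous_map (subtopology (gtop H) (units H)) euclidean b" by (simp add: unit_top_def)
    show "Hausdorff_space (subtopology (gtop H) (units H))" using unit_Hausdorff by (simp add: unit_top_def)
    show "compactin (gtop H) C" "C \<subseteq> units H" using g(3) by (auto simp: unit_top_def compactin_subtopology)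
    show "b h = 0" if "h \<notin> C" for h using g(4) that by (simp add: b_def topspace_unit_top)
  qed
  then have "b \<in> Cfun (gtop H)"
    using Cc_on_subset_Cfun[OF units_open] unit_Hausdorff by (auto simp: unit_top_def)
  moreover have "b (csrc Z z) = 1" if "\<theta> z \<noteq> 0" for z
    using K that g(2) csrc_unit[of z] by (simp add: b_def cpts_def)
  ultimately show thesis using that b_def by metis
qed

lemma right_local_unit:
  assumes \<phi>: "\<phi> \<in> Cfun (ctop Z)"
  shows "\<exists>b\<in>Cfun (gtop H). right_C_act H Z \<phi> b = \<phi>"
proof -
  obtain b where b: "b \<in> Cfun (gtop H)" "\<And>h. h \<notin> units H \<Longrightarrow> b h = 0" "\<And>z. \<phi> z \<noteq> 0 \<Longrightarrow> b (csrc Z z) = 1"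
    using local_unit[OF \<phi>] by metis
  have "right_C_act H Z \<phi> b z = \<phi> z" for z
  proof (cases "z \<in> cpts Z")
    case True
    have u: "csrc Z z \<in> units H" by (rule csrc_unit[OF True])
    have "right_C_act H Z \<phi> b z = \<phi> (ract Z z (csrc Z z)) * b (ginv H (csrc Z z))"
      unfolding right_C_act_def if_P[OF True]
    proof (rule infsum_eq_single)
      show "csrc Z z \<in> {\<eta> \<in> arrows H. grng H \<eta> = csrc Z z}" using u by (simp add: units_arrows rng_of_unit)
      fix \<eta> assume \<eta>: "\<eta> \<in> {\<eta> \<in> arrows H. grng H \<eta> = csrc Z z}" "\<eta> \<noteq> csrc Z z"
      have "ginv H \<eta> \<notin> units H"
      proof
        assume "ginv H \<eta> \<in> units H"
        then have "\<eta> \<in> units H" using inv_unit[of "ginv H \<eta>"] inv_inv[of \<eta>] \<eta> by simp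
        then show False using rng_of_unit \<eta> by auto
      qed
      then show "\<phi> (ract Z z \<eta>) * b (ginv H \<eta>) = 0" using b(2) by simp
    qed
    then show ?thesis using b(3)[of z] ract_unit[OF True] inv_unit[OF u] by (cases "\<phi> z = 0") auto
  qed (use Cfun_zero_outside[OF \<phi>] in \<open>auto simp: right_C_act_def cpts_def\<close>)
  then show ?thesis using b(1) by blast
qed

lemma left_local_unit:
  assumes \<psi>: "\<psi> \<in> Cfun (opp_top (ctop Z))"
  shows "\<exists>b\<in>Cfun (gtop H). left_C_act H Z b \<psi> = \<psi>"
proof -
  obtain b where b: "b \<in> Cfun (gtop H)" "right_C_act H Z (\<psi> \<circ> bar) b = \<psi> \<circ> bar"
    using right_local_unit[OF Cfun_bar[OF \<psi>]] by blast
  let ?b = "\<lambda>\<eta>. if \<eta> \<in> topspace (gtop H) then b (ginv H \<eta>) else 0"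
  have "(\<lambda>\<eta>. if \<eta> \<in> topspace (gtop H) then ?b (ginv H \<eta>) else 0) = b"
    using inv_closed inv_inv Cfun_zero_outside[OF b(1)] by (auto simp: fun_eq_iff arrows_def)
  then have "left_C_act H Z ?b \<psi> = \<psi>" by (simp only: left_C_act_eq_right b(2) bar_unbar)
  then show ?thesis using Cfun_pullback[OF inv_homeomorphic b(1)] by blast
qed

end

section \<open>Closures of spaces of operators\<close>

abbreviation closed_ops ::
  "('a::ab_group_add) nspace \<Rightarrow> ('b::ab_group_add) nspace \<Rightarrow> ('a \<Rightarrow> 'b) set \<Rightarrow> ('a \<Rightarrow> 'b) nspace" where
  "closed_ops E F S \<equiv> (bounded_ops E F)\<lparr>carr := norm_closure (bounded_ops E F) S\<rparr>"

text \<open>Completions of function spaces are taken inside spaces of operators; linearity of \<open>T\<close> makes its image a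
  subspace.\<close>

lemma banach_closed_ops:
  assumes E: "banach_space E" and F: "banach_space F"
    and C: "fscale.subspace C" and T: "\<And>f. f \<in> C \<Longrightarrow> T f \<in> carr (bounded_ops E F)"
    and add: "\<And>f g. f \<in> C \<Longrightarrow> g \<in> C \<Longrightarrow> T (\<lambda>x. f x + g x) = T f + T g"
    and scale: "\<And>c f. f \<in> C \<Longrightarrow> T (\<lambda>x. c * f x) = (\<lambda>x. scal F c (T f x))"
  shows "banach_space (closed_ops E F (T ` C))"
proof -
  interpret EF: operator_space E F by unfold_locales (use E F in auto)
  interpret W: banach_carrier EF.W by unfold_locales (rule EF.banach_bounded_ops)
  have scaleW: "T (\<lambda>x. c * f x) = scal EF.W c (T f)" if "f \<in> C" for c f
    using scale[OF that] by (simp add: EF.scal_W)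
  show ?thesis
  proof (rule W.banach_norm_closure)
    show "T ` C \<subseteq> carr EF.W" using T by blast
    show "W.vs.subspace (T ` C)"
    proof (rule W.vs.subspaceI)
      have z: "0 \<in> C" using fscale.subspace_0[OF C] .
      have "T (\<lambda>x. 0 * (0::'c \<Rightarrow> complex) x) = 0" using scaleW[OF z, of 0] by simp
      moreover have "(\<lambda>x. 0 * (0::'c \<Rightarrow> complex) x) = 0" by (simp add: fun_eq_iff)
      ultimately show "0 \<in> T ` C" using z by (metis image_eqI)
    next
      fix x y assume "x \<in> T ` C" "y \<in> T ` C"
      then obtain f g where fg: "f \<in> C" "g \<in> C" "x = T f" "y = T g" by blast
      have "(\<lambda>x. f x + g x) \<in> C" using fscale.subspace_add[OF C fg(1,2)] by (simp add: plus_fun_def)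
      then show "x + y \<in> T ` C" using add[OF fg(1,2)] fg by (metis image_eqI)
    next
      fix c x assume "x \<in> T ` C"
      then obtain f where f: "f \<in> C" "x = T f" by blast
      have "(\<lambda>x. c * f x) \<in> C" using fscale.subspace_scale[OF C f(1)] by (simp add: fscale_def)
      then show "scal EF.W c x \<in> T ` C" using scaleW[OF f(1)] f by (metis image_eqI)
    qed
  qed
qed

text \<open>The source of every bilinear map of the pair. Additivity in the second argument uses linearity of the
  first, which is available only on the carrier; off the carrier all operators vanish.\<close>

lemma contractive_comp:
  assumes B: "banach_space E" "banach_space F" "banach_space K"
    and R: "\<And>s t. s \<in> \<S> \<Longrightarrow> t \<in> \<T> \<Longrightarrow> s \<circ> t \<in> \<R>"
  shows "contractive_bilinear (closed_ops F K \<S>) (closed_ops E F \<T>) (closed_ops E K \<R>) (\<circ>)"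
proof -
  interpret EF: operator_space E F by unfold_locales (use B in auto)
  interpret FK: operator_space F K by unfold_locales (use B in auto)
  have carr: "x \<in> carr FK.W" if "x \<in> carr (closed_ops F K \<S>)" for x using that by (simp add: norm_closure_def)
  have carr': "y \<in> carr EF.W" if "y \<in> carr (closed_ops E F \<T>)" for y using that by (simp add: norm_closure_def)
  show ?thesis
    unfolding contractive_bilinear_def
  proof (intro conjI ballI allI)
    fix a b assume ab: "a \<in> carr (closed_ops F K \<S>)" "b \<in> carr (closed_ops E F \<T>)"
    note a = carr[OF ab(1)] and b = carr'[OF ab(2)]
    show "a \<circ> b \<in> carr (closed_ops E K \<R>)" using comp_norm_closure[OF B _ _ R, of a \<S> b \<T>] ab by simp
    show "vnorm (closed_ops E K \<R>) (a \<circ> b) \<le> vnorm (closed_ops F K \<S>) a * vnorm (closed_ops E F \<T>) b"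
      using comp_bounded_ops(2)[OF B a b] by simp
    show "(a + a') \<circ> b = (a \<circ> b) + (a' \<circ> b)" for a' by (simp add: fun_eq_iff)
    show "a \<circ> (b + b') = (a \<circ> b) + (a \<circ> b')" if "b' \<in> carr (closed_ops E F \<T>)" for b'
    proof
      fix x
      note b' = carr'[OF that]
      show "(a \<circ> (b + b')) x = ((a \<circ> b) + (a \<circ> b')) x"
        by (cases "x \<in> carr E")
          (simp_all add: FK.op_add[OF a EF.op_mem[OF b] EF.op_mem[OF b']] EF.op_outside[OF b] EF.op_outside[OF b'] FK.op_0[OF a])
    qed
    fix c
    show "scal (closed_ops F K \<S>) c a \<circ> b = scal (closed_ops E K \<R>) c (a \<circ> b)"
      by (simp add: bounded_ops_def fun_eq_iff)
    show "a \<circ> scal (closed_ops E F \<T>) c b = scal (closed_ops E K \<R>) c (a \<circ> b)"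
    proof
      fix x
      show "(a \<circ> scal (closed_ops E F \<T>) c b) x = scal (closed_ops E K \<R>) c (a \<circ> b) x"
        by (cases "x \<in> carr E")
          (simp_all add: bounded_ops_def FK.op_scale[OF a EF.op_mem[OF b]] EF.op_outside[OF b] FK.op_0[OF a])
    qed
  qed
qed

text \<open>Any set that contains the operators whose closure is taken has dense span; local units supply the
  inclusion.\<close>

lemma dense_span_closed_ops:
  assumes B: "banach_space E" "banach_space F"
    and S: "\<S> \<subseteq> carr (bounded_ops E F)" and G: "\<S> \<subseteq> \<G>"
  shows "norm_closure (closed_ops E F \<S>) (module.span (scal (closed_ops E F \<S>)) \<G>) = carr (closed_ops E F \<S>)"
proof -
  interpret EF: operator_space E F by unfold_locales (use B in auto)
  interpret W: banach_carrier EF.W by unfold_locales (rule EF.banach_bounded_ops)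
  have sub: "\<S> \<subseteq> W.vs.span \<G>" using G W.vs.span_superset by blast
  have "\<S> \<subseteq> norm_closure EF.W \<S>" by (rule W.subset_norm_closure[OF S])
  then have "\<exists>s\<in>W.vs.span \<G> \<inter> norm_closure EF.W \<S>. vnorm EF.W (x - s) < \<epsilon>"
    if "x \<in> norm_closure EF.W \<S>" "0 < \<epsilon>" for x \<epsilon>
    using that sub unfolding norm_closure_def[of _ \<S>] by blast
  then show ?thesis unfolding norm_closure_def[of "closed_ops E F \<S>"] by auto
qed

section \<open>The Banach pair of a correspondence\<close>

lemma correspondence_right_space:
  assumes "lc_etale_groupoid H" "groupoid_correspondence G H Z"
  shows "proper_right_space H Z"
proof -
  interpret H: lc_etale_groupoid H by (rule assms)
  interpret C: groupoid_correspondence G H Z by (rule assms)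
  show ?thesis
    by unfold_locales
      (fact C.csrc_local_homeo C.ract_continuous C.csrc_ract C.ract_unit C.ract_mul C.ract_free C.ract_proper)+
qed

theorem proposition7p9:
  fixes G :: "'g groupoid" and H :: "'h groupoid" and Z :: "('g, 'h, 'z) correspondence"
    and p :: ennreal
  assumes "lc_etale_groupoid G" and "lc_etale_groupoid H"
    and "groupoid_correspondence G H Z"
    and "1 \<le> p"
  shows "\<exists>lm rm pr.
    banach_pair (Fred p H) (\<circ>) (Xmod p H Z) lm (Ymod p H Z) rm pr \<and>
    nondegenerate_pair (Fred p H) (Xmod p H Z) lm (Ymod p H Z) rm \<and>
    lam p H ` Cfun (gtop H) \<subseteq> carr (Fred p H) \<and>
    Sop p H Z ` Cfun (opp_top (ctop Z)) \<subseteq> carr (Xmod p H Z) \<and>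
    Top p H Z ` Cfun (ctop Z) \<subseteq> carr (Ymod p H Z) \<and>
    (\<forall>\<phi> \<in> Cfun (ctop Z). \<forall>b \<in> Cfun (gtop H).
       right_C_act H Z \<phi> b \<in> Cfun (ctop Z) \<and>
       rm (Top p H Z \<phi>) (lam p H b) = Top p H Z (right_C_act H Z \<phi> b)) \<and>
    (\<forall>b \<in> Cfun (gtop H). \<forall>\<psi> \<in> Cfun (opp_top (ctop Z)).
       left_C_act H Z b \<psi> \<in> Cfun (opp_top (ctop Z)) \<and>
       lm (lam p H b) (Sop p H Z \<psi>) = Sop p H Z (left_C_act H Z b \<psi>)) \<and>
    (\<forall>\<psi> \<in> Cfun (opp_top (ctop Z)). \<forall>\<phi> \<in> Cfun (ctop Z).
       C_pairing H Z \<psi> \<phi> \<in> Cfun (gtop H) \<and>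
       pr (Sop p H Z \<psi>) (Top p H Z \<phi>) = Sop p H Z \<psi> \<circ> Top p H Z \<phi> \<and>
       Sop p H Z \<psi> \<circ> Top p H Z \<phi> = lam p H (C_pairing H Z \<psi> \<phi>))"
proof -
  interpret proper_right_space H Z by (rule correspondence_right_space[OF assms(2,3)])
  interpret self: proper_right_space H "self_space H" by (rule self_space_right_space)
  note p = assms(4)
  let ?E = "EH p H" and ?F = "EZ p H Z"
  let ?L = "lam p H ` Cfun (gtop H)" and ?S = "Sop p H Z ` Cfun (opp_top (ctop Z))" and ?T = "Top p H Z ` Cfun (ctop Z)"
  have E: "banach_space ?E" and F: "banach_space ?F" by (rule banach_EH[OF p] banach_EZ[OF p])+
  have B: "Fred p H = closed_ops ?E ?E ?L" by (simp add: Fred_def Let_def)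
  have X: "Xmod p H Z = closed_ops ?F ?E ?S" by (simp add: Xmod_def Let_def)
  have Y: "Ymod p H Z = closed_ops ?E ?F ?T" by (simp add: Ymod_def Let_def)
  have scal: "scal ?E = fscale" "scal ?F = fscale" by (simp_all add: EH_def EZ_def lp_sum_def)
  have L: "?L \<subseteq> carr (bounded_ops ?E ?E)" and S: "?S \<subseteq> carr (bounded_ops ?F ?E)" and T: "?T \<subseteq> carr (bounded_ops ?E ?F)"
    using lam_bounded[OF p] Sop_mem[OF p] Top_bounded[OF p] by blast+
  have banachB: "banach_space (Fred p H)"
    unfolding B
  proof (rule banach_closed_ops[OF E E Cfun_subspace lam_bounded[OF p]])
    show "lam p H (\<lambda>x. f x + g x) = lam p H f + lam p H g" if "f \<in> Cfun (gtop H)" "g \<in> Cfun (gtop H)" for f g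
      using self.Top_add[of f g p] that by (simp add: Top_self_space)
    show "lam p H (\<lambda>x. c * f x) = (\<lambda>x. scal ?E c (lam p H f x))" for c f
      using self.Top_scale[of p c f] by (simp add: Top_self_space scal)
  qed
  have banachX: "banach_space (Xmod p H Z)"
    unfolding X by (rule banach_closed_ops[OF F E Cfun_subspace Sop_mem[OF p]]) (simp_all add: Sop_add Sop_scale scal)
  have banachY: "banach_space (Ymod p H Z)"
    unfolding Y by (rule banach_closed_ops[OF E F Cfun_subspace Top_bounded[OF p]]) (simp_all add: Top_add Top_scale scal)
  have LL: "s \<circ> t \<in> ?L" if "s \<in> ?L" "t \<in> ?L" for s t
  proof -
    obtain f g where fg: "f \<in> Cfun (gtop H)" "g \<in> Cfun (gtop H)" "s = lam p H f" "t = lam p H g" using \<open>s \<in> ?L\<close> \<open>t \<in> ?L\<close> by blast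
    have "s \<circ> t = lam p H (right_C_act H (self_space H) f g)"
      using self.Top_lam[OF p, of f g] fg by (simp add: Top_self_space)
    moreover have "right_C_act H (self_space H) f g \<in> Cfun (gtop H)" using self.right_C_act_Cfun[of f g] fg by simp
    ultimately show ?thesis by blast
  qed
  have LS: "s \<circ> t \<in> ?S" if "s \<in> ?L" "t \<in> ?S" for s t
    using that lam_Sop[OF p] left_C_act_Cfun by auto
  have TL: "s \<circ> t \<in> ?T" if "s \<in> ?T" "t \<in> ?L" for s t
    using that Top_lam[OF p] right_C_act_Cfun by auto
  have ST: "s \<circ> t \<in> ?L" if "s \<in> ?S" "t \<in> ?T" for s t
    using that Sop_Top[OF p] C_pairing_Cfun by auto
  have algebra: "banach_algebra (Fred p H) (\<circ>)"
    unfolding banach_algebra_def using banachB contractive_comp[OF E E E LL] by (auto simp: B o_assoc)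
  have X_module: "left_banach_module (Fred p H) (\<circ>) (Xmod p H Z) (\<circ>)"
    unfolding left_banach_module_def using banachX contractive_comp[OF F E E LS] by (auto simp: B X o_assoc)
  have Y_module: "right_banach_module (Fred p H) (\<circ>) (Ymod p H Z) (\<circ>)"
    unfolding right_banach_module_def using banachY contractive_comp[OF E E F TL] by (auto simp: B Y o_assoc)
  have pair: "banach_pair (Fred p H) (\<circ>) (Xmod p H Z) (\<circ>) (Ymod p H Z) (\<circ>) (\<circ>)"
    unfolding banach_pair_def using algebra X_module Y_module contractive_comp[OF E F E ST]
    by (auto simp: B X Y o_assoc)
  have inB: "?L \<subseteq> carr (Fred p H)" and inX: "?S \<subseteq> carr (Xmod p H Z)" and inY: "?T \<subseteq> carr (Ymod p H Z)"
  proof -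
    interpret EE: operator_space ?E ?E by unfold_locales (use E in auto)
    interpret FE: operator_space ?F ?E by unfold_locales (use E F in auto)
    interpret EF: operator_space ?E ?F by unfold_locales (use E F in auto)
    show "?L \<subseteq> carr (Fred p H)" "?S \<subseteq> carr (Xmod p H Z)" "?T \<subseteq> carr (Ymod p H Z)"
      using banach_carrier.subset_norm_closure[OF banach_carrier.intro[OF EE.banach_bounded_ops] L]
        banach_carrier.subset_norm_closure[OF banach_carrier.intro[OF FE.banach_bounded_ops] S]
        banach_carrier.subset_norm_closure[OF banach_carrier.intro[OF EF.banach_bounded_ops] T]
      by (simp_all add: B X Y)
  qed
  have nondegenerate: "nondegenerate_pair (Fred p H) (Xmod p H Z) (\<circ>) (Ymod p H Z) (\<circ>)"
    unfolding nondegenerate_pair_def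
  proof
    have "?S \<subseteq> {b \<circ> x |b x. b \<in> carr (Fred p H) \<and> x \<in> carr (Xmod p H Z)}"
    proof
      fix s assume "s \<in> ?S"
      then obtain \<psi> where \<psi>: "\<psi> \<in> Cfun (opp_top (ctop Z))" "s = Sop p H Z \<psi>" by blast
      obtain b where b: "b \<in> Cfun (gtop H)" "left_C_act H Z b \<psi> = \<psi>" using left_local_unit[OF \<psi>(1)] by blast
      have "s = lam p H b \<circ> Sop p H Z \<psi>" using lam_Sop[OF p b(1) \<psi>(1)] b(2) \<psi>(2) by simp
      then show "s \<in> {b \<circ> x |b x. b \<in> carr (Fred p H) \<and> x \<in> carr (Xmod p H Z)}" using b \<psi> inB inX by blast
    qed
    from dense_span_closed_ops[OF F E S this]
    show "norm_closure (Xmod p H Z) (module.span (scal (Xmod p H Z)) {b \<circ> x |b x. b \<in> carr (Fred p H) \<and> x \<in> carr (Xmod p H Z)}) = carr (Xmod p H Z)"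
      by (simp only: X[symmetric])
  next
    have "?T \<subseteq> {y \<circ> b |y b. y \<in> carr (Ymod p H Z) \<and> b \<in> carr (Fred p H)}"
    proof
      fix t assume "t \<in> ?T"
      then obtain \<phi> where \<phi>: "\<phi> \<in> Cfun (ctop Z)" "t = Top p H Z \<phi>" by blast
      obtain b where b: "b \<in> Cfun (gtop H)" "right_C_act H Z \<phi> b = \<phi>" using right_local_unit[OF \<phi>(1)] by blast
      have "t = Top p H Z \<phi> \<circ> lam p H b" using Top_lam[OF p \<phi>(1) b(1)] b(2) \<phi>(2) by simp
      then show "t \<in> {y \<circ> b |y b. y \<in> carr (Ymod p H Z) \<and> b \<in> carr (Fred p H)}" using b \<phi> inB inY by blast
    qed
    from dense_span_closed_ops[OF E F T this]
    show "norm_closure (Ymod p H Z) (module.span (scal (Ymod p H Z)) {y \<circ> b |y b. y \<in> carr (Ymod p H Z) \<and> b \<in> carr (Fred p H)}) = carr (Ymod p H Z)"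
      by (simp only: Y[symmetric])
  qed
  show ?thesis
  proof (intro exI conjI ballI)
    show "banach_pair (Fred p H) (\<circ>) (Xmod p H Z) (\<circ>) (Ymod p H Z) (\<circ>) (\<circ>)" by (rule pair)
  qed (use nondegenerate inB inX inY right_C_act_Cfun left_C_act_Cfun C_pairing_Cfun Top_lam[OF p] lam_Sop[OF p] Sop_Top[OF p] in \<open>simp_all\<close>)
qed

end
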